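(* Let $\mathcal G=(V,E)$ be a finite connected electrical network with boundary $\partial\mathcal G$, let $\widetilde{\mathcal G}$ be its metric graph, and let $u$ be a non-negative boundary condition. Let $\mathcal L^{\widetilde{\mathcal G}}_{1/2}$ and $\Xi^{\widetilde{\mathcal G}}_u$ be an independent metric graph loop-soup and Poisson point process of boundary-to-boundary excursions, and let $\sigma$ be a random sign function as follows: $\sigma=0$ where $L^x(\mathcal L^{\widetilde{\mathcal G}}_{1/2})+L^x(\Xi^{\widetilde{\mathcal G}}_u)=0$; $\sigma$ is constant, with value in $\{-1,1\}$, on each connected component of the set where $L^x(\mathcal L^{\widetilde{\mathcal G}}_{1/2})+L^x(\Xi^{\widetilde{\mathcal G}}_u)>0$; $\sigma=1$ on each such component (cluster) that contains at least one excursion; and, conditionally on $(\mathcal L^{\widetilde{\mathcal G}}_{1/2},\Xi^{\widetilde{\mathcal G}}_u)$, the values of $\sigma$ on the components containing no excursion are independent and equal to $\pm1$ with probability $1/2$ each. Couple the metric graph GFF $\tilde\phi+u$ with boundary condition $u$ to these objects by $$\tilde\phi(x)+u(x)=\sigma(x)\sqrt2\,\big(L^x(\mathcal L^{\widetilde{\mathcal G}}_{1/2})+L^x(\Xi^{\widetilde{\mathcal G}}_u)\big)^{1/2},\qquad x\in\widetilde{\mathcal G}.$$ Then in this coupling the first passage set $\widetilde{\mathbb A}^u_0$ of $\tilde\phi+u$ of level $0$ is the union of the topological closures of the clusters of loops and excursions that contain at least one excursion (i.e. that are connected to $\partial\mathcal G$), plus $\partial\mathcal G$.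
   Context: Network and GFF. $\mathcal G=(V,E)$ is a finite connected undirected graph without multiple edges or self-loops, with conductances $C(x,y)>0$ on edges; $\partial\mathcal G\subset V$ and $V\setminus\partial\mathcal G$ are non-empty. $(\Delta^{\mathcal G}f)(x)=\sum_{y\sim x}C(x,y)(f(y)-f(x))$; the discrete GFF with zero boundary condition on $\partial \mathcal G$ has covariance the inverse of $-\Delta^{\mathcal G}$ with zero boundary conditions. A boundary condition $u$ is a function harmonic on $V\setminus\partial\mathcal G$, identified with its restriction to $\partial\mathcal G$ and interpolated linearly inside edges. In $\widetilde{\mathcal G}$ each edge is a line segment of length $C(x,y)^{-1}$; the metric graph GFF $\tilde\phi$ interpolates the discrete GFF inside edges by conditionally independent standard Brownian bridges of length $C(x,y)^{-1}$. It is known that the right-hand side of the displayed formula in the claim has the law of $\tilde\phi+u$, so the coupling makes sense. First passage set. $\widetilde{\mathbb A}^u_{-a}=\{x\in\widetilde{\mathcal G}:\exists$ a continuous path $\gamma$ from $x$ to $\partial\mathcal G$ with $\tilde\phi+u\ge-a$ on $\gamma\}$; here $a=0$. Loops and excursions. $\widetilde X$ is the diffusion on $\widetilde{\mathcal G}$ that inside each edge has generator $f\mapsto f''$ and at a vertex performs small excursions at equal rates into all adjacent edges. $\tilde m$ is the length measure, $p_t$ the transition densities, $\mathbb P^{x,x}_t$ the bridge measures, $\widetilde T$ the hitting time of $\partial\mathcal G$. $\mu^{\widetilde{\mathcal G}}_{\rm loop}(\cdot)=\int_{\widetilde{\mathcal G}}\int_0^\infty\mathbb P^{x,x}_t(\cdot,\widetilde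 T>t)p_t(x,x)\frac{dt}t\,d\tilde m(x)$, and $\mathcal L^{\widetilde{\mathcal G}}_{1/2}$ is a Poisson point process of intensity $\frac12\mu^{\widetilde{\mathcal G}}_{\rm loop}$. For $x\in\partial\mathcal G$, $\mu^{\widetilde{\mathcal G},x}_{\rm exc}(F)=\lim_{\varepsilon\to0}\varepsilon^{-1}\sum_i\mathbb E_{x_{i,\varepsilon}}[F((\widetilde X_t)_{0\le t\le\widetilde T})]$ where $x_{i,\varepsilon}$ are the points of the edges adjacent to $x$ at distance $\varepsilon$ from $x$; $\mu^{\widetilde{\mathcal G},x,y}_{\rm exc}$ is its restriction to excursions ending at $y\in\partial\mathcal G$; $\Xi_u^{\widetilde{\mathcal G}}$ is a Poisson point process of intensity $\mu^{\widetilde{\mathcal G},u}_{\rm exc}=\frac12\sum_{x,y\in\partial\mathcal G}u(x)u(y)\mu^{\widetilde{\mathcal G},x,y}_{\rm exc}$. $L^x(\cdot)$ is the total local time at $x$ (density of occupation time with respect to $\tilde m$) of the loops, resp. excursions; one takes the continuous version in $x$, with boundary value $\frac12u^2$ for the excursions. Two paths are in the same cluster if joined by a finite chain of paths with consecutive ones intersecting; the clusters are exactly the connected components of $\{x: L^x(\mathcal L^{\widetilde{\mathcal G}}_{1/2})+L^x(\Xi^{\widetilde{\mathcal G}}_u)>0\}$. *)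

theory Defs
  imports "HOL-Probability.Probability"
begin

section \<open>Electrical networks and metric graphs\<close>

text \<open>
  The vertex set is the finite type \<open>'v\<close>.  Every undirected edge is represented by both of its
  orientations.
\<close>

record 'v network =
  edges :: "('v \<times> 'v) set"
  conductance :: "'v \<Rightarrow> 'v \<Rightarrow> real"
  boundary :: "'v set"

definition electrical_network :: "'v::finite network \<Rightarrow> bool" where
  "electrical_network N \<longleftrightarrow>
     sym (edges N) \<and> irrefl (edges N) \<and>
     (\<forall>x y. (x, y) \<in> (edges N)\<^sup>*) \<and>
     (\<forall>(x, y)\<in>edges N. 0 < conductance N x y \<and> conductance N x y = conductance N y x) \<and>
     boundary N \<noteq> {} \<and> - boundary N \<noteq> {}"

definition laplacian :: "'v::finite network \<Rightarrow> ('v \<Rightarrow> real) \<Rightarrow> 'v \<Rightarrow> real" where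
  "laplacian N f x = (\<Sum>y | (x, y) \<in> edges N. conductance N x y * (f y - f x))"

definition boundary_condition :: "'v::finite network \<Rightarrow> ('v \<Rightarrow> real) \<Rightarrow> bool" where
  "boundary_condition N u \<longleftrightarrow> (\<forall>x. x \<notin> boundary N \<longrightarrow> laplacian N u x = 0)"

text \<open>
  The metric graph is realised inside \<open>real ^ 'v\<close> as the geometric realisation of the graph: a
  vertex is a unit vector and an edge is the segment joining its two end points.  The edge
  \<open>{x, y}\<close> is parametrised by its length parameter \<open>s \<in> [0, 1 / C(x,y)]\<close>, the distance from \<open>x\<close>.
  For a finite graph the subspace topology is that of the intrinsic metric; lengths enter only
  through the parametrisation.  Barycentric interpolation is linear interpolation inside the edges.
\<close>

definition vertex :: "'v::finite \<Rightarrow> real ^ 'v" where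
  "vertex x = axis x 1"

definition edge_length :: "'v::finite network \<Rightarrow> 'v \<Rightarrow> 'v \<Rightarrow> real" where
  "edge_length N x y = 1 / conductance N x y"

definition edge_point :: "'v::finite network \<Rightarrow> 'v \<Rightarrow> 'v \<Rightarrow> real \<Rightarrow> real ^ 'v" where
  "edge_point N x y s =
     (1 - s / edge_length N x y) *\<^sub>R vertex x + (s / edge_length N x y) *\<^sub>R vertex y"

definition edge_segment :: "'v::finite network \<Rightarrow> 'v \<Rightarrow> 'v \<Rightarrow> (real ^ 'v) set" where
  "edge_segment N x y = edge_point N x y ` {0..edge_length N x y}"

definition metric_graph :: "'v::finite network \<Rightarrow> (real ^ 'v) set" where
  "metric_graph N = range vertex \<union> (\<Union>(x, y)\<in>edges N. edge_segment N x y)"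

definition boundary_points :: "'v::finite network \<Rightarrow> (real ^ 'v) set" where
  "boundary_points N = vertex ` boundary N"

definition interpolate :: "('v::finite \<Rightarrow> real) \<Rightarrow> real ^ 'v \<Rightarrow> real" where
  "interpolate f p = (\<Sum>v\<in>UNIV. p $ v * f v)"

text \<open>The division by two compensates for each edge occurring in both orientations.\<close>

definition length_measure :: "'v::finite network \<Rightarrow> (real ^ 'v) measure" where
  "length_measure N =
     measure_of (metric_graph N) (sets (restrict_space borel (metric_graph N)))
       (\<lambda>B. (\<Sum>(x, y)\<in>edges N.
          emeasure lborel {s \<in> {0..edge_length N x y}. edge_point N x y s \<in> B}) / 2)"

lemma space_length_measure [simp]: "space (length_measure N) = metric_graph N"
  unfolding length_measure_def
  by (rule space_measure_of) (use sets.space_closed[of "restrict_space borel (metric_graph N)"] in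
      \<open>simp add: space_restrict_space\<close>)

lemma sets_length_measure [simp]:
  "sets (length_measure N) = sets (restrict_space borel (metric_graph N))"
proof -
  have "sets (length_measure N) =
      sigma_sets (metric_graph N) (sets (restrict_space borel (metric_graph N)))"
    unfolding length_measure_def
    by (rule sets_measure_of) (use sets.space_closed[of "restrict_space borel (metric_graph N)"] in
        \<open>simp add: space_restrict_space\<close>)
  also have "\<dots> = sets (restrict_space borel (metric_graph N))"
    using sets.sigma_sets_eq[of "restrict_space borel (metric_graph N)"]
    by (simp add: space_restrict_space)
  finally show ?thesis .
qed

lemma emeasure_length_measure:
  fixes N :: "'v::finite network"
  assumes B: "B \<in> sets (length_measure N)"
  shows "emeasure (length_measure N) B =
    (\<Sum>(x, y)\<in>edges N.
       emeasure lborel {s \<in> {0..edge_length N x y}. edge_point N x y s \<in> B}) / 2"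
proof -
  let ?S = "sets (restrict_space borel (metric_graph N))"
  let ?R = "\<lambda>x y B. {s \<in> {0..edge_length N x y}. edge_point N x y s \<in> B}"
  let ?f = "\<lambda>B. (\<Sum>(x, y)\<in>edges N. emeasure lborel (?R x y B)) / (2 :: ennreal)"
  have meas: "?R x y B \<in> sets lborel" if "B \<in> ?S" "(x, y) \<in> edges N" for x y B
  proof -
    from that obtain B' where B': "B' \<in> sets borel" "B = B' \<inter> metric_graph N"
      by (auto simp: sets_restrict_space)
    have "?R x y B = {0..edge_length N x y} \<inter> edge_point N x y -` B'"
      using that(2) by (auto simp: B'(2) metric_graph_def edge_segment_def)
    moreover have "edge_point N x y \<in> borel_measurable borel"
      unfolding edge_point_def divide_inverse
      by (intro borel_measurable_continuous_onI continuous_intros)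
    then have "edge_point N x y -` B' \<inter> space borel \<in> sets borel"
      using B'(1) by (rule measurable_sets)
    ultimately show ?thesis by simp
  qed
  have "positive ?S ?f"
    by (auto simp: positive_def case_prod_unfold)
  moreover have "countably_additive ?S ?f"
  proof (rule countably_additiveI)
    fix A :: "nat \<Rightarrow> (real ^ 'v) set"
    assume A: "range A \<subseteq> ?S" "disjoint_family A"
    have "(\<Sum>i. ?f (A i)) = (\<Sum>i. \<Sum>(x, y)\<in>edges N. emeasure lborel (?R x y (A i))) / 2"
      by (simp add: ennreal_suminf_divide)
    also have "(\<Sum>i. \<Sum>(x, y)\<in>edges N. emeasure lborel (?R x y (A i))) =
        (\<Sum>e\<in>edges N. \<Sum>i. emeasure lborel (?R (fst e) (snd e) (A i)))"
      unfolding case_prod_unfold by (rule suminf_sum) simp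
    also have "\<dots> = (\<Sum>e\<in>edges N. emeasure lborel (?R (fst e) (snd e) (\<Union>i. A i)))"
    proof (rule sum.cong[OF refl])
      fix e assume e: "e \<in> edges N"
      have "(\<Sum>i. emeasure lborel (?R (fst e) (snd e) (A i))) =
          emeasure lborel (\<Union>i. ?R (fst e) (snd e) (A i))"
        using A e meas[of _ "fst e" "snd e"]
        by (intro suminf_emeasure) (auto simp: disjoint_family_on_def image_subset_iff)
      also have "(\<Union>i. ?R (fst e) (snd e) (A i)) = ?R (fst e) (snd e) (\<Union>i. A i)"
        by auto
      finally show "(\<Sum>i. emeasure lborel (?R (fst e) (snd e) (A i))) =
          emeasure lborel (?R (fst e) (snd e) (\<Union>i. A i))" .
    qed
    finally show "(\<Sum>i. ?f (A i)) = ?f (\<Union>i. A i)"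
      by (simp add: case_prod_unfold)
  qed
  moreover have "B \<in> sets (length_measure N)" "?S \<subseteq> Pow (metric_graph N)"
    using B sets.space_closed[of "restrict_space borel (metric_graph N)"]
    by (auto simp: space_restrict_space simp del: sets_length_measure)
  ultimately show ?thesis
    using emeasure_measure_of[OF length_measure_def, of N B]
    by (simp del: sets_length_measure add: sets_length_measure[symmetric])
qed

section \<open>The metric graph Gaussian free field\<close>

definition centered_normal :: "'w measure \<Rightarrow> ('w \<Rightarrow> real) \<Rightarrow> real \<Rightarrow> bool" where
  "centered_normal M X v \<longleftrightarrow> X \<in> borel_measurable M \<and>
     (v = 0 \<and> (AE \<omega> in M. X \<omega> = 0) \<or>
      v > 0 \<and> distributed M lborel X (\<lambda>t. ennreal (normal_density 0 (sqrt v) t)))"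

definition centered_gaussian_family ::
    "'w measure \<Rightarrow> 'i set \<Rightarrow> ('i \<Rightarrow> 'w \<Rightarrow> real) \<Rightarrow> ('i \<Rightarrow> 'i \<Rightarrow> real) \<Rightarrow> bool" where
  "centered_gaussian_family M I X K \<longleftrightarrow>
     (\<forall>J a. finite J \<and> J \<subseteq> I \<longrightarrow>
        centered_normal M (\<lambda>\<omega>. \<Sum>i\<in>J. a i * X i \<omega>) (\<Sum>i\<in>J. \<Sum>j\<in>J. a i * a j * K i j))"

text \<open>\<open>G\<close> is the inverse of \<open>-\<Delta>\<close> with zero boundary conditions, extended by \<open>0\<close> to the boundary.\<close>

definition zero_boundary_green :: "'v::finite network \<Rightarrow> ('v \<Rightarrow> 'v \<Rightarrow> real) \<Rightarrow> bool" where
  "zero_boundary_green N G \<longleftrightarrow>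
     (\<forall>x y. x \<in> boundary N \<or> y \<in> boundary N \<longrightarrow> G x y = 0) \<and>
     (\<forall>x y. x \<notin> boundary N \<and> y \<notin> boundary N \<longrightarrow>
        - laplacian N (\<lambda>z. G z y) x = (if x = y then 1 else 0))"

definition discrete_gff :: "'w measure \<Rightarrow> 'v::finite network \<Rightarrow> ('v \<Rightarrow> 'w \<Rightarrow> real) \<Rightarrow> bool" where
  "discrete_gff M N \<phi> \<longleftrightarrow>
     (\<exists>G. zero_boundary_green N G \<and> centered_gaussian_family M UNIV \<phi> G)"

text \<open>The standard Brownian bridge of length \<open>l\<close> from \<open>0\<close> to \<open>0\<close> (its covariance).\<close>

definition brownian_bridge :: "'w measure \<Rightarrow> real \<Rightarrow> (real \<Rightarrow> 'w \<Rightarrow> real) \<Rightarrow> bool" where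
  "brownian_bridge M l W \<longleftrightarrow> centered_gaussian_family M {0..l} W (\<lambda>s t. min s t - s * t / l)"

text \<open>
  A Brownian bridge between two given values is the linear interpolation of these values plus a
  bridge from \<open>0\<close> to \<open>0\<close>.  The following is this second part; conditional independence of the
  bridges inside the edges given the discrete field means that the fluctuations in the different
  edges and the discrete field (index \<open>None\<close> below) are jointly independent.
\<close>

definition edge_fluctuation :: "(real ^ 'v \<Rightarrow> real) \<Rightarrow> real ^ 'v::finite \<Rightarrow> real" where
  "edge_fluctuation f p = f p - interpolate (\<lambda>v. f (vertex v)) p"

definition metric_graph_gff ::
    "'w measure \<Rightarrow> 'v::finite network \<Rightarrow> ('w \<Rightarrow> real ^ 'v \<Rightarrow> real) \<Rightarrow> bool" where
  "metric_graph_gff M N \<phi> \<longleftrightarrow>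
     (\<forall>p\<in>metric_graph N. (\<lambda>\<omega>. \<phi> \<omega> p) \<in> borel_measurable M) \<and>
     (AE \<omega> in M. continuous_on (metric_graph N) (\<phi> \<omega>)) \<and>
     discrete_gff M N (\<lambda>x \<omega>. \<phi> \<omega> (vertex x)) \<and>
     (\<forall>(x, y)\<in>edges N. brownian_bridge M (edge_length N x y)
        (\<lambda>s \<omega>. edge_fluctuation (\<phi> \<omega>) (edge_point N x y s))) \<and>
     prob_space.indep_vars M
       (\<lambda>i. case i of None \<Rightarrow> Pi\<^sub>M (range vertex) (\<lambda>_. borel)
                    | Some I \<Rightarrow> Pi\<^sub>M I (\<lambda>_. borel))
       (\<lambda>i \<omega>. case i of None \<Rightarrow> restrict (\<phi> \<omega>) (range vertex)
                      | Some I \<Rightarrow> restrict (edge_fluctuation (\<phi> \<omega>)) I)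
       (insert None (Some ` (\<lambda>(x, y). edge_segment N x y) ` edges N))"

definition first_passage_set ::
    "'v::finite network \<Rightarrow> real \<Rightarrow> (real ^ 'v \<Rightarrow> real) \<Rightarrow> (real ^ 'v) set" where
  "first_passage_set N a f =
     {p \<in> metric_graph N. \<exists>\<gamma>. path \<gamma> \<and> path_image \<gamma> \<subseteq> metric_graph N \<and> pathstart \<gamma> = p \<and>
        pathfinish \<gamma> \<in> boundary_points N \<and> (\<forall>q\<in>path_image \<gamma>. - a \<le> f q)}"

section \<open>The diffusion, its bridges, and its loop and excursion measures\<close>

text \<open>
  Trajectories are functions on \<open>{0..}\<close>.  A path with lifetime \<open>T\<close> is a pair \<open>(T, \<gamma>)\<close> where \<open>\<gamma>\<close>
  stays at its terminal point after time \<open>T\<close>.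
\<close>

definition trajectories :: "'v::finite network \<Rightarrow> (real \<Rightarrow> real ^ 'v) measure" where
  "trajectories N = restrict_space (Pi\<^sub>M {0..} (\<lambda>_. borel))
     {\<gamma>. continuous_on {0..} \<gamma> \<and> \<gamma> ` {0..} \<subseteq> metric_graph N}"

type_synonym 'v lifetime_path = "real \<times> (real \<Rightarrow> real ^ 'v)"

definition lifetime_paths :: "'v::finite network \<Rightarrow> 'v lifetime_path measure" where
  "lifetime_paths N = restrict_space (borel \<Otimes>\<^sub>M Pi\<^sub>M {0..} (\<lambda>_. borel))
     {(T, \<gamma>). 0 \<le> T \<and> continuous_on {0..} \<gamma> \<and> \<gamma> ` {0..} \<subseteq> metric_graph N \<and>
        (\<forall>t\<ge>T. \<gamma> t = \<gamma> T)}"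

definition trace :: "'v lifetime_path \<Rightarrow> (real ^ 'v::finite) set" where
  "trace w = snd w ` {0..fst w}"

text \<open>
  \<open>f\<close> is in the domain of the generator and is mapped to \<open>g\<close>.  Inside the edges \<open>g = f''\<close>; at each
  vertex the outward derivatives of \<open>f\<close> along the adjacent edges sum to \<open>0\<close>.  All edges having the
  same weight in this condition expresses that the small excursions from a vertex into the adjacent
  edges have equal rates, and the continuity of \<open>g\<close> at the vertices that no time is spent there.
\<close>

definition in_generator ::
    "'v::finite network \<Rightarrow> (real ^ 'v \<Rightarrow> real) \<Rightarrow> (real ^ 'v \<Rightarrow> real) \<Rightarrow> bool" where
  "in_generator N f g \<longleftrightarrow>
     continuous_on (metric_graph N) f \<and> continuous_on (metric_graph N) g \<and>
     (\<exists>f' :: 'v \<Rightarrow> 'v \<Rightarrow> real \<Rightarrow> real.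
        (\<forall>(x, y)\<in>edges N. \<forall>s\<in>{0..edge_length N x y}.
           ((\<lambda>r. f (edge_point N x y r)) has_real_derivative f' x y s)
             (at s within {0..edge_length N x y}) \<and>
           (f' x y has_real_derivative g (edge_point N x y s))
             (at s within {0..edge_length N x y})) \<and>
        (\<forall>x. (\<Sum>y | (x, y) \<in> edges N. f' x y 0) = 0))"

text \<open>
  \<open>P x\<close> is the law of the diffusion started from \<open>x\<close>, i.e. the solution of the martingale problem
  for the generator.
\<close>

definition diffusion ::
    "'v::finite network \<Rightarrow> (real ^ 'v \<Rightarrow> (real \<Rightarrow> real ^ 'v) measure) \<Rightarrow> bool" where
  "diffusion N P \<longleftrightarrow>
     (\<forall>x\<in>metric_graph N.
        prob_space (P x) \<and> space (P x) = space (trajectories N) \<and>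
        sets (P x) = sets (trajectories N) \<and>
        (AE \<gamma> in P x. \<gamma> 0 = x) \<and>
        (\<forall>f g s t A. in_generator N f g \<and> 0 \<le> s \<and> s \<le> t \<and> A \<in> sets (Pi\<^sub>M {0..s} (\<lambda>_. borel)) \<longrightarrow>
           (\<integral>\<gamma>. indicator A (restrict \<gamma> {0..s}) *
              (f (\<gamma> t) - f (\<gamma> s) - integral {s..t} (\<lambda>r. g (\<gamma> r))) \<partial>P x) = 0))"

definition transition_density ::
    "'v::finite network \<Rightarrow> (real ^ 'v \<Rightarrow> (real \<Rightarrow> real ^ 'v) measure) \<Rightarrow>
     (real \<Rightarrow> real ^ 'v \<Rightarrow> real ^ 'v \<Rightarrow> real) \<Rightarrow> bool" where
  "transition_density N P p \<longleftrightarrow>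
     continuous_on ({0<..} \<times> metric_graph N \<times> metric_graph N) (\<lambda>(t, x, y). p t x y) \<and>
     (\<forall>t>0. \<forall>x\<in>metric_graph N.
        (\<forall>y\<in>metric_graph N. 0 \<le> p t x y) \<and>
        (\<forall>B\<in>sets (length_measure N).
           emeasure (P x) {\<gamma> \<in> space (P x). \<gamma> t \<in> B} =
           (\<integral>\<^sup>+y\<in>B. ennreal (p t x y) \<partial>length_measure N)))"

text \<open>
  \<open>Br t x y\<close> is the law of the bridge of length \<open>t\<close> from \<open>x\<close> to \<open>y\<close>, which on the events observable
  up to time \<open>s < t\<close> has density \<open>p_{t-s}(X_s, y) / p_t(x, y)\<close> with respect to the diffusion started
  from \<open>x\<close>.
\<close>

definition bridges ::
    "'v::finite network \<Rightarrow> (real ^ 'v \<Rightarrow> (real \<Rightarrow> real ^ 'v) measure) \<Rightarrow>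
     (real \<Rightarrow> real ^ 'v \<Rightarrow> real ^ 'v \<Rightarrow> real) \<Rightarrow>
     (real \<Rightarrow> real ^ 'v \<Rightarrow> real ^ 'v \<Rightarrow> 'v lifetime_path measure) \<Rightarrow> bool" where
  "bridges N P p Br \<longleftrightarrow>
     (\<forall>t>0. \<forall>x\<in>metric_graph N. \<forall>y\<in>metric_graph N.
        prob_space (Br t x y) \<and> space (Br t x y) = space (lifetime_paths N) \<and>
        sets (Br t x y) = sets (lifetime_paths N) \<and>
        (AE w in Br t x y. fst w = t \<and> snd w t = y) \<and>
        (\<forall>s\<in>{0..<t}. \<forall>A\<in>sets (Pi\<^sub>M {0..s} (\<lambda>_. borel)).
           emeasure (Br t x y) {w \<in> space (Br t x y). restrict (snd w) {0..s} \<in> A} =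
           (\<integral>\<^sup>+\<gamma>. indicator A (restrict \<gamma> {0..s}) * ennreal (p (t - s) (\<gamma> s) y) \<partial>P x) /
             ennreal (p t x y)))"

definition loop_measure ::
    "'v::finite network \<Rightarrow> (real \<Rightarrow> real ^ 'v \<Rightarrow> real ^ 'v \<Rightarrow> real) \<Rightarrow>
     (real \<Rightarrow> real ^ 'v \<Rightarrow> real ^ 'v \<Rightarrow> 'v lifetime_path measure) \<Rightarrow>
     'v lifetime_path set \<Rightarrow> ennreal" where
  "loop_measure N p Br B =
     (\<integral>\<^sup>+x. (\<integral>\<^sup>+t\<in>{0<..}.
        emeasure (Br t x x) {w \<in> B. \<forall>s\<in>{0..t}. snd w s \<notin> boundary_points N} *
        ennreal (p t x x / t) \<partial>lborel) \<partial>length_measure N)"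

definition hitting_time :: "'v::finite network \<Rightarrow> (real \<Rightarrow> real ^ 'v) \<Rightarrow> real" where
  "hitting_time N \<gamma> = Inf {t. 0 \<le> t \<and> \<gamma> t \<in> boundary_points N}"

definition stopped_path :: "'v::finite network \<Rightarrow> (real \<Rightarrow> real ^ 'v) \<Rightarrow> 'v lifetime_path" where
  "stopped_path N \<gamma> = (hitting_time N \<gamma>, \<lambda>t\<in>{0..}. \<gamma> (min t (hitting_time N \<gamma>)))"

definition path_dist :: "'v::finite lifetime_path \<Rightarrow> 'v lifetime_path \<Rightarrow> real" where
  "path_dist w w' = \<bar>fst w - fst w'\<bar> + (SUP t\<in>{0..}. dist (snd w t) (snd w' t))"

text \<open>
  The test functionals in the limit defining the excursion measure, which has infinite mass near
  the paths of lifetime \<open>0\<close>: non-negative, bounded, continuous, and zero on all paths with lifetime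
  below some positive threshold.
\<close>

definition excursion_test :: "'v::finite network \<Rightarrow> ('v lifetime_path \<Rightarrow> real) \<Rightarrow> bool" where
  "excursion_test N F \<longleftrightarrow>
     (\<exists>c. \<forall>w\<in>space (lifetime_paths N). 0 \<le> F w \<and> F w \<le> c) \<and>
     (\<forall>w\<in>space (lifetime_paths N). \<forall>e>0. \<exists>d>0. \<forall>w'\<in>space (lifetime_paths N).
        path_dist w w' < d \<longrightarrow> \<bar>F w - F w'\<bar> < e) \<and>
     (\<exists>\<delta>>0. \<forall>w\<in>space (lifetime_paths N). fst w < \<delta> \<longrightarrow> F w = 0)"

definition excursion_measure ::
    "'v::finite network \<Rightarrow> (real ^ 'v \<Rightarrow> (real \<Rightarrow> real ^ 'v) measure) \<Rightarrow> 'v \<Rightarrow>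
     'v lifetime_path measure \<Rightarrow> bool" where
  "excursion_measure N P x \<nu> \<longleftrightarrow>
     space \<nu> = space (lifetime_paths N) \<and> sets \<nu> = sets (lifetime_paths N) \<and>
     (AE w in \<nu>. 0 < fst w) \<and>
     (\<forall>F. excursion_test N F \<longrightarrow>
        ((\<lambda>\<epsilon>. (\<Sum>z | (x, z) \<in> edges N.
              \<integral>\<^sup>+\<gamma>. ennreal (F (stopped_path N \<gamma>)) \<partial>P (edge_point N x z \<epsilon>)) / ennreal \<epsilon>)
           \<longlongrightarrow> (\<integral>\<^sup>+w. ennreal (F w) \<partial>\<nu>)) (at_right 0))"

text \<open>
  Excursions from \<open>x\<close> to \<open>y\<close> are those of the excursion measure at \<open>x\<close> which end at \<open>y\<close>.
\<close>

definition boundary_excursion_measure ::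
    "'v::finite network \<Rightarrow> ('v \<Rightarrow> real) \<Rightarrow> ('v \<Rightarrow> 'v lifetime_path measure) \<Rightarrow>
     'v lifetime_path set \<Rightarrow> ennreal" where
  "boundary_excursion_measure N u \<nu> B =
     (\<Sum>x\<in>boundary N. \<Sum>y\<in>boundary N.
        ennreal (u x * u y) * emeasure (\<nu> x) {w \<in> B. snd w (fst w) = vertex y}) / 2"

section \<open>Poisson point processes, local times and clusters\<close>

text \<open>
  A point process is a random set of points of the measurable space \<open>W\<close>; multiplicities are not
  needed since the intensities considered here have no atoms.  The intensity \<open>\<Lambda>\<close> is given by its
  values on the measurable sets.
\<close>

definition poisson_point_process ::
    "'w measure \<Rightarrow> 'a measure \<Rightarrow> ('a set \<Rightarrow> ennreal) \<Rightarrow> ('w \<Rightarrow> 'a set) \<Rightarrow> bool" where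
  "poisson_point_process M W \<Lambda> S \<longleftrightarrow>
     (\<forall>\<omega>\<in>space M. S \<omega> \<subseteq> space W) \<and>
     (\<forall>B\<in>sets W. \<Lambda> B < \<infinity> \<longrightarrow>
        (AE \<omega> in M. finite (S \<omega> \<inter> B)) \<and>
        (\<lambda>\<omega>. card (S \<omega> \<inter> B)) \<in> measurable M (count_space UNIV) \<and>
        (\<forall>k. measure M {\<omega> \<in> space M. card (S \<omega> \<inter> B) = k} =
           enn2real (\<Lambda> B) ^ k / fact k * exp (- enn2real (\<Lambda> B)))) \<and>
     (\<forall>\<B>. finite \<B> \<and> \<B> \<subseteq> sets W \<and> disjoint \<B> \<and> (\<forall>B\<in>\<B>. \<Lambda> B < \<infinity>) \<longrightarrow>
        prob_space.indep_vars M (\<lambda>_. count_space UNIV) (\<lambda>B \<omega>. card (S \<omega> \<inter> B)) \<B>)"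

text \<open>The events generating the \<open>\<sigma>\<close>-algebra of a point process.\<close>

definition point_process_events ::
    "'w measure \<Rightarrow> 'a measure \<Rightarrow> ('a set \<Rightarrow> ennreal) \<Rightarrow> ('w \<Rightarrow> 'a set) \<Rightarrow> 'w set set" where
  "point_process_events M W \<Lambda> S =
     {{\<omega> \<in> space M. card (S \<omega> \<inter> B) = k} | B k. B \<in> sets W \<and> \<Lambda> B < \<infinity>}"

text \<open>
  \<open>l\<close> is the total local time of the family \<open>S\<close> of paths: the continuous density, with respect to
  length, of the total time spent by the paths of \<open>S\<close> in a set.
\<close>

definition total_local_time ::
    "'v::finite network \<Rightarrow> 'v lifetime_path set \<Rightarrow> (real ^ 'v \<Rightarrow> real) \<Rightarrow> bool" where
  "total_local_time N S l \<longleftrightarrow>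
     continuous_on (metric_graph N) l \<and> (\<forall>p\<in>metric_graph N. 0 \<le> l p) \<and>
     (\<forall>B\<in>sets (length_measure N).
        (\<integral>\<^sup>+w. (\<integral>\<^sup>+t\<in>{0..fst w}. indicator B (snd w t) \<partial>lborel) \<partial>count_space S) =
        (\<integral>\<^sup>+p\<in>B. ennreal (l p) \<partial>length_measure N))"

definition positivity_set ::
    "'v::finite network \<Rightarrow> (real ^ 'v \<Rightarrow> real) \<Rightarrow> (real ^ 'v) set" where
  "positivity_set N l = {p \<in> metric_graph N. 0 < l p}"

text \<open>
  Equivalence classes of paths under finite chains of consecutively intersecting paths.  The cluster
  as a subset of the metric graph is the union of the traces of its paths; almost surely these
  subsets are exactly the components of the set where the total local time is positive.
\<close>

definition clusters :: "'v::finite lifetime_path set \<Rightarrow> 'v lifetime_path set set" where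
  "clusters S = S // {(w, w') \<in> S \<times> S. (w, w') \<in>
     {(w1, w2). w1 \<in> S \<and> w2 \<in> S \<and> trace w1 \<inter> trace w2 \<noteq> {}}\<^sup>*}"

definition cluster_trace :: "'v::finite lifetime_path set \<Rightarrow> (real ^ 'v) set" where
  "cluster_trace C = (\<Union>w\<in>C. trace w)"

text \<open>
  A component is one piece of the union of the traces, so that it contains the excursions whose
  trace meets it.
\<close>

definition contains_excursion ::
    "'v::finite lifetime_path set \<Rightarrow> (real ^ 'v) set \<Rightarrow> bool" where
  "contains_excursion X K \<longleftrightarrow> (\<exists>e\<in>X. trace e \<inter> K \<noteq> {})"

text \<open>
  The last clause is the conditional law given the \<open>\<sigma>\<close>-algebra \<open>\<F>\<close>: whenever the points of a finite
  set \<open>Q\<close> lie in pairwise distinct components without excursions, the values of \<open>\<sigma>\<close> at these points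
  are independent fair signs.  Deterministic \<open>Q\<close> suffice because the components are non-empty open
  subsets of the metric graph.
\<close>

definition cluster_sign ::
    "'w measure \<Rightarrow> 'v::finite network \<Rightarrow> 'w set set \<Rightarrow> ('w \<Rightarrow> 'v lifetime_path set) \<Rightarrow>
     ('w \<Rightarrow> real ^ 'v \<Rightarrow> real) \<Rightarrow> ('w \<Rightarrow> real ^ 'v \<Rightarrow> real) \<Rightarrow> bool" where
  "cluster_sign M N \<F> X l \<sigma> \<longleftrightarrow>
     (\<forall>p\<in>metric_graph N. (\<lambda>\<omega>. \<sigma> \<omega> p) \<in> borel_measurable M) \<and>
     (AE \<omega> in M.
        (\<forall>p\<in>metric_graph N. l \<omega> p = 0 \<longrightarrow> \<sigma> \<omega> p = 0) \<and>
        (\<forall>K\<in>components (positivity_set N (l \<omega>)).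
           (\<exists>s\<in>{-1, 1}. \<forall>p\<in>K. \<sigma> \<omega> p = s) \<and>
           (contains_excursion (X \<omega>) K \<longrightarrow> (\<forall>p\<in>K. \<sigma> \<omega> p = 1)))) \<and>
     (\<forall>Q s A. finite Q \<and> Q \<subseteq> metric_graph N \<and> s \<in> Q \<rightarrow> {-1, 1} \<and> A \<in> \<F> \<and>
        (AE \<omega> in M. \<omega> \<in> A \<longrightarrow>
           (\<forall>q\<in>Q. q \<in> positivity_set N (l \<omega>) \<and>
              \<not> contains_excursion (X \<omega>) (connected_component_set (positivity_set N (l \<omega>)) q)) \<and>
           inj_on (connected_component_set (positivity_set N (l \<omega>))) Q) \<longrightarrow>
        measure M {\<omega> \<in> A. \<forall>q\<in>Q. \<sigma> \<omega> q = s q} = measure M A * (1 / 2) ^ card Q)"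

end

theory Submission
  imports Defs
begin

text \<open>
  Write \<open>f = \<phi> + u\<close> for the field and \<open>L\<close> for the total local time, so that \<open>f\<^sup>2 = 2 L\<close>: the
  components of \<open>{L > 0}\<close> are the components of \<open>{f \<noteq> 0}\<close>.

  Suppose that an excursion \<open>e\<close> meets a component \<open>K\<close>.  Every point of the trace of \<open>e\<close> is either a
  zero of \<open>L\<close>, hence of \<open>f\<close>, or lies in a component which is also met by \<open>e\<close> and on which the sign is
  therefore \<open>+1\<close>.  So \<open>f \<ge> 0\<close> all along \<open>e\<close>, which almost surely ends in the boundary.  A component is
  path connected, and each of its limit points inside an edge is reached from it along this edge;
  almost surely \<open>f\<close> does not vanish at interior vertices, so these are not limit points outside \<open>K\<close>.
  This puts the closure of \<open>K\<close> into the first passage set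
  (\<open>excursion_cluster_in_first_passage_set\<close>).

  Conversely, let \<open>f \<ge> 0\<close> on a path from \<open>p\<close> to the boundary.  The path may be taken injective and is
  stopped when it first hits the boundary.  It then has no zero of \<open>f\<close> strictly between its ends:
  almost surely interior vertices are not zeros, and at a zero inside an edge an injective path
  passes to both sides, so the zero would be a local minimum of \<open>f\<close>.  This is almost surely
  impossible, because the minimum of \<open>f\<close> over a fixed interval inside an edge has no atom at \<open>0\<close>.  The
  end point cannot be a boundary point with \<open>u = 0\<close> either, as the field oscillates there like a
  Brownian path at its starting point.  Hence the path runs in one component and reaches a boundary
  point with \<open>u > 0\<close>.  There the local time of the excursions is \<open>u\<^sup>2 / 2 > 0\<close>, so that an excursion
  visits this component (\<open>first_passage_point_in_excursion_cluster\<close>).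

  The probabilistic input consists of two properties of Brownian bridges,
  \<open>gff_no_zero_minimum_on_edge\<close> and \<open>brownian_bridge_steep_at_zero\<close>.  Both rest on the independence of
  uncorrelated members of a Gaussian family, which is derived from \<open>fourier_uniqueness\<close>: the
  characteristic functions of all finite linear combinations determine the joint law.
\<close>

section \<open>Fourier uniqueness for families of random variables\<close>

lemma integrable_bounded_weight:
  fixes h k :: "'a \<Rightarrow> real"
  assumes "finite_measure R" and [measurable]: "h \<in> borel_measurable R" "k \<in> borel_measurable R"
    and h: "\<And>x. 0 \<le> h x" "\<And>x. h x \<le> c" and k: "\<And>x. \<bar>k x\<bar> \<le> 1"
  shows "integrable R (\<lambda>x. h x * k x)"
proof -
  have "\<bar>h x\<bar> * \<bar>k x\<bar> \<le> c * 1" for x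
    using h[of x] k[of x] by (intro mult_mono) auto
  then show ?thesis
    by (intro finite_measure.integrable_const_bound[OF assms(1), of _ c]) (auto simp: abs_mult)
qed

text \<open>
  The law of \<open>Y\<close> under the probability measure whose density with respect to \<open>R\<close> is proportional to
  the weight \<open>h\<close>.
\<close>

definition weighted_law :: "'a measure \<Rightarrow> ('a \<Rightarrow> real) \<Rightarrow> ('a \<Rightarrow> real) \<Rightarrow> real measure" where
  "weighted_law R h Y = distr (density R (\<lambda>x. ennreal (h x / (\<integral>x. h x \<partial>R)))) borel Y"

lemma weighted_law:
  fixes h Y :: "'a \<Rightarrow> real"
  assumes R: "finite_measure R"
    and meas[measurable]: "h \<in> borel_measurable R" "Y \<in> borel_measurable R" "B \<in> sets borel"
    and h: "\<And>x. 0 \<le> h x" "\<And>x. h x \<le> c" and m_pos: "0 < (\<integral>x. h x \<partial>R)"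
  shows "real_distribution (weighted_law R h Y)"
    and "measure (weighted_law R h Y) B = (\<integral>x. h x * indicator B (Y x) \<partial>R) / (\<integral>x. h x \<partial>R)"
    and "char (weighted_law R h Y) t =
      Complex (\<integral>x. h x * cos (t * Y x) \<partial>R) (\<integral>x. h x * sin (t * Y x) \<partial>R) / (\<integral>x. h x \<partial>R)"
proof -
  interpret finite_measure R by fact
  define m where "m = (\<integral>x. h x \<partial>R)"
  have m: "0 < m" using m_pos by (simp add: m_def)
  have hi: "integrable R h"
    using integrable_bounded_weight[OF R meas(1) _ h, where k = "\<lambda>_. 1"] by simp
  have nn: "(\<integral>\<^sup>+x. ennreal (h x / m) \<partial>R) = 1"
    using hi m h by (subst nn_integral_eq_integral) (auto simp: m_def[symmetric])
  then have ps: "prob_space (density R (\<lambda>x. ennreal (h x / m)))"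
    by (intro prob_spaceI) (simp add: emeasure_density cong: nn_integral_cong)
  then show "real_distribution (weighted_law R h Y)"
    unfolding weighted_law_def m_def[symmetric]
    by (intro prob_space.real_distribution_distr[OF ps]) simp
  have integ: "(\<integral>x. f x \<partial>weighted_law R h Y) = (\<integral>x. (h x / m) *\<^sub>R f (Y x) \<partial>R)"
    if [measurable]: "f \<in> borel_measurable borel" for f :: "real \<Rightarrow> 'd :: {banach, second_countable_topology}"
    unfolding weighted_law_def m_def[symmetric] using h m
    by (subst integral_distr) (auto simp: integral_density)
  have "measure (weighted_law R h Y) B = (\<integral>x. indicator B x \<partial>weighted_law R h Y)"
    by (simp add: weighted_law_def)
  also have "\<dots> = (\<integral>x. h x * indicator B (Y x) \<partial>R) / m"
    by (subst integ) auto
  finally show "measure (weighted_law R h Y) B = (\<integral>x. h x * indicator B (Y x) \<partial>R) / (\<integral>x. h x \<partial>R)"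
    by (simp add: m_def)
  have e: "char (weighted_law R h Y) t = (\<integral>x. (h x / m) *\<^sub>R iexp (t * Y x) \<partial>R)"
    unfolding char_def by (subst integ) auto
  have ii: "integrable R (\<lambda>x. (h x / m) *\<^sub>R iexp (t * Y x))"
    using h m by (intro integrable_const_bound[of _ "c / m"])
      (auto simp: norm_mult divide_right_mono norm_divide)
  have "Re (char (weighted_law R h Y) t) = (\<integral>x. h x * cos (t * Y x) \<partial>R) / m"
    unfolding e by (subst integral_Re[OF ii, symmetric]) (simp add: Re_exp)
  moreover have "Im (char (weighted_law R h Y) t) = (\<integral>x. h x * sin (t * Y x) \<partial>R) / m"
    unfolding e by (subst integral_Im[OF ii, symmetric]) (simp add: Im_exp)
  ultimately show "char (weighted_law R h Y) t =
      Complex (\<integral>x. h x * cos (t * Y x) \<partial>R) (\<integral>x. h x * sin (t * Y x) \<partial>R) / (\<integral>x. h x \<partial>R)"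
    by (simp add: complex_eq_iff m_def)
qed

text \<open>
  Levy's uniqueness theorem for the weighted laws.  The weights are what makes an induction over the
  coordinates of a random vector possible: they carry the coordinates that have been dealt with.
\<close>

lemma weighted_fourier_uniqueness:
  fixes P :: "'a measure" and Q :: "'b measure"
    and X g :: "'a \<Rightarrow> real" and X' g' :: "'b \<Rightarrow> real"
  assumes P: "finite_measure P" and Q: "finite_measure Q"
    and meas[measurable]: "X \<in> borel_measurable P" "g \<in> borel_measurable P"
      "X' \<in> borel_measurable Q" "g' \<in> borel_measurable Q" "B \<in> sets borel"
    and g: "\<And>x. 0 \<le> g x" "\<And>x. g x \<le> c" and g': "\<And>x. 0 \<le> g' x" "\<And>x. g' x \<le> c"
    and cos: "\<And>t. (\<integral>x. g x * cos (t * X x) \<partial>P) = (\<integral>x. g' x * cos (t * X' x) \<partial>Q)"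
    and sin: "\<And>t. (\<integral>x. g x * sin (t * X x) \<partial>P) = (\<integral>x. g' x * sin (t * X' x) \<partial>Q)"
  shows "(\<integral>x. g x * indicator B (X x) \<partial>P) = (\<integral>x. g' x * indicator B (X' x) \<partial>Q)"
proof -
  have m: "(\<integral>x. g x \<partial>P) = (\<integral>x. g' x \<partial>Q)"
    using cos[of 0] by simp
  show ?thesis
  proof (cases "(\<integral>x. g x \<partial>P) = 0")
    case True
    have z: "(\<integral>x. h x * k x \<partial>R) = 0"
      if "finite_measure R" "h \<in> borel_measurable R" "k \<in> borel_measurable R"
        "\<And>x. 0 \<le> h x" "\<And>x. h x \<le> c" "(\<integral>x. h x \<partial>R) = 0"
      for R :: "'c measure" and h k :: "'c \<Rightarrow> real"
    proof -
      note that(2,3)[measurable]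
      have "integrable R h"
        using integrable_bounded_weight[OF that(1,2) _ that(4,5), where k = "\<lambda>_. 1"] by simp
      then have "AE x in R. h x = 0"
        using integral_nonneg_eq_0_iff_AE that(4,6) by blast
      then have "(\<integral>x. h x * k x \<partial>R) = (\<integral>x. 0 \<partial>R)"
        by (intro integral_cong_AE) auto
      then show ?thesis by simp
    qed
    have "(\<integral>x. g x * indicator B (X x) \<partial>P) = 0"
      by (rule z[OF P _ _ g True]) simp_all
    moreover have "(\<integral>x. g' x * indicator B (X' x) \<partial>Q) = 0"
      by (rule z[OF Q _ _ g' True[unfolded m]]) simp_all
    ultimately show ?thesis by simp
  next
    case False
    moreover have "0 \<le> (\<integral>x. g x \<partial>P)" using g by simp
    ultimately have pos: "0 < (\<integral>x. g x \<partial>P)" "0 < (\<integral>x. g' x \<partial>Q)" using m by auto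
    note DP = weighted_law[OF P meas(2,1,5) g pos(1)] and DQ = weighted_law[OF Q meas(4,3,5) g' pos(2)]
    have law: "weighted_law P g X = weighted_law Q g' X'"
      using DP(1) DQ(1) by (intro Levy_uniqueness) (auto simp: DP(3) DQ(3) cos sin m fun_eq_iff)
    have "(\<integral>x. g x * indicator B (X x) \<partial>P) / (\<integral>x. g x \<partial>P) =
        (\<integral>x. g' x * indicator B (X' x) \<partial>Q) / (\<integral>x. g' x \<partial>Q)"
      by (simp only: DP(2)[symmetric] DQ(2)[symmetric] law)
    then show ?thesis
      using pos(2) unfolding m by (simp only: divide_cancel_right) auto
  qed
qed

text \<open>
  The characteristic function is replaced by an indicator function in one coordinate after the other.
  After some coordinates have been treated, the integrals of the product \<open>G\<close> of their indicators
  against \<open>cos\<close> and \<open>sin\<close> of any linear combination \<open>S\<close> agree.  For a further coordinate \<open>x\<close> the addition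
  formulas turn \<open>cos (t * x) * cos S\<close> and its variants into combinations of the same form, so that the
  one-dimensional theorem applies with the non-negative weights \<open>G\<close> and \<open>G * (1 + cos S)\<close>, and
  likewise with \<open>sin S\<close>.  Taking \<open>S = 0\<close> in the end gives the probabilities of all boxes.
\<close>

theorem fourier_uniqueness:
  fixes P :: "'a measure" and Q :: "'b measure"
    and X :: "'i \<Rightarrow> 'a \<Rightarrow> real" and X' :: "'i \<Rightarrow> 'b \<Rightarrow> real"
  assumes P: "prob_space P" and Q: "prob_space Q"
    and meas: "\<And>i. i \<in> I \<Longrightarrow> X i \<in> borel_measurable P" "\<And>i. i \<in> I \<Longrightarrow> X' i \<in> borel_measurable Q"
    and char: "\<And>J a. finite J \<Longrightarrow> J \<subseteq> I \<Longrightarrow>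
      (\<integral>\<omega>. iexp (\<Sum>i\<in>J. a i * X i \<omega>) \<partial>P) = (\<integral>\<omega>. iexp (\<Sum>i\<in>J. a i * X' i \<omega>) \<partial>Q)"
  shows "distr P (Pi\<^sub>M I (\<lambda>_. borel)) (\<lambda>\<omega>. \<lambda>i\<in>I. X i \<omega>) = distr Q (Pi\<^sub>M I (\<lambda>_. borel)) (\<lambda>\<omega>. \<lambda>i\<in>I. X' i \<omega>)"
proof -
  interpret P: prob_space P by fact
  interpret Q: prob_space Q by fact
  note [measurable] = meas
  have [measurable]: "(\<lambda>\<omega>. \<lambda>i\<in>I. X i \<omega>) \<in> measurable P (Pi\<^sub>M I (\<lambda>_. borel))"
    "(\<lambda>\<omega>. \<lambda>i\<in>I. X' i \<omega>) \<in> measurable Q (Pi\<^sub>M I (\<lambda>_. borel))"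
    by (intro measurable_restrict; simp)+
  have box: "(\<integral>\<omega>. (\<Prod>i\<in>J. indicator (A i) (X i \<omega>) :: real) \<partial>P) = (\<integral>\<omega>. (\<Prod>i\<in>J. indicator (A i) (X' i \<omega>) :: real) \<partial>Q)"
    if J: "finite J" "J \<subseteq> I" and A: "\<And>i. i \<in> J \<Longrightarrow> A i \<in> sets borel" for J and A :: "'i \<Rightarrow> real set"
  proof -
    define S where "S a \<omega> = (\<Sum>i\<in>J. a i * X i \<omega>)" for a \<omega>
    define S' where "S' a \<omega> = (\<Sum>i\<in>J. a i * X' i \<omega>)" for a \<omega>
    have mS[measurable]: "S a \<in> borel_measurable P" "S' a \<in> borel_measurable Q" for a
      using J unfolding S_def S'_def by (auto intro!: borel_measurable_sum borel_measurable_times)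
    have upd: "t * X j \<omega> + S a \<omega> = S (a(j := a j + t)) \<omega>" "t * X j \<omega> - S a \<omega> = S ((\<lambda>i. - a i)(j := - a j + t)) \<omega>"
      if "j \<in> J" for t j a \<omega>
      unfolding S_def using that J(1)
      by (simp_all add: sum.remove algebra_simps sum_negf)
    have upd': "t * X' j \<omega> + S' a \<omega> = S' (a(j := a j + t)) \<omega>" "t * X' j \<omega> - S' a \<omega> = S' ((\<lambda>i. - a i)(j := - a j + t)) \<omega>"
      if "j \<in> J" for t j a \<omega>
      unfolding S'_def using that J(1)
      by (simp_all add: sum.remove algebra_simps sum_negf)
    define G where "G H \<omega> = (\<Prod>i\<in>H. indicator (A i) (X i \<omega>) :: real)" for H \<omega>
    define G' where "G' H \<omega> = (\<Prod>i\<in>H. indicator (A i) (X' i \<omega>) :: real)" for H \<omega>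
    have mG: "G H \<in> borel_measurable P" "G' H \<in> borel_measurable Q" if "H \<subseteq> J" for H
    proof -
      have [measurable]: "\<And>i. i \<in> H \<Longrightarrow> A i \<in> sets borel" "\<And>i. i \<in> H \<Longrightarrow> X i \<in> borel_measurable P"
        "\<And>i. i \<in> H \<Longrightarrow> X' i \<in> borel_measurable Q"
        using A J that by auto
      show "G H \<in> borel_measurable P" "G' H \<in> borel_measurable Q"
        unfolding G_def G'_def by (intro borel_measurable_prod; simp)+
    qed
    have G: "0 \<le> G H \<omega>" "G H \<omega> \<le> 1" "0 \<le> G' H \<omega>'" "G' H \<omega>' \<le> 1" for H \<omega> \<omega>'
      unfolding G_def G'_def by (auto intro!: prod_nonneg prod_le_1)
    have "(\<forall>a. (\<integral>\<omega>. G H \<omega> * cos (S a \<omega>) \<partial>P) = (\<integral>\<omega>. G' H \<omega> * cos (S' a \<omega>) \<partial>Q)) \<and>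
          (\<forall>a. (\<integral>\<omega>. G H \<omega> * sin (S a \<omega>) \<partial>P) = (\<integral>\<omega>. G' H \<omega> * sin (S' a \<omega>) \<partial>Q))"
      if "H \<subseteq> J" for H
      using finite_subset[OF that J(1)] that
    proof (induction H rule: finite_induct)
      case empty
      have ii: "integrable P (\<lambda>\<omega>. iexp (S a \<omega>))" "integrable Q (\<lambda>\<omega>. iexp (S' a \<omega>))" for a
        by (intro P.integrable_const_bound[of _ 1] Q.integrable_const_bound[of _ 1]; simp)+
      have c: "(\<integral>\<omega>. iexp (S a \<omega>) \<partial>P) = (\<integral>\<omega>. iexp (S' a \<omega>) \<partial>Q)" for a
        unfolding S_def S'_def by (intro char J)
      have "(\<integral>\<omega>. cos (S a \<omega>) \<partial>P) = (\<integral>\<omega>. cos (S' a \<omega>) \<partial>Q)" for a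
        using arg_cong[OF c[of a], of Re] integral_Re[OF ii(1)] integral_Re[OF ii(2)]
        by (simp add: Re_exp)
      moreover have "(\<integral>\<omega>. sin (S a \<omega>) \<partial>P) = (\<integral>\<omega>. sin (S' a \<omega>) \<partial>Q)" for a
        using arg_cong[OF c[of a], of Im] integral_Im[OF ii(1)] integral_Im[OF ii(2)]
        by (simp add: Im_exp)
      ultimately show ?case by (simp add: G_def G'_def)
    next
      case (insert j H)
      then have j: "j \<in> J" "j \<in> I" and HJ: "H \<subseteq> J" using J by auto
      note IH = insert.IH[OF HJ]
      note [measurable] = mG[OF HJ] A[OF j(1)] meas(1)[OF j(2)] meas(2)[OF j(2)]
      have [simp]: "finite H" using HJ J finite_subset by auto
      have IH': "(\<integral>\<omega>. G H \<omega> * cos (S a \<omega>) \<partial>P) = (\<integral>\<omega>. G' H \<omega> * cos (S' a \<omega>) \<partial>Q)"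
        "(\<integral>\<omega>. G H \<omega> * sin (S a \<omega>) \<partial>P) = (\<integral>\<omega>. G' H \<omega> * sin (S' a \<omega>) \<partial>Q)" for a
        using IH by auto
      have ig: "integrable P (\<lambda>\<omega>. G H \<omega> * k \<omega>)" if "k \<in> borel_measurable P" "\<And>x. \<bar>k x\<bar> \<le> 1" for k
        using integrable_bounded_weight[OF P.finite_measure_axioms _ that(1) G(1,2) that(2)] by simp
      have ig': "integrable Q (\<lambda>\<omega>. G' H \<omega> * k \<omega>)" if "k \<in> borel_measurable Q" "\<And>x. \<bar>k x\<bar> \<le> 1" for k
        using integrable_bounded_weight[OF Q.finite_measure_axioms _ that(1) G(3,4) that(2)] by simp
      \<comment> \<open>a weight \<open>1 + e\<close> with \<open>e\<close> a cosine or a sine of a linear combination stays in the class of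
        non-negative weights; subtracting the weight \<open>1\<close> isolates \<open>e\<close>\<close>
      have step: "(\<integral>\<omega>. G (insert j H) \<omega> * e \<omega> \<partial>P) = (\<integral>\<omega>. G' (insert j H) \<omega> * e' \<omega> \<partial>Q)"
        if [measurable]: "e \<in> borel_measurable P" "e' \<in> borel_measurable Q"
          and e: "\<And>\<omega>. \<bar>e \<omega>\<bar> \<le> 1" "\<And>\<omega>. \<bar>e' \<omega>\<bar> \<le> 1"
          and c: "\<And>t. (\<integral>\<omega>. G H \<omega> * (e \<omega> * cos (t * X j \<omega>)) \<partial>P) = (\<integral>\<omega>. G' H \<omega> * (e' \<omega> * cos (t * X' j \<omega>)) \<partial>Q)"
          and s: "\<And>t. (\<integral>\<omega>. G H \<omega> * (e \<omega> * sin (t * X j \<omega>)) \<partial>P) = (\<integral>\<omega>. G' H \<omega> * (e' \<omega> * sin (t * X' j \<omega>)) \<partial>Q)"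
        for e e'
      proof -
        have c0: "(\<integral>\<omega>. G H \<omega> * cos (t * X j \<omega>) \<partial>P) = (\<integral>\<omega>. G' H \<omega> * cos (t * X' j \<omega>) \<partial>Q)"
          and s0: "(\<integral>\<omega>. G H \<omega> * sin (t * X j \<omega>) \<partial>P) = (\<integral>\<omega>. G' H \<omega> * sin (t * X' j \<omega>) \<partial>Q)" for t
          using IH'[of "(\<lambda>_. 0)(j := t)"] upd(1)[OF j(1), of t _ "\<lambda>_. 0"] upd'(1)[OF j(1), of t _ "\<lambda>_. 0"]
          by (simp_all add: S_def[of "\<lambda>_. 0"] S'_def[of "\<lambda>_. 0"])
        have b: "\<bar>x * y\<bar> \<le> 1" if "\<bar>x\<bar> \<le> 1" "\<bar>y\<bar> \<le> 1" for x y :: real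
          using mult_mono[OF that] by (simp add: abs_mult)
        have b2: "0 \<le> G H \<omega> * (1 + e \<omega>)" "G H \<omega> * (1 + e \<omega>) \<le> 2" for \<omega>
          using G(1,2)[of H \<omega>] e(1)[of \<omega>] mult_mono[of "G H \<omega>" 1 "1 + e \<omega>" 2] by (auto simp: abs_le_iff)
        have b2': "0 \<le> G' H \<omega> * (1 + e' \<omega>)" "G' H \<omega> * (1 + e' \<omega>) \<le> 2" for \<omega>
          using G(3,4)[of H \<omega>] e(2)[of \<omega>] mult_mono[of "G' H \<omega>" 1 "1 + e' \<omega>" 2] by (auto simp: abs_le_iff)
        have 1: "(\<integral>\<omega>. G H \<omega> * indicator (A j) (X j \<omega>) \<partial>P) = (\<integral>\<omega>. G' H \<omega> * indicator (A j) (X' j \<omega>) \<partial>Q)"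
          by (rule weighted_fourier_uniqueness[OF P.finite_measure_axioms Q.finite_measure_axioms _ _ _ _ _ G c0 s0]) auto
        have 2: "(\<integral>\<omega>. (G H \<omega> * (1 + e \<omega>)) * indicator (A j) (X j \<omega>) \<partial>P) =
            (\<integral>\<omega>. (G' H \<omega> * (1 + e' \<omega>)) * indicator (A j) (X' j \<omega>) \<partial>Q)"
        proof (rule weighted_fourier_uniqueness[OF P.finite_measure_axioms Q.finite_measure_axioms _ _ _ _ _ b2 b2'])
          show "(\<integral>\<omega>. G H \<omega> * (1 + e \<omega>) * cos (t * X j \<omega>) \<partial>P) = (\<integral>\<omega>. G' H \<omega> * (1 + e' \<omega>) * cos (t * X' j \<omega>) \<partial>Q)" for t
            using c0[of t] c[of t] ig[of "\<lambda>\<omega>. cos (t * X j \<omega>)"] ig[of "\<lambda>\<omega>. e \<omega> * cos (t * X j \<omega>)"]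
              ig'[of "\<lambda>\<omega>. cos (t * X' j \<omega>)"] ig'[of "\<lambda>\<omega>. e' \<omega> * cos (t * X' j \<omega>)"]
            by (simp add: algebra_simps b[OF e(1)] b[OF e(2)] b e)
          show "(\<integral>\<omega>. G H \<omega> * (1 + e \<omega>) * sin (t * X j \<omega>) \<partial>P) = (\<integral>\<omega>. G' H \<omega> * (1 + e' \<omega>) * sin (t * X' j \<omega>) \<partial>Q)" for t
            using s0[of t] s[of t] ig[of "\<lambda>\<omega>. sin (t * X j \<omega>)"] ig[of "\<lambda>\<omega>. e \<omega> * sin (t * X j \<omega>)"]
              ig'[of "\<lambda>\<omega>. sin (t * X' j \<omega>)"] ig'[of "\<lambda>\<omega>. e' \<omega> * sin (t * X' j \<omega>)"]
            by (simp add: algebra_simps b[OF e(1)] b[OF e(2)] b e)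
        qed auto
        have i1: "integrable P (\<lambda>\<omega>. G H \<omega> * indicator (A j) (X j \<omega>))" "integrable P (\<lambda>\<omega>. G H \<omega> * (e \<omega> * indicator (A j) (X j \<omega>)))"
          "integrable Q (\<lambda>\<omega>. G' H \<omega> * indicator (A j) (X' j \<omega>))" "integrable Q (\<lambda>\<omega>. G' H \<omega> * (e' \<omega> * indicator (A j) (X' j \<omega>)))"
          by (intro ig ig' b e; auto simp: indicator_def)+
        have "(\<integral>\<omega>. G H \<omega> * (e \<omega> * indicator (A j) (X j \<omega>)) \<partial>P) =
            (\<integral>\<omega>. (G H \<omega> * (1 + e \<omega>)) * indicator (A j) (X j \<omega>) \<partial>P) - (\<integral>\<omega>. G H \<omega> * indicator (A j) (X j \<omega>) \<partial>P)"
          using i1 by (simp add: algebra_simps)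
        also have "\<dots> = (\<integral>\<omega>. (G' H \<omega> * (1 + e' \<omega>)) * indicator (A j) (X' j \<omega>) \<partial>Q) - (\<integral>\<omega>. G' H \<omega> * indicator (A j) (X' j \<omega>) \<partial>Q)"
          by (simp only: 1 2)
        also have "\<dots> = (\<integral>\<omega>. G' H \<omega> * (e' \<omega> * indicator (A j) (X' j \<omega>)) \<partial>Q)"
          using i1 by (simp add: algebra_simps)
        finally show ?thesis
          using insert.hyps by (simp add: G_def G'_def mult_ac)
      qed
      have lin: "(\<integral>\<omega>. G H \<omega> * cos (t * X j \<omega> + S a \<omega>) \<partial>P) = (\<integral>\<omega>. G' H \<omega> * cos (t * X' j \<omega> + S' a \<omega>) \<partial>Q)"
        "(\<integral>\<omega>. G H \<omega> * sin (t * X j \<omega> + S a \<omega>) \<partial>P) = (\<integral>\<omega>. G' H \<omega> * sin (t * X' j \<omega> + S' a \<omega>) \<partial>Q)"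
        "(\<integral>\<omega>. G H \<omega> * cos (t * X j \<omega> - S a \<omega>) \<partial>P) = (\<integral>\<omega>. G' H \<omega> * cos (t * X' j \<omega> - S' a \<omega>) \<partial>Q)"
        "(\<integral>\<omega>. G H \<omega> * sin (t * X j \<omega> - S a \<omega>) \<partial>P) = (\<integral>\<omega>. G' H \<omega> * sin (t * X' j \<omega> - S' a \<omega>) \<partial>Q)" for t a
        unfolding upd[OF j(1)] upd'[OF j(1)] by (rule IH')+
      have tr: "cos y * cos x = (cos (x + y) + cos (x - y)) / 2" "cos y * sin x = (sin (x + y) + sin (x - y)) / 2"
        "sin y * cos x = (sin (x + y) - sin (x - y)) / 2" "sin y * sin x = (cos (x - y) - cos (x + y)) / 2" for x y :: real
        by (simp_all add: cos_add cos_diff sin_add sin_diff)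
      have ex: "G H \<omega> * ((x + y) / 2) = (G H \<omega> * x + G H \<omega> * y) / 2" "G H \<omega> * ((x - y) / 2) = (G H \<omega> * x - G H \<omega> * y) / 2"
        "G' H \<omega>' * ((x + y) / 2) = (G' H \<omega>' * x + G' H \<omega>' * y) / 2" "G' H \<omega>' * ((x - y) / 2) = (G' H \<omega>' * x - G' H \<omega>' * y) / 2"
        for \<omega> \<omega>' x y by (simp_all add: algebra_simps)
      show ?case
        by (intro conjI allI step; (simp only: tr ex)?; (simp add: ig ig' lin)?)
    qed
    from this[of J] have "(\<integral>\<omega>. G J \<omega> * cos (S (\<lambda>_. 0) \<omega>) \<partial>P) = (\<integral>\<omega>. G' J \<omega> * cos (S' (\<lambda>_. 0) \<omega>) \<partial>Q)"
      by blast
    then have "(\<integral>\<omega>. G J \<omega> \<partial>P) = (\<integral>\<omega>. G' J \<omega> \<partial>Q)"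
      by (simp add: S_def S'_def)
    then show ?thesis unfolding G_def G'_def .
  qed
  show ?thesis
  proof (rule measure_eqI_PiM_infinite)
    show "finite_measure (distr P (Pi\<^sub>M I (\<lambda>_. borel)) (\<lambda>\<omega>. \<lambda>i\<in>I. X i \<omega>))"
      by (rule P.finite_measure_distr) simp
  next
    fix A :: "'i \<Rightarrow> real set" and J
    assume J: "finite J" "J \<subseteq> I" and A: "\<And>i. i \<in> J \<Longrightarrow> A i \<in> sets borel"
    have cyl: "emeasure (distr R (Pi\<^sub>M I (\<lambda>_. borel)) (\<lambda>\<omega>. \<lambda>i\<in>I. Y i \<omega>)) (prod_emb I (\<lambda>_. borel) J (Pi\<^sub>E J A)) =
        ennreal (\<integral>\<omega>. (\<Prod>i\<in>J. indicator (A i) (Y i \<omega>)) \<partial>R)"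
      if "prob_space R" and Y: "\<And>i. i \<in> I \<Longrightarrow> Y i \<in> borel_measurable R" for R :: "'c measure" and Y :: "'i \<Rightarrow> 'c \<Rightarrow> real"
    proof -
      interpret prob_space R by fact
      have [measurable]: "(\<lambda>\<omega>. \<lambda>i\<in>I. Y i \<omega>) \<in> measurable R (Pi\<^sub>M I (\<lambda>_. borel))"
        using Y by (intro measurable_restrict) auto
      have iI: "i \<in> I" if "i \<in> J" for i using that J by auto
      have "prod_emb I (\<lambda>_. borel) J (Pi\<^sub>E J A) \<in> sets (Pi\<^sub>M I (\<lambda>_. borel))"
        using J A by (intro sets_PiM_I) auto
      then have "emeasure (distr R (Pi\<^sub>M I (\<lambda>_. borel)) (\<lambda>\<omega>. \<lambda>i\<in>I. Y i \<omega>)) (prod_emb I (\<lambda>_. borel) J (Pi\<^sub>E J A)) =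
          emeasure R ((\<lambda>\<omega>. \<lambda>i\<in>I. Y i \<omega>) -` prod_emb I (\<lambda>_. borel) J (Pi\<^sub>E J A) \<inter> space R)"
        by (subst emeasure_distr) auto
      also have "(\<lambda>\<omega>. \<lambda>i\<in>I. Y i \<omega>) -` prod_emb I (\<lambda>_. borel) J (Pi\<^sub>E J A) \<inter> space R = {\<omega>\<in>space R. \<forall>i\<in>J. Y i \<omega> \<in> A i}"
        using iI by (auto simp: prod_emb_def PiE_iff)
      also have "emeasure R {\<omega>\<in>space R. \<forall>i\<in>J. Y i \<omega> \<in> A i} = ennreal (measure R {\<omega>\<in>space R. \<forall>i\<in>J. Y i \<omega> \<in> A i})"
        by (simp add: emeasure_eq_measure)
      also have "measure R {\<omega>\<in>space R. \<forall>i\<in>J. Y i \<omega> \<in> A i} = (\<integral>\<omega>. indicator {\<omega>\<in>space R. \<forall>i\<in>J. Y i \<omega> \<in> A i} \<omega> \<partial>R)"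
        by (simp add: inf.absorb1)
      also have "\<dots> = (\<integral>\<omega>. (\<Prod>i\<in>J. indicator (A i) (Y i \<omega>)) \<partial>R)"
        using J(1) by (intro Bochner_Integration.integral_cong refl) (auto simp: indicator_def)
      finally show ?thesis .
    qed
    have "emeasure (distr P (Pi\<^sub>M I (\<lambda>_. borel)) (\<lambda>\<omega>. \<lambda>i\<in>I. X i \<omega>)) (prod_emb I (\<lambda>_. borel) J (Pi\<^sub>E J A)) =
        ennreal (\<integral>\<omega>. (\<Prod>i\<in>J. indicator (A i) (X i \<omega>)) \<partial>P)"
      by (rule cyl[OF P]) (rule meas(1))
    also have "(\<integral>\<omega>. (\<Prod>i\<in>J. indicator (A i) (X i \<omega>) :: real) \<partial>P) =
        (\<integral>\<omega>. (\<Prod>i\<in>J. indicator (A i) (X' i \<omega>)) \<partial>Q)"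
      by (rule box[OF J A])
    also have "ennreal \<dots> = emeasure (distr Q (Pi\<^sub>M I (\<lambda>_. borel)) (\<lambda>\<omega>. \<lambda>i\<in>I. X' i \<omega>))
        (prod_emb I (\<lambda>_. borel) J (Pi\<^sub>E J A))"
      by (rule cyl[OF Q, symmetric]) (rule meas(2))
    finally show "emeasure (distr P (Pi\<^sub>M I (\<lambda>_. borel)) (\<lambda>\<omega>. \<lambda>i\<in>I. X i \<omega>)) (prod_emb I (\<lambda>_. borel) J (Pi\<^sub>E J A)) =
        emeasure (distr Q (Pi\<^sub>M I (\<lambda>_. borel)) (\<lambda>\<omega>. \<lambda>i\<in>I. X' i \<omega>)) (prod_emb I (\<lambda>_. borel) J (Pi\<^sub>E J A))" .
  qed simp_all
qed

section \<open>Gaussian families\<close>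

lemma char_centered_normal:
  assumes M: "prob_space M" and X: "centered_normal M X v"
  shows "(\<integral>\<omega>. iexp (X \<omega>) \<partial>M) = of_real (exp (- v / 2))"
proof -
  interpret prob_space M by fact
  have [measurable]: "X \<in> borel_measurable M" using X by (simp add: centered_normal_def)
  from X consider "v = 0" "AE \<omega> in M. X \<omega> = 0"
    | "v > 0" "distributed M lborel X (\<lambda>t. ennreal (normal_density 0 (sqrt v) t))"
    by (auto simp: centered_normal_def)
  then show ?thesis
  proof cases
    case 1
    have "(\<integral>\<omega>. iexp (X \<omega>) \<partial>M) = (\<integral>\<omega>. 1 \<partial>M)"
      using 1(2) by (intro integral_cong_AE) auto
    then show ?thesis using 1 by (simp add: prob_space)
  next
    case 2
    define Y where "Y = (\<lambda>\<omega>. (X \<omega> - 0) / sqrt v)"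
    have [measurable]: "Y \<in> borel_measurable M" by (simp add: Y_def)
    have "distributed M lborel Y (\<lambda>x. ennreal (std_normal_density x))"
      using 2 normal_standard_normal_convert[of "sqrt v" X 0] by (simp add: Y_def)
    then have "distr M borel Y = std_normal_distribution"
      by (simp add: distributed_def cong: distr_cong)
    then have "of_real (exp (- (sqrt v)\<^sup>2 / 2)) = char (distr M borel Y) (sqrt v)"
      by (simp add: char_std_normal_distribution)
    also have "\<dots> = (\<integral>\<omega>. iexp (sqrt v * Y \<omega>) \<partial>M)"
      by (simp add: char_def integral_distr)
    also have "\<dots> = (\<integral>\<omega>. iexp (X \<omega>) \<partial>M)"
      using 2(1) by (simp add: Y_def)
    finally show ?thesis using 2(1) by simp
  qed
qed

lemma centered_normal_no_atom:
  assumes "prob_space M" "centered_normal M X v" "v \<noteq> 0"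
  shows "AE \<omega> in M. X \<omega> \<noteq> z"
proof -
  have d: "distributed M lborel X (\<lambda>t. ennreal (normal_density 0 (sqrt v) t))"
    using assms by (auto simp: centered_normal_def)
  have [measurable]: "X \<in> borel_measurable M"
    using assms by (simp add: centered_normal_def)
  have "AE t in density lborel (\<lambda>t. ennreal (normal_density 0 (sqrt v) t)). t \<noteq> z"
    using AE_lborel_singleton[of z] by (simp add: AE_density) (erule eventually_mono; simp)
  moreover have "distr M lborel X = density lborel (\<lambda>t. ennreal (normal_density 0 (sqrt v) t))"
    using d by (simp add: distributed_def)
  ultimately have "AE t in distr M lborel X. t \<noteq> z"
    by (simp only:)
  then show ?thesis by (subst (asm) AE_distr_iff) auto
qed

lemma centered_gaussian_familyD:
  assumes "centered_gaussian_family M I X K" "finite J" "J \<subseteq> I"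
  shows "centered_normal M (\<lambda>\<omega>. \<Sum>i\<in>J. a i * X i \<omega>) (\<Sum>i\<in>J. \<Sum>j\<in>J. a i * a j * K i j)"
  using assms by (auto simp: centered_gaussian_family_def)

lemma centered_gaussian_family_normal:
  assumes "centered_gaussian_family M I X K" "i \<in> I"
  shows "centered_normal M (X i) (K i i)"
  using centered_gaussian_familyD[OF assms(1), of "{i}" "\<lambda>_. 1"] assms(2) by simp

lemma centered_gaussian_family_measurable:
  assumes "centered_gaussian_family M I X K" "i \<in> I"
  shows "X i \<in> borel_measurable M"
  using centered_gaussian_family_normal[OF assms] by (simp add: centered_normal_def)

text \<open>
  Combinations of combinations are combinations over the union of the finite index sets; the
  coefficients \<open>e\<close> extend \<open>c\<close> by \<open>0\<close> to this union.
\<close>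

lemma centered_gaussian_family_linear_combinations:
  assumes X: "centered_gaussian_family M I X K" and T: "\<And>k. k \<in> I' \<Longrightarrow> finite (T k) \<and> T k \<subseteq> I"
  shows "centered_gaussian_family M I' (\<lambda>k \<omega>. \<Sum>i\<in>T k. c k i * X i \<omega>)
    (\<lambda>k k'. \<Sum>i\<in>T k. \<Sum>j\<in>T k'. c k i * c k' j * K i j)"
  unfolding centered_gaussian_family_def
proof (intro allI impI, elim conjE)
  fix J a assume J: "finite J" "J \<subseteq> I'"
  define U where "U = (\<Union>k\<in>J. T k)"
  define e where "e k i = (if i \<in> T k then c k i else 0)" for k i
  have fin: "finite U" and U: "U \<subseteq> I" and TU: "k \<in> J \<Longrightarrow> T k \<subseteq> U" for k
    using J T by (auto simp: U_def)
  have ext: "(\<Sum>i\<in>T k. c k i * f i) = (\<Sum>i\<in>U. e k i * f i)" if "k \<in> J" for k and f :: "_ \<Rightarrow> real"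
    using fin TU[OF that] by (intro sum.mono_neutral_cong_left) (auto simp: e_def)
  have 1: "(\<Sum>k\<in>J. a k * (\<Sum>i\<in>T k. c k i * X i \<omega>)) = (\<Sum>i\<in>U. (\<Sum>k\<in>J. a k * e k i) * X i \<omega>)" for \<omega>
  proof -
    have "(\<Sum>k\<in>J. a k * (\<Sum>i\<in>T k. c k i * X i \<omega>)) = (\<Sum>k\<in>J. \<Sum>i\<in>U. a k * e k i * X i \<omega>)"
      by (intro sum.cong refl) (simp add: ext sum_distrib_left mult.assoc)
    then show ?thesis by (subst (asm) sum.swap) (simp add: sum_distrib_right)
  qed
  have 2: "(\<Sum>k\<in>J. \<Sum>k'\<in>J. a k * a k' * (\<Sum>i\<in>T k. \<Sum>j\<in>T k'. c k i * c k' j * K i j)) =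
      (\<Sum>i\<in>U. \<Sum>j\<in>U. (\<Sum>k\<in>J. a k * e k i) * (\<Sum>k\<in>J. a k * e k j) * K i j)"
  proof -
    have in1: "(\<Sum>i\<in>T k. \<Sum>j\<in>T k'. c k i * c k' j * K i j) = (\<Sum>i\<in>U. \<Sum>j\<in>U. e k i * e k' j * K i j)"
      if "k \<in> J" "k' \<in> J" for k k'
      using ext[OF that(1)] ext[OF that(2)] by (simp add: sum_distrib_left[symmetric] mult.assoc)
    have "(\<Sum>k\<in>J. \<Sum>k'\<in>J. a k * a k' * (\<Sum>i\<in>T k. \<Sum>j\<in>T k'. c k i * c k' j * K i j)) =
        (\<Sum>k\<in>J. \<Sum>k'\<in>J. \<Sum>i\<in>U. \<Sum>j\<in>U. a k * e k i * (a k' * e k' j) * K i j)"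
      by (intro sum.cong refl) (simp only: in1, simp add: sum_distrib_left mult_ac)
    also have "\<dots> = (\<Sum>k\<in>J. \<Sum>i\<in>U. \<Sum>k'\<in>J. \<Sum>j\<in>U. a k * e k i * (a k' * e k' j) * K i j)"
      by (intro sum.cong refl sum.swap)
    also have "\<dots> = (\<Sum>i\<in>U. \<Sum>k\<in>J. \<Sum>j\<in>U. \<Sum>k'\<in>J. a k * e k i * (a k' * e k' j) * K i j)"
      by (subst sum.swap) (intro sum.cong refl sum.swap)
    also have "\<dots> = (\<Sum>i\<in>U. \<Sum>j\<in>U. \<Sum>k\<in>J. \<Sum>k'\<in>J. a k * e k i * (a k' * e k' j) * K i j)"
      by (intro sum.cong refl sum.swap)
    also have "\<dots> = (\<Sum>i\<in>U. \<Sum>j\<in>U. (\<Sum>k\<in>J. a k * e k i) * (\<Sum>k\<in>J. a k * e k j) * K i j)"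
      by (intro sum.cong refl) (simp only: sum_product, simp only: sum_distrib_right)
    finally show ?thesis .
  qed
  show "centered_normal M (\<lambda>\<omega>. \<Sum>k\<in>J. a k * (\<Sum>i\<in>T k. c k i * X i \<omega>))
      (\<Sum>k\<in>J. \<Sum>k'\<in>J. a k * a k' * (\<Sum>i\<in>T k. \<Sum>j\<in>T k'. c k i * c k' j * K i j))"
    unfolding 1 2 by (rule centered_gaussian_familyD[OF X fin U])
qed

text \<open>
  A member uncorrelated with the others does not produce mixed terms in the variance, which is the
  exponent of the characteristic function.
\<close>

lemma gaussian_char_split:
  assumes M: "prob_space M" and X: "centered_gaussian_family M I X K"
    and z: "z \<in> I" and J: "finite J" "J \<subseteq> I - {z}"
    and K: "\<And>i. i \<in> J \<Longrightarrow> K z i = 0 \<and> K i z = 0"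
  shows "(\<integral>\<omega>. iexp (t * X z \<omega> + (\<Sum>i\<in>J. b i * X i \<omega>)) \<partial>M) =
    (\<integral>\<omega>. iexp (t * X z \<omega>) \<partial>M) * (\<integral>\<omega>. iexp (\<Sum>i\<in>J. b i * X i \<omega>) \<partial>M)"
proof -
  have zJ: "z \<notin> J" using J by auto
  let ?a = "b(z := t)"
  have s: "(\<Sum>i\<in>insert z J. ?a i * X i \<omega>) = t * X z \<omega> + (\<Sum>i\<in>J. b i * X i \<omega>)" for \<omega>
  proof -
    have "(\<Sum>i\<in>J. ?a i * X i \<omega>) = (\<Sum>i\<in>J. b i * X i \<omega>)"
      using zJ by (intro sum.cong refl) auto
    then show ?thesis using J(1) zJ by simp
  qed
  have v: "(\<Sum>i\<in>insert z J. \<Sum>j\<in>insert z J. ?a i * ?a j * K i j) = t\<^sup>2 * K z z + (\<Sum>i\<in>J. \<Sum>j\<in>J. b i * b j * K i j)"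
  proof -
    have "(\<Sum>i\<in>J. \<Sum>j\<in>insert z J. ?a i * ?a j * K i j) = (\<Sum>i\<in>J. \<Sum>j\<in>J. b i * b j * K i j)"
    proof (rule sum.cong[OF refl])
      fix i assume i: "i \<in> J"
      have "(\<Sum>j\<in>J. ?a i * ?a j * K i j) = (\<Sum>j\<in>J. b i * b j * K i j)"
        using i zJ by (intro sum.cong refl) auto
      then show "(\<Sum>j\<in>insert z J. ?a i * ?a j * K i j) = (\<Sum>j\<in>J. b i * b j * K i j)"
        using i J(1) zJ K by simp
    qed
    moreover have "(\<Sum>j\<in>J. ?a z * ?a j * K z j) = 0"
      using K by (intro sum.neutral) auto
    ultimately show ?thesis using J(1) zJ by (simp add: power2_eq_square)
  qed
  have "(\<integral>\<omega>. iexp (t * X z \<omega> + (\<Sum>i\<in>J. b i * X i \<omega>)) \<partial>M) =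
      of_real (exp (- (t\<^sup>2 * K z z + (\<Sum>i\<in>J. \<Sum>j\<in>J. b i * b j * K i j)) / 2))"
    using char_centered_normal[OF M centered_gaussian_familyD[OF X, of "insert z J" ?a]] J z
    unfolding s v by auto
  moreover have "(\<integral>\<omega>. iexp (t * X z \<omega>) \<partial>M) = of_real (exp (- (t\<^sup>2 * K z z) / 2))"
    using char_centered_normal[OF M centered_gaussian_familyD[OF X, of "{z}" "\<lambda>_. t"]] z
    by (simp add: power2_eq_square)
  moreover have "(\<integral>\<omega>. iexp (\<Sum>i\<in>J. b i * X i \<omega>) \<partial>M) = of_real (exp (- (\<Sum>i\<in>J. \<Sum>j\<in>J. b i * b j * K i j) / 2))"
    using char_centered_normal[OF M centered_gaussian_familyD[OF X, of J b]] J by auto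
  ultimately show ?thesis
    by (simp add: exp_add[symmetric] of_real_mult[symmetric] add_divide_distrib del: of_real_mult)
qed

text \<open>
  The joint law is compared with the product \<open>Q\<close> of the one-dimensional laws: on both sides the
  characteristic function of a linear combination is the product over the coordinates.
\<close>

lemma gaussian_uncorrelated_indep:
  assumes M: "prob_space M" and X: "centered_gaussian_family M I X K"
    and K: "\<And>i j. i \<in> I \<Longrightarrow> j \<in> I \<Longrightarrow> i \<noteq> j \<Longrightarrow> K i j = 0" and "I \<noteq> {}"
  shows "prob_space.indep_vars M (\<lambda>_. borel) X I"
proof -
  interpret prob_space M by fact
  have [measurable]: "X i \<in> borel_measurable M" if "i \<in> I" for i
    using centered_gaussian_family_measurable[OF X that] .
  define Q where "Q = Pi\<^sub>M I (\<lambda>i. distr M borel (X i))"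
  have Q: "prob_space Q" unfolding Q_def by (intro prob_space_PiM prob_space_distr) simp
  interpret Q: prob_space Q by fact
  have sQ[measurable_cong]: "sets Q = sets (Pi\<^sub>M I (\<lambda>_. borel))"
    unfolding Q_def by (intro sets_PiM_cong) auto
  have mQ[measurable]: "(\<lambda>x. x i) \<in> borel_measurable Q" if "i \<in> I" for i
    using that by (simp add: measurable_cong_sets[OF sQ refl])
  have restr: "distr Q (Pi\<^sub>M I (\<lambda>_. borel)) (\<lambda>x. \<lambda>i\<in>I. x i) = Q"
  proof -
    have "distr Q (Pi\<^sub>M I (\<lambda>_. borel)) (\<lambda>x. \<lambda>i\<in>I. x i) = distr Q Q (\<lambda>x. x)"
      using sQ by (intro distr_cong) (auto simp: Q_def space_PiM PiE_iff extensional_def fun_eq_iff)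
    then show ?thesis by (simp add: distr_id[of Q, unfolded id_def])
  qed
  have comp: "distr Q borel (\<lambda>x. x i) = distr M borel (X i)" if "i \<in> I" for i
  proof -
    have "distr Q borel (\<lambda>x. x i) = distr Q (distr M borel (X i)) (\<lambda>x. x i)"
      by (intro distr_cong) auto
    also have "\<dots> = distr M borel (X i)"
      unfolding Q_def using that by (intro distr_PiM_component prob_space_distr) auto
    finally show ?thesis .
  qed
  have indQ: "Q.indep_vars (\<lambda>_. borel) (\<lambda>i x. x i) I"
    using restr comp by (subst Q.indep_vars_iff_distr_eq_PiM'[OF \<open>I \<noteq> {}\<close>]) (auto simp: Q_def cong: PiM_cong)
  have "distr M (Pi\<^sub>M I (\<lambda>_. borel)) (\<lambda>\<omega>. \<lambda>i\<in>I. X i \<omega>) = distr Q (Pi\<^sub>M I (\<lambda>_. borel)) (\<lambda>\<omega>. \<lambda>i\<in>I. \<omega> i)"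
  proof (rule fourier_uniqueness[OF M Q])
    fix J and a :: "_ \<Rightarrow> real" assume J: "finite J" "J \<subseteq> I"
    have single: "(\<integral>\<omega>. iexp (a i * X i \<omega>) \<partial>M) = of_real (exp (- (a i * a i * K i i) / 2))" if "i \<in> I" for i
      using char_centered_normal[OF M centered_gaussian_familyD[OF X, of "{i}" a]] that by simp
    have diag: "(\<Sum>i\<in>J. \<Sum>j\<in>J. a i * a j * K i j) = (\<Sum>i\<in>J. a i * a i * K i i)"
    proof (intro sum.cong refl)
      fix i assume i: "i \<in> J"
      have "(\<Sum>j\<in>J. a i * a j * K i j) = (\<Sum>j\<in>{i}. a i * a j * K i j)"
        using J i K by (intro sum.mono_neutral_right) auto
      then show "(\<Sum>j\<in>J. a i * a j * K i j) = a i * a i * K i i" by simp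
    qed
    have "(\<integral>x. iexp (\<Sum>i\<in>J. a i * x i) \<partial>Q) = (\<integral>x. (\<Prod>i\<in>J. iexp (a i * x i)) \<partial>Q)"
      using J by (simp add: sum_distrib_left exp_sum)
    also have "\<dots> = (\<Prod>i\<in>J. \<integral>x. iexp (a i * x i) \<partial>Q)"
    proof (rule Q.indep_vars_lebesgue_integral[OF J(1)])
      show "Q.indep_vars (\<lambda>_. borel) (\<lambda>i x. iexp (a i * x i)) J"
        by (rule Q.indep_vars_compose2[OF Q.indep_vars_subset[OF indQ J(2)]]) simp
      show "integrable Q (\<lambda>x. iexp (a i * x i))" if "i \<in> J" for i
        using that J by (intro Q.integrable_const_bound[of _ 1]) (auto simp: subset_iff)
    qed
    also have "\<dots> = (\<Prod>i\<in>J. \<integral>\<omega>. iexp (a i * X i \<omega>) \<partial>M)"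
    proof (intro prod.cong refl)
      fix i assume "i \<in> J"
      then have i: "i \<in> I" using J by auto
      have "(\<integral>x. iexp (a i * x i) \<partial>Q) = (\<integral>y. iexp (a i * y) \<partial>distr Q borel (\<lambda>x. x i))"
        using i by (subst integral_distr) auto
      also have "\<dots> = (\<integral>\<omega>. iexp (a i * X i \<omega>) \<partial>M)"
        unfolding comp[OF i] using i by (subst integral_distr) auto
      finally show "(\<integral>x. iexp (a i * x i) \<partial>Q) = (\<integral>\<omega>. iexp (a i * X i \<omega>) \<partial>M)" .
    qed
    also have "\<dots> = of_real (exp (- (\<Sum>i\<in>J. a i * a i * K i i) / 2))"
      using J single by (simp add: subset_iff exp_sum[symmetric] of_real_prod[symmetric] sum_negf sum_divide_distrib
          del: of_real_prod)
    also have "\<dots> = (\<integral>\<omega>. iexp (\<Sum>i\<in>J. a i * X i \<omega>) \<partial>M)"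
      using char_centered_normal[OF M centered_gaussian_familyD[OF X J, of a]] diag by simp
    finally show "(\<integral>\<omega>. iexp (\<Sum>i\<in>J. a i * X i \<omega>) \<partial>M) = (\<integral>x. iexp (\<Sum>i\<in>J. a i * x i) \<partial>Q)" ..
  qed auto
  then show ?thesis
    unfolding restr by (subst indep_vars_iff_distr_eq_PiM'[OF \<open>I \<noteq> {}\<close>]) (auto simp: Q_def)
qed

section \<open>Infima of random families\<close>

lemma sum_option:
  assumes "finite A"
  shows "(\<Sum>x\<in>A. f x) = (if None \<in> A then f None else 0) + (\<Sum>i\<in>Some -` A. f (Some i) :: 'b :: comm_monoid_add)"
proof -
  have "A = (if None \<in> A then {None} else {}) \<union> Some ` (Some -` A)"
    by (auto simp: image_iff) (metis not_None_eq)
  have fin: "finite (Some -` A)" using assms by (rule finite_vimageI) simp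
  have "(\<Sum>x\<in>A. f x) = (\<Sum>x\<in>(if None \<in> A then {None} else {}) \<union> Some ` (Some -` A). f x)"
    using \<open>A = _\<close> by simp
  also have "\<dots> = (\<Sum>x\<in>(if None \<in> A then {None} else {}). f x) + (\<Sum>x\<in>Some ` (Some -` A). f x)"
    using fin by (intro sum.union_disjoint) (auto simp del: image_vimage_eq)
  finally show ?thesis by (simp add: sum.reindex del: image_vimage_eq)
qed

text \<open>
  The event excluded here is \<open>(INF i\<in>I. Y i + h i * Z) = 0\<close>.  The hypothesis on the characteristic
  functions says that \<open>Z\<close> is independent of the family \<open>Y\<close>, so that \<open>Z\<close> may be resampled.  For fixed
  \<open>Y\<close> the infimum is strictly increasing in \<open>Z\<close>, since all \<open>h i\<close> are at least \<open>c > 0\<close>; it vanishes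
  for at most one value of \<open>Z\<close>, and \<open>Z\<close> has no atoms.
\<close>

lemma AE_infimum_nonzero:
  fixes Z :: "'a \<Rightarrow> real" and Y :: "'i \<Rightarrow> 'a \<Rightarrow> real"
  assumes M: "prob_space M" and I: "countable I"
    and Z[measurable]: "Z \<in> borel_measurable M" and Y[measurable]: "\<And>i. i \<in> I \<Longrightarrow> Y i \<in> borel_measurable M"
    and no_atom: "\<And>z. AE \<omega> in M. Z \<omega> \<noteq> z"
    and char: "\<And>J t b. finite J \<Longrightarrow> J \<subseteq> I \<Longrightarrow> (\<integral>\<omega>. iexp (t * Z \<omega> + (\<Sum>i\<in>J. b i * Y i \<omega>)) \<partial>M) =
      (\<integral>\<omega>. iexp (t * Z \<omega>) \<partial>M) * (\<integral>\<omega>. iexp (\<Sum>i\<in>J. b i * Y i \<omega>) \<partial>M)"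
    and h: "0 < c" "\<And>i. i \<in> I \<Longrightarrow> c \<le> h i"
  shows "AE \<omega> in M. \<not> ((\<forall>i\<in>I. 0 \<le> Y i \<omega> + h i * Z \<omega>) \<and> (\<forall>n::nat. \<exists>i\<in>I. Y i \<omega> + h i * Z \<omega> < 1 / Suc n))"
proof -
  interpret prob_space M by fact
  interpret pair: pair_prob_space M M ..
  define Q where "Q = M \<Otimes>\<^sub>M M"
  have Q: "prob_space Q" unfolding Q_def by unfold_locales
  interpret Q: prob_space Q by fact
  define I' where "I' = insert None (Some ` I)"
  define X where "X k \<omega> = (case k of None \<Rightarrow> Z \<omega> | Some i \<Rightarrow> Y i \<omega>)" for k \<omega>
  define X' where "X' k w = (case k of None \<Rightarrow> Z (snd w) | Some i \<Rightarrow> Y i (fst w))" for k and w :: "'a \<times> 'a"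
  let ?PI = "Pi\<^sub>M I' (\<lambda>_. borel :: real measure)"
  have X_simps: "X None = Z" "X (Some i) = Y i" for i by (auto simp: X_def fun_eq_iff)
  have mX[measurable]: "X k \<in> borel_measurable M" if "k \<in> I'" for k
    using that by (cases k) (auto simp: I'_def X_simps)
  have X'_simps: "X' None = (\<lambda>w. Z (snd w))" "X' (Some i) = (\<lambda>w. Y i (fst w))" for i
    by (auto simp: X'_def fun_eq_iff)
  have mX'[measurable]: "X' k \<in> borel_measurable Q" if "k \<in> I'" for k
    using that by (cases k) (auto simp: I'_def X'_simps Q_def)
  have mm: "(\<lambda>\<omega>. \<lambda>k\<in>I'. X k \<omega>) \<in> measurable M ?PI" "(\<lambda>\<omega>. \<lambda>k\<in>I'. X' k \<omega>) \<in> measurable Q ?PI"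
    by (intro measurable_restrict; simp)+
  have eq: "distr M ?PI (\<lambda>\<omega>. \<lambda>k\<in>I'. X k \<omega>) = distr Q ?PI (\<lambda>\<omega>. \<lambda>k\<in>I'. X' k \<omega>)"
  proof (rule fourier_uniqueness[OF M Q])
    fix J' and a :: "'i option \<Rightarrow> real" assume J': "finite J'" "J' \<subseteq> I'"
    define J where "J = Some -` J'"
    have J: "finite J" "J \<subseteq> I" using J' finite_vimageI[of J' Some] by (auto simp: J_def I'_def)
    define t where "t = (if None \<in> J' then a None else 0)"
    define S where "S \<omega> = (\<Sum>i\<in>J. a (Some i) * Y i \<omega>)" for \<omega>
    have mS[measurable]: "S \<in> borel_measurable M" unfolding S_def using J by (intro borel_measurable_sum) auto
    have 1: "(\<Sum>k\<in>J'. a k * X k \<omega>) = t * Z \<omega> + S \<omega>" for \<omega>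
      using J' by (simp add: sum_option X_def t_def S_def J_def)
    have 2: "(\<Sum>k\<in>J'. a k * X' k w) = t * Z (snd w) + S (fst w)" for w
      using J' by (simp add: sum_option X'_def t_def S_def J_def)
    have i: "integrable Q (\<lambda>(x, y). iexp (t * Z y + S x))"
      by (intro Q.integrable_const_bound[of _ 1]) (auto simp: Q_def case_prod_unfold)
    have "(\<integral>w. iexp (\<Sum>k\<in>J'. a k * X' k w) \<partial>Q) = (\<integral>w. (case w of (x, y) \<Rightarrow> iexp (t * Z y + S x)) \<partial>Q)"
      by (simp add: 2 case_prod_unfold)
    also have "\<dots> = (\<integral>x. (\<integral>y. iexp (t * Z y + S x) \<partial>M) \<partial>M)"
      using i unfolding Q_def by (subst pair.integral_fst'[symmetric]) auto
    also have "\<dots> = (\<integral>x. (\<integral>y. iexp (t * Z y) \<partial>M) * iexp (S x) \<partial>M)"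
      by (simp add: exp_add distrib_left)
    also have "\<dots> = (\<integral>\<omega>. iexp (t * Z \<omega>) \<partial>M) * (\<integral>\<omega>. iexp (S \<omega>) \<partial>M)"
      by simp
    also have "\<dots> = (\<integral>\<omega>. iexp (\<Sum>k\<in>J'. a k * X k \<omega>) \<partial>M)"
      unfolding 1 S_def by (rule char[OF J, symmetric])
    finally show "(\<integral>\<omega>. iexp (\<Sum>k\<in>J'. a k * X k \<omega>) \<partial>M) = (\<integral>w. iexp (\<Sum>k\<in>J'. a k * X' k w) \<partial>Q)" ..
  qed auto
  define bad where "bad x \<longleftrightarrow> (\<forall>i\<in>I. 0 \<le> x (Some i) + h i * x None) \<and> (\<forall>n::nat. \<exists>i\<in>I. x (Some i) + h i * x None < 1 / Suc n)"
    for x :: "'i option \<Rightarrow> real"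
  have [measurable]: "(\<lambda>x. x None) \<in> borel_measurable ?PI" "\<And>i. i \<in> I \<Longrightarrow> (\<lambda>x. x (Some i)) \<in> borel_measurable ?PI"
    by (auto simp: I'_def)
  have mbad: "{x \<in> space ?PI. \<not> bad x} \<in> sets ?PI"
    unfolding bad_def using I by measurable
  have "AE w in Q. \<not> bad (\<lambda>k\<in>I'. X' k w)"
    unfolding Q_def
  proof (rule pair.AE_pair_measure)
    have "{w \<in> space Q. \<not> bad (\<lambda>k\<in>I'. X' k w)} \<in> sets Q"
      using measurable_sets[OF mm(2) mbad] measurable_space[OF mm(2)]
      by (auto simp: vimage_def Int_def conj_commute intro: back_subst[of "\<lambda>A. A \<in> sets Q"])
    then show "{w \<in> space (M \<Otimes>\<^sub>M M). \<not> bad (\<lambda>k\<in>I'. X' k w)} \<in> sets (M \<Otimes>\<^sub>M M)" by (simp add: Q_def)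
    show "AE x in M. AE y in M. \<not> bad (\<lambda>k\<in>I'. X' k (x, y))"
    proof (rule AE_I2)
      fix x
      define B where "B z \<longleftrightarrow> (\<forall>i\<in>I. 0 \<le> Y i x + h i * z) \<and> (\<forall>n::nat. \<exists>i\<in>I. Y i x + h i * z < 1 / Suc n)" for z
      have B: "bad (\<lambda>k\<in>I'. X' k (x, y)) \<longleftrightarrow> B (Z y)" for y
        by (auto simp: bad_def B_def X'_def I'_def)
      \<comment> \<open>raising \<open>z\<close> raises all the values by at least \<open>c\<close> times the increment\<close>
      have uniq: False if "B z" "B z'" and less: "z < z'" for z z'
      proof -
        obtain n where n: "1 / Suc n < c * (z' - z)"
          using nat_approx_posE[of "c * (z' - z)"] less h(1) by auto
        obtain i where i: "i \<in> I" "Y i x + h i * z' < 1 / Suc n" using \<open>B z'\<close> unfolding B_def by blast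
        have "0 \<le> Y i x + h i * z" using \<open>B z\<close> i unfolding B_def by blast
        moreover have "c * (z' - z) \<le> h i * (z' - z)" using h(2)[OF i(1)] less by (intro mult_right_mono) auto
        ultimately show False using i(2) n by (simp add: algebra_simps)
      qed
      show "AE y in M. \<not> bad (\<lambda>k\<in>I'. X' k (x, y))"
      proof (cases "\<exists>z. B z")
        case True
        then obtain z where z: "B z" by auto
        show ?thesis
          using no_atom[of z] by eventually_elim (use uniq z B in \<open>metis linorder_neqE\<close>)
      qed (use B in auto)
    qed
  qed
  then have "AE x in distr Q ?PI (\<lambda>\<omega>. \<lambda>k\<in>I'. X' k \<omega>). \<not> bad x"
    by (subst AE_distr_iff[OF mm(2) mbad])
  then have "AE \<omega> in M. \<not> bad (\<lambda>k\<in>I'. X k \<omega>)"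
    unfolding eq[symmetric] by (subst (asm) AE_distr_iff[OF mm(1) mbad])
  then show ?thesis
    by eventually_elim (auto simp: bad_def X_def I'_def)
qed

section \<open>Brownian bridges near their end points\<close>

lemma centered_normal_tail_bound:
  assumes M: "prob_space M" and X: "centered_normal M X v" and v: "0 < v" and c: "0 < c"
  shows "measure M {\<omega> \<in> space M. c \<le> \<bar>X \<omega>\<bar>} \<le> v / c\<^sup>2"
proof -
  interpret prob_space M by fact
  have [measurable]: "X \<in> borel_measurable M" using X by (simp add: centered_normal_def)
  have d: "distributed M lborel X (\<lambda>t. ennreal (normal_density 0 (sqrt v) t))"
    using X v by (auto simp: centered_normal_def)
  have E: "expectation X = 0" and V: "variance X = v"
    using normal_distributed_expectation[OF _ d] normal_distributed_variance[OF _ d] v by simp_all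
  have "integrable lborel (\<lambda>x. normal_density 0 (sqrt v) x * x\<^sup>2)"
    using integrable_normal_moment[of "sqrt v" 0 2] v by simp
  then have "integrable M (\<lambda>\<omega>. (X \<omega>)\<^sup>2)"
    using distributed_integrable[OF d, of "\<lambda>x. x\<^sup>2"] by simp
  from Chebyshev_inequality[OF _ this c] show ?thesis
    using E V by simp
qed

lemma centered_normal_lower_tail:
  assumes M: "prob_space M" and X: "centered_normal M X v" and v: "0 < v"
  shows "measure M {\<omega> \<in> space M. X \<omega> \<le> - sqrt v} = measure std_normal_distribution {..-1}"
proof -
  interpret prob_space M by fact
  have [measurable]: "X \<in> borel_measurable M" using X by (simp add: centered_normal_def)
  define Y where "Y = (\<lambda>\<omega>. (X \<omega> - 0) / sqrt v)"
  have [measurable]: "Y \<in> borel_measurable M" by (simp add: Y_def)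
  have d: "distributed M lborel X (\<lambda>t. ennreal (normal_density 0 (sqrt v) t))"
    using X v by (auto simp: centered_normal_def)
  have "distributed M lborel Y (\<lambda>x. ennreal (std_normal_density x))"
    using d v normal_standard_normal_convert[of "sqrt v" X 0] by (simp add: Y_def)
  then have "std_normal_distribution = distr M borel Y"
    by (simp add: distributed_def cong: distr_cong)
  then have "measure std_normal_distribution {..-1} = measure M (Y -` {..-1} \<inter> space M)"
    by (simp add: measure_distr)
  also have "Y -` {..-1} \<inter> space M = {\<omega> \<in> space M. X \<omega> \<le> - sqrt v}"
    using v by (auto simp: Y_def field_simps)
  finally show ?thesis ..
qed

lemma std_normal_lower_tail_pos: "0 < measure std_normal_distribution {..-1}"
proof -
  interpret real_distribution std_normal_distribution by (rule real_dist_normal_dist)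
  have "emeasure std_normal_distribution {..-1} \<noteq> 0"
  proof
    assume "emeasure std_normal_distribution {..-1} = 0"
    moreover have "\<not> std_normal_density x \<le> 0" for x
      unfolding not_le by (rule normal_density_pos) simp
    ultimately have "AE x in lborel. x \<notin> {..-1::real}"
      by (subst (asm) emeasure_density)
        (auto simp: nn_integral_0_iff_AE indicator_def ennreal_eq_0_iff
          split: if_splits elim!: eventually_mono)
    then have "emeasure lborel {..-1::real} = 0"
      by (simp add: AE_iff_measurable[OF _ refl] Collect_neg_eq[symmetric] atMost_def)
    moreover have "emeasure lborel {-2..-1::real} \<le> emeasure lborel {..-1::real}"
      by (intro emeasure_mono) auto
    ultimately show False by simp
  qed
  then show ?thesis
    by (simp add: emeasure_eq_measure zero_less_measure_iff)
qed

text \<open>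
  All the events have the same positive probability, hence they occur infinitely often with positive
  probability, and by independence with probability one.
\<close>

lemma gaussian_independent_deviations_infinitely_often:
  assumes M: "prob_space M" and D: "centered_gaussian_family M UNIV D K"
    and K: "\<And>i j. i \<noteq> j \<Longrightarrow> K i j = 0" and v: "\<And>k::nat. 0 < K k k"
  shows "AE \<omega> in M. infinite {k. D k \<omega> \<le> - sqrt (K k k)}"
proof -
  interpret prob_space M by fact
  have [measurable]: "D k \<in> borel_measurable M" for k
    using centered_gaussian_family_measurable[OF D] by simp
  define E where "E k = {\<omega> \<in> space M. D k \<omega> \<le> - sqrt (K k k)}" for k
  have [measurable]: "E k \<in> sets M" for k unfolding E_def by measurable
  have "indep_vars (\<lambda>_. borel) D UNIV"
    using gaussian_uncorrelated_indep[OF M D] K by simp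
  then have "indep_events E UNIV"
    unfolding E_def by (rule indep_eventsI_indep_vars[where P = "\<lambda>k x. x \<le> - sqrt (K k k)"]) simp
  then have zero_one: "prob (\<Inter>n. \<Union>m\<in>{n..}. E m) = 0 \<or> prob (\<Inter>n. \<Union>m\<in>{n..}. E m) = 1"
    by (rule borel_0_1_law)
  have pE: "prob (E k) = measure std_normal_distribution {..-1}" for k
    unfolding E_def by (rule centered_normal_lower_tail[OF M centered_gaussian_family_normal[OF D] v]) simp
  have dec: "decseq (\<lambda>n. \<Union>m\<in>{n..}. E m)"
    unfolding decseq_def by (intro allI impI UN_mono) auto
  have "(\<lambda>n. prob (\<Union>m\<in>{n..}. E m)) \<longlonglongrightarrow> prob (\<Inter>n. \<Union>m\<in>{n..}. E m)"
    by (intro finite_Lim_measure_decseq dec) auto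
  moreover have "prob (E n) \<le> prob (\<Union>m\<in>{n..}. E m)" for n
    by (intro finite_measure_mono) auto
  ultimately have "measure std_normal_distribution {..-1} \<le> prob (\<Inter>n. \<Union>m\<in>{n..}. E m)"
    unfolding pE by (intro LIMSEQ_le_const) auto
  with zero_one std_normal_lower_tail_pos have "prob (\<Inter>n. \<Union>m\<in>{n..}. E m) = 1" by linarith
  then have "AE \<omega> in M. \<omega> \<in> (\<Inter>n. \<Union>m\<in>{n..}. E m)"
    by (subst (asm) prob_eq_1) auto
  then show ?thesis
    by eventually_elim (auto simp: E_def infinite_nat_iff_unbounded_le)
qed

text \<open>
  Time inversion: with \<open>r = 1 / s - 1 / l\<close> the process \<open>W s / s\<close> is a Brownian motion in the time \<open>r\<close>,
  and \<open>s \<rightarrow> 0\<close> corresponds to \<open>r \<rightarrow> \<infinity>\<close>.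
\<close>

lemma brownian_bridge_rescaled:
  assumes W: "brownian_bridge M l W" and l: "0 < l" and r: "\<And>k. 0 < (r k :: real)"
  shows "centered_gaussian_family M UNIV (\<lambda>k \<omega>. (r k + 1 / l) * W (1 / (r k + 1 / l)) \<omega>)
    (\<lambda>j k. min (r j) (r k))"
proof -
  define s where "s k = 1 / (r k + 1 / l)" for k
  have pos: "0 < r k + 1 / l" for k using r[of k] l by (simp add: add_pos_pos)
  have s: "0 < s k" "s k \<le> l" for k
    using pos[of k] r[of k] l by (auto simp: s_def field_simps)
  have cov: "1 / s j * (1 / s k) * (min (s j) (s k) - s j * s k / l) = min (r j) (r k)" for j k
  proof -
    have r_eq: "r i = 1 / s i - 1 / l" for i using pos[of i] by (simp add: s_def)
    have 1: "1 / s j * (1 / s k) * (s j - s j * s k / l) = r k"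
      and 2: "1 / s j * (1 / s k) * (s k - s j * s k / l) = r j"
      unfolding r_eq using s(1)[of j] s(1)[of k] l by (simp_all add: field_simps)
    have le: "s j \<le> s k \<longleftrightarrow> r k \<le> r j"
      using pos[of j] pos[of k] by (simp add: s_def field_simps)
    show ?thesis
    proof (cases "s j \<le> s k")
      case True
      then show ?thesis using le by (simp only: min_absorb1 min_absorb2 1)
    next
      case False
      then have "s k \<le> s j" "r j \<le> r k" using le by auto
      then show ?thesis by (simp only: min_absorb1 min_absorb2 2)
    qed
  qed
  have "centered_gaussian_family M UNIV (\<lambda>k \<omega>. \<Sum>i\<in>{s k}. 1 / s k * W i \<omega>)
      (\<lambda>j k. \<Sum>i\<in>{s j}. \<Sum>i'\<in>{s k}. 1 / s j * (1 / s k) * (min i i' - i * i' / l))"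
    by (rule centered_gaussian_family_linear_combinations[OF W[unfolded brownian_bridge_def]])
      (use s in \<open>auto simp: less_imp_le\<close>)
  then have "centered_gaussian_family M UNIV (\<lambda>k \<omega>. 1 / s k * W (s k) \<omega>)
      (\<lambda>j k. 1 / s j * (1 / s k) * (min (s j) (s k) - s j * s k / l))"
    by simp
  then show ?thesis
    unfolding cov by (simp add: s_def)
qed

text \<open>
  The inverted process \<open>X\<close> is a Brownian motion, observed at times \<open>r k\<close> growing so fast that the
  increments dominate.  Infinitely often the increment after time \<open>r k\<close> is below minus its standard
  deviation, while by Borel and Cantelli \<open>X k\<close> is eventually smaller than half of this standard
  deviation.  Hence \<open>X\<close> is not bounded below, and \<open>W s / s\<close> is not bounded below near \<open>0\<close>.
\<close>

lemma brownian_bridge_steep_at_zero: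
  assumes M: "prob_space M" and W: "brownian_bridge M l W" and l: "0 < l"
  shows "AE \<omega> in M. \<forall>C. \<forall>\<delta>>0. \<exists>s. 0 < s \<and> s < \<delta> \<and> s \<le> l \<and> W s \<omega> < - C * s"
proof -
  interpret prob_space M by fact
  \<comment> \<open>with \<open>r (Suc k) / r k = 2 * 4 ^ k\<close> the tail probabilities in the Borel-Cantelli lemma are summable\<close>
  define r where "r k = (2::real) ^ (k\<^sup>2)" for k :: nat
  define s where "s k = 1 / (r k + 1 / l)" for k
  define X where "X k \<omega> = (r k + 1 / l) * W (1 / (r k + 1 / l)) \<omega>" for k \<omega>
  have r_pos: "0 < r k" for k by (simp add: r_def)
  have r_Suc: "r (Suc k) = r k * 2 * 4 ^ k" for k
    by (simp add: r_def power2_eq_square power_add algebra_simps power_mult[symmetric])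
      (simp add: power_mult mult_2 power_add power2_eq_square flip: power_mult_distrib)
  have r_ge: "2 ^ k \<le> r k" for k
    unfolding r_def by (intro power_increasing) (auto simp: power2_eq_square)
  have incr: "r k * 4 ^ k \<le> r (Suc k) - r k" for k
    using r_pos[of k] one_le_power[of "4::real" k] mult_left_mono[of 1 "4 ^ k" "r k"] by (simp add: r_Suc)
  have r_mono: "r j \<le> r k" if "j \<le> k" for j k
    unfolding r_def using that by (intro power_increasing power_mono) auto
  have X: "centered_gaussian_family M UNIV X (\<lambda>j k. min (r j) (r k))"
    unfolding X_def by (rule brownian_bridge_rescaled[OF W l r_pos])
  have [measurable]: "X k \<in> borel_measurable M" for k
    using centered_gaussian_family_measurable[OF X] by simp
  define c where "c k i = (if i = Suc k then 1 else - 1 :: real)" for k i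
  define K where "K j k = (\<Sum>i\<in>{j, Suc j}. \<Sum>i'\<in>{k, Suc k}. c j i * c k i' * min (r i) (r i'))" for j k
  have K: "K j k = (if j = k then r (Suc k) - r k else 0)" for j k
  proof -
    have m: "min (r i) (r i') = r (min i i')" for i i'
      using r_mono[of i i'] r_mono[of i' i] by (auto simp: min_def)
    have "K j k = r (min j k) - r (min j (Suc k)) - r (min (Suc j) k) + r (min (Suc j) (Suc k))"
      by (simp add: K_def c_def m)
    also have "\<dots> = (if j = k then r (Suc k) - r k else 0)"
      by (cases j k rule: linorder_cases) (simp_all add: min_absorb1 min_absorb2)
    finally show ?thesis .
  qed
  have D: "centered_gaussian_family M UNIV (\<lambda>k \<omega>. \<Sum>i\<in>{k, Suc k}. c k i * X i \<omega>) K"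
    unfolding K_def by (rule centered_gaussian_family_linear_combinations[OF X]) auto
  have v: "0 < K k k" for k
    using incr[of k] r_pos[of k] by (simp add: K) (smt (verit) mult_pos_pos zero_less_power)
  have drops: "AE \<omega> in M. infinite {k. (\<Sum>i\<in>{k, Suc k}. c k i * X i \<omega>) \<le> - sqrt (K k k)}"
    by (rule gaussian_independent_deviations_infinitely_often[OF M D _ v]) (simp add: K)
  have "AE \<omega> in M. eventually (\<lambda>k. \<omega> \<in> space M - {\<omega> \<in> space M. sqrt (K k k) / 2 \<le> \<bar>X k \<omega>\<bar>}) sequentially"
  proof (rule borel_cantelli_AE1)
    show "summable (\<lambda>k. prob {\<omega> \<in> space M. sqrt (K k k) / 2 \<le> \<bar>X k \<omega>\<bar>})"
    proof (rule summable_comparison_test')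
      show "summable (\<lambda>k. 4 * (1 / 4 :: real) ^ k)"
        by (intro summable_mult summable_geometric) simp
      fix k :: nat
      have "prob {\<omega> \<in> space M. sqrt (K k k) / 2 \<le> \<bar>X k \<omega>\<bar>} \<le> r k / (sqrt (K k k) / 2)\<^sup>2"
        using centered_normal_tail_bound[OF M centered_gaussian_family_normal[OF X], of k "sqrt (K k k) / 2"] v[of k] r_pos[of k]
        by simp
      also have "\<dots> = 4 * r k / K k k"
        using v[of k] by (simp add: power_divide)
      also have "\<dots> \<le> 4 * r k / (r k * 4 ^ k)"
        using incr[of k] r_pos[of k] v[of k] by (intro divide_left_mono mult_pos_pos) (auto simp: K)
      also have "\<dots> = 4 * (1 / 4) ^ k"
        using r_pos[of k] by (simp add: power_divide)
      finally show "norm (prob {\<omega> \<in> space M. sqrt (K k k) / 2 \<le> \<bar>X k \<omega>\<bar>}) \<le> 4 * (1 / 4) ^ k" by simp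
    qed
  qed (auto simp: emeasure_eq_measure)
  with drops show ?thesis
  proof eventually_elim
    case (elim \<omega>)
    show ?case
    proof (intro allI impI)
      fix C \<delta> :: real assume \<delta>: "0 < \<delta>"
      obtain n\<^sub>0 where "max (4 * C\<^sup>2) (1 / \<delta>) < 2 ^ n\<^sub>0"
        using real_arch_pow[of 2 "max (4 * C\<^sup>2) (1 / \<delta>)"] by auto
      then have "max (4 * C\<^sup>2) (1 / \<delta>) < 2 ^ k" if "n\<^sub>0 \<le> k" for k
        using power_increasing[OF that, of "2::real"] by linarith
      then have "eventually (\<lambda>k. max (4 * C\<^sup>2) (1 / \<delta>) < 2 ^ k) sequentially"
        by (rule eventually_sequentiallyI)
      with elim(2) have "eventually (\<lambda>k. max (4 * C\<^sup>2) (1 / \<delta>) < 2 ^ k \<and> \<bar>X k \<omega>\<bar> < sqrt (K k k) / 2) sequentially"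
        by eventually_elim auto
      then obtain n where n: "\<And>k. n \<le> k \<Longrightarrow> max (4 * C\<^sup>2) (1 / \<delta>) < 2 ^ k \<and> \<bar>X k \<omega>\<bar> < sqrt (K k k) / 2"
        by (auto simp: eventually_sequentially)
      from elim(1) obtain k where k: "n \<le> k" "(\<Sum>i\<in>{k, Suc k}. c k i * X i \<omega>) \<le> - sqrt (K k k)"
        by (auto simp: infinite_nat_iff_unbounded_le)
      have big: "4 * C\<^sup>2 < 2 ^ k" "1 / \<delta> < 2 ^ k" "\<bar>X k \<omega>\<bar> < sqrt (K k k) / 2"
        using n[OF k(1)] by auto
      have "X (Suc k) \<omega> < - sqrt (K k k) / 2"
        using k(2) big(3) by (simp add: c_def)
      moreover have "2 * \<bar>C\<bar> \<le> sqrt (K k k)"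
      proof (rule real_le_rsqrt)
        have "(2::real) ^ k * 1 \<le> r k * 4 ^ k"
          using r_ge[of k] r_pos[of k] by (intro mult_mono) auto
        then show "(2 * \<bar>C\<bar>)\<^sup>2 \<le> K k k"
          using big(1) incr[of k] by (simp add: K power_mult_distrib)
      qed
      ultimately have "X (Suc k) \<omega> < - C" by (auto simp: abs_le_iff)
      moreover have rp: "0 < r (Suc k) + 1 / l" using r_pos[of "Suc k"] l by (simp add: add_pos_pos)
      ultimately have W: "W (s (Suc k)) \<omega> < - C * s (Suc k)"
        by (simp add: X_def s_def field_simps)
      have "1 / \<delta> < r (Suc k)"
        using big(2) r_ge[of k] r_mono[of k "Suc k"] by linarith
      then have "1 / \<delta> < r (Suc k) + 1 / l" using l by (smt (verit) zero_less_divide_1_iff)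
      then have "s (Suc k) < \<delta>" using \<delta> rp by (simp add: s_def field_simps)
      moreover have "s (Suc k) \<le> l"
        using l r_pos[of "Suc k"] rp by (simp add: s_def field_simps)
      moreover have "0 < s (Suc k)" using rp by (simp add: s_def)
      ultimately show "\<exists>s. 0 < s \<and> s < \<delta> \<and> s \<le> l \<and> W s \<omega> < - C * s"
        using W by blast
    qed
  qed
qed

section \<open>Geometry of the metric graph\<close>

lemma vertex_nth: "vertex x $ v = (if v = x then 1 else 0)"
  by (simp add: vertex_def axis_def)

lemma edge_sym:
  assumes "electrical_network N" "(x, y) \<in> edges N"
  shows "(y, x) \<in> edges N" "edge_length N y x = edge_length N x y" "x \<noteq> y"
  using assms by (auto simp: electrical_network_def edge_length_def irrefl_def dest: symD)

lemma edge_length_pos: "electrical_network N \<Longrightarrow> (x, y) \<in> edges N \<Longrightarrow> 0 < edge_length N x y"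
  by (auto simp: electrical_network_def edge_length_def)

lemma edge_point_nth:
  "edge_point N x y s $ v = (1 - s / edge_length N x y) * (if v = x then 1 else 0) + s / edge_length N x y * (if v = y then 1 else 0)"
  by (simp add: edge_point_def vertex_nth)

lemma edge_segment_eq:
  assumes "0 < edge_length N x y"
  shows "edge_segment N x y = closed_segment (vertex x) (vertex y)"
proof
  show "edge_segment N x y \<subseteq> closed_segment (vertex x) (vertex y)"
  proof
    fix q assume "q \<in> edge_segment N x y"
    then obtain s where "0 \<le> s" "s \<le> edge_length N x y" "q = edge_point N x y s" by (auto simp: edge_segment_def)
    then show "q \<in> closed_segment (vertex x) (vertex y)"
      using assms by (auto simp: edge_point_def in_segment intro!: exI[of _ "s / edge_length N x y"])
  qed
  show "closed_segment (vertex x) (vertex y) \<subseteq> edge_segment N x y"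
  proof
    fix q assume "q \<in> closed_segment (vertex x) (vertex y)"
    then obtain t where t: "0 \<le> t" "t \<le> 1" "q = (1 - t) *\<^sub>R vertex x + t *\<^sub>R vertex y"
      by (auto simp: in_segment)
    then have "q = edge_point N x y (t * edge_length N x y)" using assms by (simp add: edge_point_def)
    then show "q \<in> edge_segment N x y"
      using t assms by (auto simp: edge_segment_def mult_left_le_one_le)
  qed
qed

text \<open>
  The vertices and the edges as compact convex sets.  That the metric graph is a finite union of such
  sets makes it closed and locally path connected.
\<close>

definition edge_cells :: "'v::finite network \<Rightarrow> (real ^ 'v) set set" where
  "edge_cells N = (\<lambda>x. {vertex x}) ` UNIV \<union> (\<lambda>(x, y). closed_segment (vertex x) (vertex y)) ` edges N"

lemma metric_graph_eq_Union_cells: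
  assumes "electrical_network N"
  shows "metric_graph N = \<Union> (edge_cells N)"
  using assms edge_segment_eq[OF edge_length_pos[OF assms]]
  by (auto simp: metric_graph_def edge_cells_def)

lemma edge_cells: "finite (edge_cells N)" "I \<in> edge_cells N \<Longrightarrow> convex I \<and> compact I"
  by (auto simp: edge_cells_def)

lemma closed_metric_graph: "electrical_network N \<Longrightarrow> closed (metric_graph N)"
  unfolding metric_graph_eq_Union_cells
  by (intro closed_Union edge_cells(1)) (auto dest: edge_cells(2) compact_imp_closed)

text \<open>
  In a ball around \<open>p\<close> that avoids the pieces not containing \<open>p\<close>, the union is star-shaped about \<open>p\<close>.
\<close>

lemma locally_path_connected_finite_Union_convex:
  fixes \<C> :: "'a::real_normed_vector set set"
  assumes fin: "finite \<C>" and \<C>: "\<And>I. I \<in> \<C> \<Longrightarrow> convex I \<and> closed I"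
  shows "locally path_connected (\<Union>\<C>)"
  unfolding locally_path_connected
proof (intro allI impI, elim conjE)
  fix V p assume V: "openin (top_of_set (\<Union>\<C>)) V" and p: "p \<in> V"
  obtain O1 where O1: "open O1" "V = \<Union>\<C> \<inter> O1" using V by (auto simp: openin_open)
  define O2 where "O2 = O1 - \<Union>{I \<in> \<C>. p \<notin> I}"
  have "closed (\<Union>{I \<in> \<C>. p \<notin> I})" using fin \<C> by (intro closed_Union) auto
  then have "open O2" unfolding O2_def using O1(1) by blast
  moreover have "p \<in> O2" using p O1 by (auto simp: O2_def)
  ultimately obtain \<epsilon> where \<epsilon>: "0 < \<epsilon>" "ball p \<epsilon> \<subseteq> O2" by (meson openE)
  define U where "U = \<Union>\<C> \<inter> ball p \<epsilon>"
  have star: "closed_segment p q \<subseteq> U" if "q \<in> U" for q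
  proof -
    obtain I where I: "I \<in> \<C>" "q \<in> I" using \<open>q \<in> U\<close> by (auto simp: U_def)
    have "q \<in> O2" using that \<epsilon> by (auto simp: U_def)
    then have "p \<in> I" using I by (auto simp: O2_def)
    then have "closed_segment p q \<subseteq> I" using I \<C> by (meson closed_segment_subset)
    moreover have "closed_segment p q \<subseteq> ball p \<epsilon>"
      using that \<epsilon>(1) by (intro closed_segment_subset) (auto simp: U_def)
    ultimately show ?thesis using I by (auto simp: U_def)
  qed
  have pU: "p \<in> U" using p O1 \<epsilon>(1) by (auto simp: U_def)
  then have "starlike U" using star by (auto simp: starlike_def)
  then have "path_connected U" by (rule starlike_imp_path_connected)
  moreover have "openin (top_of_set (\<Union>\<C>)) U" unfolding U_def by (intro openin_open_Int) simp
  moreover have "U \<subseteq> V" using \<epsilon> O1 by (auto simp: U_def O2_def)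
  ultimately show "\<exists>U. openin (top_of_set (\<Union>\<C>)) U \<and> path_connected U \<and> p \<in> U \<and> U \<subseteq> V"
    using pU by blast
qed

lemma locally_path_connected_metric_graph:
  "electrical_network N \<Longrightarrow> locally path_connected (metric_graph N)"
  unfolding metric_graph_eq_Union_cells
  by (intro locally_path_connected_finite_Union_convex edge_cells(1)) (auto dest: edge_cells(2) compact_imp_closed)

lemma edge_subset_metric_graph:
  assumes "(x, y) \<in> edges N" "0 \<le> s" "s \<le> edge_length N x y"
  shows "edge_point N x y s \<in> metric_graph N"
  using assms by (force simp: metric_graph_def edge_segment_def)

lemma vertex_in_metric_graph: "vertex x \<in> metric_graph N"
  by (simp add: metric_graph_def)

lemma metric_graph_cases:
  assumes N: "electrical_network N" and p: "p \<in> metric_graph N"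
  obtains (vertex) v where "p = vertex v"
    | (edge) x y s where "(x, y) \<in> edges N" "0 < s" "s < edge_length N x y" "p = edge_point N x y s"
proof -
  from p consider v where "p = vertex v" | x y s where "(x, y) \<in> edges N" "0 \<le> s" "s \<le> edge_length N x y" "p = edge_point N x y s"
    by (auto simp: metric_graph_def edge_segment_def)
  then show ?thesis
  proof cases
    case 1 then show ?thesis by (rule that(1))
  next
    case 2
    then have "s = 0 \<Longrightarrow> p = vertex x" "s = edge_length N x y \<Longrightarrow> p = vertex y"
      using edge_length_pos[OF N 2(1)] by (auto simp: edge_point_def)
    then show ?thesis using 2 that by (metis less_eq_real_def)
  qed
qed

text \<open>
  The open edge between \<open>x\<close> and \<open>y\<close> is where both barycentric coordinates are positive.  These open
  conditions describe neighbourhoods inside an edge, and \<open>p $ y\<close> serves as the edge parameter.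
\<close>

lemma metric_graph_edge_coordinates:
  assumes N: "electrical_network N" and p: "p \<in> metric_graph N"
    and xy: "x \<noteq> y" "0 < p $ x" "0 < p $ y"
  shows "(x, y) \<in> edges N" "p = edge_point N x y (edge_length N x y * p $ y)" "p $ x = 1 - p $ y"
proof -
  have "(x, y) \<in> edges N \<and> p = edge_point N x y (edge_length N x y * p $ y) \<and> p $ x = 1 - p $ y"
    using N p
  proof (cases rule: metric_graph_cases)
    case (vertex v)
    then show ?thesis using xy by (auto simp: vertex_nth split: if_splits)
  next
    case (edge z w s)
    note sy = edge_sym[OF N edge(1)] and l = edge_length_pos[OF N edge(1)]
    have "(x = z \<and> y = w) \<or> (x = w \<and> y = z)"
      using xy edge sy by (auto simp: edge_point_nth split: if_splits)
    then show ?thesis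
    proof
      assume a: "x = z \<and> y = w"
      then have "p $ y = s / edge_length N x y" "p $ x = 1 - s / edge_length N x y"
        using edge sy by (auto simp: edge_point_nth)
      then show ?thesis using a edge l by auto
    next
      assume a: "x = w \<and> y = z"
      then have "p $ y = 1 - s / edge_length N x y" "p $ x = s / edge_length N x y"
        using edge sy by (auto simp: edge_point_nth)
      then show ?thesis using a edge l sy
        by (auto simp: edge_point_def add.commute right_diff_distrib diff_divide_distrib)
    qed
  qed
  then show "(x, y) \<in> edges N" "p = edge_point N x y (edge_length N x y * p $ y)" "p $ x = 1 - p $ y" by auto
qed

lemma edge_point_coordinates:
  assumes N: "electrical_network N" and e: "(x, y) \<in> edges N"
  shows "edge_point N x y s $ y = s / edge_length N x y" "edge_point N x y s $ x = 1 - s / edge_length N x y"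
  using edge_sym(3)[OF N e] by (auto simp: edge_point_nth)

lemma metric_graph_near_vertex:
  assumes N: "electrical_network N" and p: "p \<in> metric_graph N" "0 < p $ x" "p \<noteq> vertex x"
  obtains y where "y \<noteq> x" "0 < p $ y"
  using N p(1)
proof (cases rule: metric_graph_cases)
  case (vertex v)
  then show ?thesis using p by (auto simp: vertex_nth split: if_splits)
next
  case (edge z w s)
  note c = edge_point_coordinates[OF N edge(1), of s]
  have "0 < p $ z" "0 < p $ w" using c edge edge_length_pos[OF N edge(1)] by auto
  then show ?thesis using that edge_sym(3)[OF N edge(1)] by metis
qed

lemma vertex_has_neighbour:
  assumes N: "electrical_network N"
  obtains y where "(x, y) \<in> edges N"
proof -
  obtain w where w: "w \<noteq> x" using N unfolding electrical_network_def by (metis Compl_iff all_not_in_conv)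
  have "(x, w) \<in> (edges N)\<^sup>*" using N by (simp add: electrical_network_def)
  then show ?thesis using w that by (cases rule: converse_rtranclE) auto
qed

lemma continuous_edge_point: "continuous_on A (edge_point N x y)"
  unfolding edge_point_def[abs_def] divide_inverse by (intro continuous_intros)

text \<open>
  Let \<open>K\<close> accumulate at \<open>p\<close> from the side of \<open>y\<close> and let \<open>k\<close> be a point of \<open>K\<close> on this side.  If \<open>K\<close> missed
  a point \<open>z\<close> between \<open>p\<close> and \<open>k\<close>, then the part of \<open>K\<close> between \<open>p\<close> and \<open>z\<close> would be closed and open in \<open>K\<close>
  and non-empty, without containing \<open>k\<close>.
\<close>

lemma connected_subset_accumulating_along_edge:
  assumes N: "electrical_network N" and K: "connected K" "K \<subseteq> metric_graph N"
    and p: "p \<in> metric_graph N" "p \<notin> K" and xy: "x \<noteq> y" "0 < p $ x" "0 < p $ y"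
    and acc: "\<And>\<epsilon>. 0 < \<epsilon> \<Longrightarrow> \<exists>q\<in>K. 0 < q $ x \<and> p $ y < q $ y \<and> q $ y < p $ y + \<epsilon>"
  shows "\<exists>k\<in>K. closed_segment p k \<subseteq> closure K"
proof -
  note coord = metric_graph_edge_coordinates[OF N _ xy(1)]
  obtain k where k: "k \<in> K" "0 < k $ x" "p $ y < k $ y" using acc[of 1] by auto
  have kG: "k \<in> metric_graph N" using k K by auto
  have k_le: "k $ x = 1 - k $ y" "p $ x = 1 - p $ y" using coord(3)[OF kG k(2)] coord(3)[OF p(1) xy(2,3)] k xy by auto
  have e: "(x, y) \<in> edges N" by (rule coord(1)[OF p(1) xy(2,3)])
  have in_segment': "q \<in> closed_segment (vertex x) (vertex y)" if "q \<in> metric_graph N" "0 < q $ x" "0 < q $ y" for q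
  proof -
    have "edge_length N x y * q $ y \<in> {0..edge_length N x y}"
      using coord(3)[OF that] that edge_length_pos[OF N e] by (auto simp: mult_left_le)
    then show ?thesis
      using coord(2)[OF that] edge_segment_eq[OF edge_length_pos[OF N e]] by (metis edge_segment_def image_eqI)
  qed
  have "open_segment p k \<subseteq> K"
  proof
    fix z assume "z \<in> open_segment p k"
    then obtain t where t: "0 < t" "t < 1" "z = (1 - t) *\<^sub>R p + t *\<^sub>R k" by (auto simp: in_segment)
    have zy: "z $ y = p $ y + t * (k $ y - p $ y)" by (simp add: t algebra_simps)
    have zx: "z $ x = 1 - z $ y" by (simp add: t k_le algebra_simps)
    have "0 < t * (k $ y - p $ y)" "0 < (1 - t) * (k $ y - p $ y)" using t k by auto
    then have between: "p $ y < z $ y" "z $ y < k $ y" by (auto simp: zy algebra_simps)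
    have "0 < z $ x" using zx k_le k between by auto
    have "z \<in> closed_segment p k" using \<open>z \<in> open_segment p k\<close> by (auto simp: open_segment_def)
    also have "closed_segment p k \<subseteq> closed_segment (vertex x) (vertex y)"
      using in_segment' p kG k xy by (intro closed_segment_subset) auto
    also have "\<dots> \<subseteq> metric_graph N"
      using e unfolding metric_graph_eq_Union_cells[OF N] edge_cells_def by auto
    finally have "z \<in> metric_graph N" .
    then have z_eq: "z = edge_point N x y (edge_length N x y * z $ y)"
      using \<open>0 < z $ x\<close> between xy by (intro coord(2)) auto
    show "z \<in> K"
    proof (rule ccontr)
      assume "z \<notin> K"
      define J where "J = K \<inter> {q. 0 < q $ x \<and> p $ y < q $ y \<and> q $ y < z $ y}"
      \<comment> \<open>both ends of the arc are missing from \<open>K\<close>, so the arc carries a clopen part of \<open>K\<close>\<close>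
      have closed_J: "J = K \<inter> {q. 1 - z $ y \<le> q $ x \<and> p $ y \<le> q $ y \<and> q $ y \<le> z $ y}"
      proof (intro equalityI subsetI)
        fix q assume "q \<in> J"
        then show "q \<in> K \<inter> {q. 1 - z $ y \<le> q $ x \<and> p $ y \<le> q $ y \<and> q $ y \<le> z $ y}"
          using coord(3)[of q] K(2) xy by (auto simp: J_def subset_iff)
      next
        fix q assume q: "q \<in> K \<inter> {q. 1 - z $ y \<le> q $ x \<and> p $ y \<le> q $ y \<and> q $ y \<le> z $ y}"
        have "0 < q $ x" "0 < q $ y" "q \<in> metric_graph N" using q between k_le k K xy by auto
        note qc = coord(2)[OF this(3,1,2)]
        have "q \<noteq> p" "q \<noteq> z" using q p(2) \<open>z \<notin> K\<close> by auto
        have "q $ y \<noteq> p $ y"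
        proof
          assume eq: "q $ y = p $ y"
          note qc
          also note eq
          also note coord(2)[OF p(1) xy(2,3), symmetric]
          finally show False using \<open>q \<noteq> p\<close> by contradiction
        qed
        moreover have "q $ y \<noteq> z $ y"
        proof
          assume eq: "q $ y = z $ y"
          note qc
          also note eq
          also note z_eq[symmetric]
          finally show False using \<open>q \<noteq> z\<close> by contradiction
        qed
        ultimately show "q \<in> J" using q \<open>0 < q $ x\<close> by (auto simp: J_def)
      qed
      have "openin (top_of_set K) J"
        unfolding J_def by (intro openin_open_Int open_Collect_conj open_Collect_less continuous_intros)
      moreover have "closedin (top_of_set K) J"
        unfolding closed_J by (intro closedin_closed_Int closed_Collect_conj closed_Collect_le continuous_intros)
      ultimately have "J = {} \<or> J = K" using K(1) by (auto simp: connected_clopen)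
      moreover have "k \<notin> J" using between by (auto simp: J_def)
      moreover obtain q where "q \<in> J" using acc[of "z $ y - p $ y"] between by (auto simp: J_def)
      ultimately show False using k(1) by auto
    qed
  qed
  then have "closure (open_segment p k) \<subseteq> closure K" by (rule closure_mono)
  moreover have "p \<noteq> k" using p k by auto
  ultimately have "closed_segment p k \<subseteq> closure K" by simp
  then show ?thesis using k by auto
qed

lemma interpolate_edge_point:
  assumes "x \<noteq> y"
  shows "interpolate g (edge_point N x y s) = (1 - s / edge_length N x y) * g x + s / edge_length N x y * g y"
proof -
  have "interpolate g (edge_point N x y s) =
      (\<Sum>v\<in>UNIV. (if v = x then (1 - s / edge_length N x y) * g v else 0) + (if v = y then s / edge_length N x y * g v else 0))"
    unfolding interpolate_def edge_point_nth by (intro sum.cong refl) (simp add: algebra_simps)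
  then show ?thesis by (simp add: sum.distrib)
qed

lemma interpolate_vertex: "interpolate g (vertex x) = g x"
proof -
  have "interpolate g (vertex x) = (\<Sum>v\<in>UNIV. if v = x then g v else 0)"
    unfolding interpolate_def vertex_nth by (intro sum.cong refl) simp
  then show ?thesis by simp
qed

lemma continuous_interpolate: "continuous_on A (interpolate g)"
  unfolding interpolate_def[abs_def] by (intro continuous_intros)

section \<open>Zeros of the Gaussian free field\<close>

text \<open>
  Summation by parts: each edge contributes to the sum in both orientations.
\<close>

lemma dirichlet_energy:
  fixes N :: "'v::finite network"
  assumes N: "electrical_network N"
  shows "(\<Sum>z\<in>UNIV. g z * - laplacian N g z) =
    (\<Sum>(z, w)\<in>edges N. conductance N z w * (g w - g z)\<^sup>2) / 2"
proof -
  let ?C = "conductance N"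
  have sym: "(w, z) \<in> edges N \<and> ?C w z = ?C z w" if "(z, w) \<in> edges N" for z w
    using N that unfolding electrical_network_def by (auto dest: symD)
  have "(\<Sum>z\<in>UNIV. g z * - laplacian N g z) = (\<Sum>z\<in>UNIV. \<Sum>w | (z, w) \<in> edges N. ?C z w * (g z - g w) * g z)"
    unfolding laplacian_def by (simp add: sum_distrib_left sum_negf[symmetric] algebra_simps)
  also have "\<dots> = (\<Sum>(z, w)\<in>(SIGMA z:UNIV. {w. (z, w) \<in> edges N}). ?C z w * (g z - g w) * g z)"
    by (rule sum.Sigma) auto
  also have "(SIGMA z:UNIV. {w. (z, w) \<in> edges N}) = edges N" by auto
  finally have 1: "(\<Sum>z\<in>UNIV. g z * - laplacian N g z) = (\<Sum>(z, w)\<in>edges N. ?C z w * (g z - g w) * g z)" .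
  have "(\<Sum>(z, w)\<in>edges N. ?C z w * (g z - g w) * g z) = (\<Sum>(z, w)\<in>edges N. ?C z w * (g w - g z) * g w)"
    by (rule sum.reindex_bij_witness[of _ prod.swap prod.swap]) (auto dest: sym)
  then have "2 * (\<Sum>(z, w)\<in>edges N. ?C z w * (g z - g w) * g z) =
      (\<Sum>(z, w)\<in>edges N. ?C z w * (g z - g w) * g z) + (\<Sum>(z, w)\<in>edges N. ?C z w * (g w - g z) * g w)"
    by simp
  also have "\<dots> = (\<Sum>(z, w)\<in>edges N. ?C z w * (g w - g z)\<^sup>2)"
    by (simp add: sum.distrib[symmetric] case_prod_unfold power2_eq_square algebra_simps)
  finally show ?thesis using 1 by simp
qed

text \<open>
  \<open>G x x\<close> is the Dirichlet energy of \<open>G (\<cdot>, x)\<close>.  If it vanished, this function would be constant along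
  every edge and its Laplacian at \<open>x\<close> would be \<open>0\<close> instead of \<open>-1\<close>.
\<close>

lemma green_diagonal_nonzero:
  fixes N :: "'v::finite network"
  assumes N: "electrical_network N" and G: "zero_boundary_green N G" and x: "x \<notin> boundary N"
  shows "G x x \<noteq> 0"
proof
  assume "G x x = 0"
  let ?g = "\<lambda>z. G z x"
  have "?g z * - laplacian N ?g z = 0" for z
    using G x \<open>G x x = 0\<close> unfolding zero_boundary_green_def by (cases "z \<in> boundary N"; cases "z = x") auto
  then have "(\<Sum>z\<in>UNIV. ?g z * - laplacian N ?g z) = 0"
    by (intro sum.neutral) blast
  then have "(\<Sum>(z, w)\<in>edges N. conductance N z w * (?g w - ?g z)\<^sup>2) = 0"
    unfolding dirichlet_energy[OF N] by simp
  moreover have "0 \<le> conductance N (fst e) (snd e) * (?g (snd e) - ?g (fst e))\<^sup>2" if "e \<in> edges N" for e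
    using N that unfolding electrical_network_def by (intro mult_nonneg_nonneg) (auto simp: case_prod_unfold less_imp_le)
  ultimately have "conductance N (fst e) (snd e) * (?g (snd e) - ?g (fst e))\<^sup>2 = 0" if "e \<in> edges N" for e
    using that by (subst (asm) case_prod_unfold, subst (asm) sum_nonneg_eq_0_iff) auto
  then have "conductance N x w * (?g w - ?g x) = 0" if "(x, w) \<in> edges N" for w
    using that by fastforce
  then have "laplacian N ?g x = 0" unfolding laplacian_def by (intro sum.neutral) auto
  then show False using G x unfolding zero_boundary_green_def by force
qed

lemma gff_zero_on_boundary:
  fixes N :: "'v::finite network"
  assumes \<phi>: "metric_graph_gff M N \<phi>"
  shows "AE \<omega> in M. \<forall>x\<in>boundary N. \<phi> \<omega> (vertex x) = 0"
proof -
  obtain G where G: "zero_boundary_green N G" "centered_gaussian_family M UNIV (\<lambda>x \<omega>. \<phi> \<omega> (vertex x)) G"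
    using \<phi> by (auto simp: metric_graph_gff_def discrete_gff_def)
  have "AE \<omega> in M. \<phi> \<omega> (vertex x) = 0" if "x \<in> boundary N" for x
    using centered_gaussian_family_normal[OF G(2), of x] G(1) that
    by (auto simp: centered_normal_def zero_boundary_green_def)
  then show ?thesis by (subst AE_finite_all) auto
qed

lemma gff_avoids_level_at_interior_vertices:
  fixes N :: "'v::finite network"
  assumes M: "prob_space M" and N: "electrical_network N" and \<phi>: "metric_graph_gff M N \<phi>"
  shows "AE \<omega> in M. \<forall>x. x \<notin> boundary N \<longrightarrow> \<phi> \<omega> (vertex x) \<noteq> c x"
proof -
  obtain G where G: "zero_boundary_green N G" "centered_gaussian_family M UNIV (\<lambda>x \<omega>. \<phi> \<omega> (vertex x)) G"
    using \<phi> by (auto simp: metric_graph_gff_def discrete_gff_def)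
  have "AE \<omega> in M. \<phi> \<omega> (vertex x) \<noteq> c x" if "x \<notin> boundary N" for x
    by (rule centered_normal_no_atom[OF M centered_gaussian_family_normal[OF G(2)] green_diagonal_nonzero[OF N G(1) that]]) simp
  then have "AE \<omega> in M. \<forall>x\<in>- boundary N. \<phi> \<omega> (vertex x) \<noteq> c x"
    by (subst AE_finite_all) auto
  then show ?thesis by eventually_elim auto
qed

text \<open>
  The independence of the discrete field and the bridge in one edge, in the form in which it
  factorises characteristic functions.
\<close>

lemma gff_vertices_indep_edge:
  fixes N :: "'v::finite network" and F H :: "(real ^ 'v \<Rightarrow> real) \<Rightarrow> complex"
  assumes M: "prob_space M" and \<phi>: "metric_graph_gff M N \<phi>" and e: "(x, y) \<in> edges N"
    and F[measurable]: "F \<in> borel_measurable (Pi\<^sub>M (edge_segment N x y) (\<lambda>_. borel))" and F1: "\<And>f. norm (F f) \<le> 1"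
    and H[measurable]: "H \<in> borel_measurable (Pi\<^sub>M (range vertex) (\<lambda>_. borel))" and H1: "\<And>f. norm (H f) \<le> 1"
  shows "(\<integral>\<omega>. F (restrict (edge_fluctuation (\<phi> \<omega>)) (edge_segment N x y)) * H (restrict (\<phi> \<omega>) (range vertex)) \<partial>M) =
    (\<integral>\<omega>. F (restrict (edge_fluctuation (\<phi> \<omega>)) (edge_segment N x y)) \<partial>M) * (\<integral>\<omega>. H (restrict (\<phi> \<omega>) (range vertex)) \<partial>M)"
proof -
  interpret prob_space M by fact
  let ?S = "edge_segment N x y"
  let ?M = "\<lambda>i. case i of None \<Rightarrow> Pi\<^sub>M (range vertex) (\<lambda>_. borel) | Some I \<Rightarrow> Pi\<^sub>M I (\<lambda>_. borel)"
  let ?X = "\<lambda>i \<omega>. case i of None \<Rightarrow> restrict (\<phi> \<omega>) (range vertex) | Some I \<Rightarrow> restrict (edge_fluctuation (\<phi> \<omega>)) I"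
  have "indep_vars ?M ?X (insert None (Some ` (\<lambda>(x, y). edge_segment N x y) ` edges N))"
    using \<phi> by (simp add: metric_graph_gff_def)
  then have ind: "indep_vars ?M ?X {None, Some ?S}"
    by (rule indep_vars_subset) (use e in force)
  define Y where "Y i = (case i of None \<Rightarrow> H | Some (_ :: (real ^ 'v) set) \<Rightarrow> F)" for i
  have indY: "indep_vars (\<lambda>_. borel) (\<lambda>i \<omega>. Y i (?X i \<omega>)) {None, Some ?S}"
    by (rule indep_vars_compose2[OF ind]) (auto simp: Y_def)
  have Y_meas: "(\<lambda>\<omega>. Y i (?X i \<omega>)) \<in> borel_measurable M" if "i \<in> {None, Some ?S}" for i
    using indY that by (auto simp: indep_vars_def)
  have "integrable M (\<lambda>\<omega>. Y i (?X i \<omega>))" if "i \<in> {None, Some ?S}" for i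
    using that F1 H1 by (intro integrable_const_bound[of _ 1] Y_meas) (auto simp: Y_def)
  then have "(\<integral>\<omega>. (\<Prod>i\<in>{None, Some ?S}. Y i (?X i \<omega>)) \<partial>M) = (\<Prod>i\<in>{None, Some ?S}. \<integral>\<omega>. Y i (?X i \<omega>) \<partial>M)"
    by (intro indep_vars_lebesgue_integral indY) auto
  then show ?thesis by (simp add: Y_def mult.commute)
qed

text \<open>
  Fix a time \<open>m < a\<close>.  On \<open>[a, b]\<close> the bridge is the sum of \<open>h s * W m\<close>, with \<open>h\<close> positive, and of a part
  \<open>g\<close> that is uncorrelated with \<open>W m\<close>.  The interpolation \<open>\<Lambda>\<close> of the vertex values is independent of
  the bridge.  Hence \<open>AE_infimum_nonzero\<close> applies with \<open>Z = W m\<close> and \<open>Y = g + \<Lambda>\<close>; rational times make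
  the index set countable.
\<close>

lemma gff_no_zero_minimum_on_edge:
  fixes N :: "'v::finite network"
  assumes M: "prob_space M" and N: "electrical_network N" and \<phi>: "metric_graph_gff M N \<phi>"
    and e: "(x, y) \<in> edges N" and ab: "0 < a" "a < b" "b < edge_length N x y"
  shows "AE \<omega> in M. \<not> ((\<forall>s\<in>\<rat> \<inter> {a..b}. 0 \<le> \<phi> \<omega> (edge_point N x y s) + interpolate u (edge_point N x y s)) \<and>
    (\<forall>n::nat. \<exists>s\<in>\<rat> \<inter> {a..b}. \<phi> \<omega> (edge_point N x y s) + interpolate u (edge_point N x y s) < 1 / Suc n))"
proof -
  interpret prob_space M by fact
  define l where "l = edge_length N x y"
  have l: "0 < l" "b < l" using ab by (auto simp: l_def)
  let ?S = "edge_segment N x y" and ?p = "edge_point N x y"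
  define W where "W s \<omega> = edge_fluctuation (\<phi> \<omega>) (?p s)" for s \<omega>
  \<comment> \<open>any time in \<open>(0, a)\<close> would do\<close>
  define m where "m = a / 2"
  have m: "0 < m" "m < a" "m < l" using ab l by (auto simp: m_def)
  define h where "h s = (l - s) / (l - m)" for s
  define I where "I = \<rat> \<inter> {a..b}"
  define Z where "Z = W m"
  define g where "g s \<omega> = W s \<omega> - h s * W m \<omega>" for s \<omega>
  define \<Lambda> where "\<Lambda> s \<omega> = interpolate (\<lambda>v. \<phi> \<omega> (vertex v)) (?p s) + interpolate u (?p s)" for s \<omega>
  have split: "\<phi> \<omega> (?p s) + interpolate u (?p s) = (g s \<omega> + \<Lambda> s \<omega>) + h s * Z \<omega>" for s \<omega>
    by (simp add: g_def \<Lambda>_def Z_def W_def edge_fluctuation_def)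
  have bridge: "centered_gaussian_family M {0..l} W (\<lambda>s t. min s t - s * t / l)"
    using \<phi> e unfolding metric_graph_gff_def brownian_bridge_def W_def[abs_def] l_def by auto
  have I_sub: "s \<in> {0..l}" "m < s" "s \<noteq> m" "s \<le> b" if "s \<in> I" for s
    using that ab l m by (auto simp: I_def)
  \<comment> \<open>remove the part of the bridge explained by its value at \<open>m\<close>\<close>
  define T where "T k = (case k of None \<Rightarrow> {m} | Some s \<Rightarrow> {m, s})" for k
  define c where "c k i = (case k of None \<Rightarrow> 1 | Some s \<Rightarrow> if i = s then 1 else - h s)" for k i
  define X where "X k \<omega> = (\<Sum>i\<in>T k. c k i * W i \<omega>)" for k \<omega>
  define K where "K k k' = (\<Sum>i\<in>T k. \<Sum>j\<in>T k'. c k i * c k' j * (min i j - i * j / l))" for k k'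
  have X: "centered_gaussian_family M (insert None (Some ` I)) X K"
    unfolding X_def[abs_def] K_def[abs_def]
    by (rule centered_gaussian_family_linear_combinations[OF bridge])
      (use m I_sub in \<open>auto simp: T_def\<close>)
  have XN: "X None = Z" by (simp add: X_def T_def c_def Z_def fun_eq_iff)
  have XS: "X (Some s) = g s" if "s \<in> I" for s
    using I_sub[OF that] by (simp add: X_def T_def c_def g_def fun_eq_iff)
  have K0: "K None (Some s) = 0 \<and> K (Some s) None = 0" if "s \<in> I" for s
  proof -
    have 1: "m - m * m / l = m * (l - m) / l" and 2: "m - m * s / l = m * (l - s) / l"
      using l by (simp_all add: field_simps)
    have h: "h s * (m - m * m / l) = m - m * s / l"
      unfolding h_def 1 2 using m(3) by simp
    have min: "min m s = m" "min s m = m" using I_sub[OF that] by auto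
    have "K None (Some s) = - h s * (m - m * m / l) + (m - m * s / l)"
      "K (Some s) None = - h s * (m - m * m / l) + (m - s * m / l)"
      using I_sub(3)[OF that] I_sub(3)[OF that, symmetric] by (simp_all add: K_def T_def c_def min)
    then show ?thesis
      unfolding minus_mult_left[symmetric] h by (simp add: mult.commute)
  qed
  have bridge_meas[measurable]: "W s \<in> borel_measurable M" if "s \<in> {0..l}" for s
    using centered_gaussian_family_measurable[OF bridge that] .
  have vert_meas[measurable]: "(\<lambda>\<omega>. \<phi> \<omega> (vertex v)) \<in> borel_measurable M" for v
    using \<phi> by (auto simp: metric_graph_gff_def metric_graph_def)
  have Z_meas: "Z \<in> borel_measurable M"
    unfolding Z_def using m by simp
  have g_meas: "g s \<in> borel_measurable M" if "s \<in> I" for s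
    unfolding g_def[abs_def] using I_sub[OF that] m
    by (intro borel_measurable_diff borel_measurable_times bridge_meas) auto
  have \<Lambda>_meas: "\<Lambda> s \<in> borel_measurable M" for s
    unfolding \<Lambda>_def[abs_def] interpolate_def by measurable
  have seg: "?p s \<in> ?S" if "s \<in> {0..l}" for s
    using that by (auto simp: edge_segment_def l_def)
  have indep: "(\<integral>\<omega>. iexp (t * Z \<omega> + (\<Sum>s\<in>J. b s * g s \<omega>) + (\<Sum>s\<in>J. b s * \<Lambda> s \<omega>)) \<partial>M) =
      (\<integral>\<omega>. iexp (t * Z \<omega> + (\<Sum>s\<in>J. b s * g s \<omega>)) \<partial>M) * (\<integral>\<omega>. iexp (\<Sum>s\<in>J. b s * \<Lambda> s \<omega>) \<partial>M)"
    if J: "finite J" "J \<subseteq> I" for J t and b :: "real \<Rightarrow> real"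
  proof -
    define F where "F w = iexp (t * w (?p m) + (\<Sum>s\<in>J. b s * (w (?p s) - h s * w (?p m))))" for w :: "real ^ 'v \<Rightarrow> real"
    define H where "H w = iexp (\<Sum>s\<in>J. b s * (interpolate (\<lambda>v. w (vertex v)) (?p s) + interpolate u (?p s)))" for w :: "real ^ 'v \<Rightarrow> real"
    have pm: "?p m \<in> ?S" and pJ: "\<And>s. s \<in> J \<Longrightarrow> ?p s \<in> ?S"
      using J I_sub m l by (auto intro!: seg simp: subset_iff)
    have [measurable]: "(\<lambda>w. w (?p m)) \<in> borel_measurable (Pi\<^sub>M ?S (\<lambda>_. borel :: real measure))"
        "\<And>s. s \<in> J \<Longrightarrow> (\<lambda>w. w (?p s)) \<in> borel_measurable (Pi\<^sub>M ?S (\<lambda>_. borel :: real measure))"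
      using pm pJ by (auto intro!: measurable_component_singleton)
    have F: "F \<in> borel_measurable (Pi\<^sub>M ?S (\<lambda>_. borel))" unfolding F_def by measurable
    have [measurable]: "(\<lambda>w. w (vertex v)) \<in> borel_measurable (Pi\<^sub>M (range vertex) (\<lambda>_. borel :: real measure))" for v :: 'v
      by (intro measurable_component_singleton) auto
    have H: "H \<in> borel_measurable (Pi\<^sub>M (range vertex) (\<lambda>_. borel))" unfolding H_def interpolate_def by measurable
    have Feq: "F (restrict (edge_fluctuation (\<phi> \<omega>)) ?S) = iexp (t * Z \<omega> + (\<Sum>s\<in>J. b s * g s \<omega>))" for \<omega>
      using pm pJ by (simp add: F_def Z_def g_def W_def)
    have Heq: "H (restrict (\<phi> \<omega>) (range vertex)) = iexp (\<Sum>s\<in>J. b s * \<Lambda> s \<omega>)" for \<omega>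
      by (simp add: H_def \<Lambda>_def)
    show ?thesis
      using gff_vertices_indep_edge[OF M \<phi> e F _ H] unfolding Feq Heq
      by (simp add: F_def H_def exp_add[symmetric] distrib_left)
  qed
  have "AE \<omega> in M. \<not> ((\<forall>s\<in>I. 0 \<le> (g s \<omega> + \<Lambda> s \<omega>) + h s * Z \<omega>) \<and>
      (\<forall>n::nat. \<exists>s\<in>I. (g s \<omega> + \<Lambda> s \<omega>) + h s * Z \<omega> < 1 / Suc n))"
  proof (rule AE_infimum_nonzero[OF M])
    show "countable I" unfolding I_def by (intro countable_Int1 countable_rat)
    show "AE \<omega> in M. Z \<omega> \<noteq> z" for z
    proof -
      have "centered_normal M Z (m - m * m / l)"
        using centered_gaussian_family_normal[OF bridge, of m] m by (simp add: Z_def)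
      moreover have "m - m * m / l \<noteq> 0" using m l by (simp add: field_simps)
      ultimately show ?thesis by (rule centered_normal_no_atom[OF M])
    qed
    fix J and t and b :: "real \<Rightarrow> real" assume J: "finite J" "J \<subseteq> I"
    have gsplit: "(\<integral>\<omega>. iexp (t * Z \<omega> + (\<Sum>s\<in>J. b s * g s \<omega>)) \<partial>M) =
        (\<integral>\<omega>. iexp (t * Z \<omega>) \<partial>M) * (\<integral>\<omega>. iexp (\<Sum>s\<in>J. b s * g s \<omega>) \<partial>M)"
    proof -
      have s: "(\<Sum>k\<in>Some ` J. b (the k) * X k \<omega>) = (\<Sum>s\<in>J. b s * g s \<omega>)" for \<omega>
        using J by (subst sum.reindex) (auto intro!: sum.cong simp: XS subset_iff)
      show ?thesis
        using gaussian_char_split[OF M X, of None "Some ` J" t "\<lambda>k. b (the k)"] J K0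
        unfolding s XN by auto
    qed
    have "(\<integral>\<omega>. iexp (t * Z \<omega> + (\<Sum>s\<in>J. b s * (g s \<omega> + \<Lambda> s \<omega>))) \<partial>M) =
        (\<integral>\<omega>. iexp (t * Z \<omega> + (\<Sum>s\<in>J. b s * g s \<omega>) + (\<Sum>s\<in>J. b s * \<Lambda> s \<omega>)) \<partial>M)"
      by (simp only: distrib_left sum.distrib add.assoc)
    also have "\<dots> = (\<integral>\<omega>. iexp (t * Z \<omega>) \<partial>M) * ((\<integral>\<omega>. iexp (\<Sum>s\<in>J. b s * g s \<omega>) \<partial>M) * (\<integral>\<omega>. iexp (\<Sum>s\<in>J. b s * \<Lambda> s \<omega>) \<partial>M))"
      by (simp only: indep[OF J] gsplit mult.assoc)
    also have "(\<integral>\<omega>. iexp (\<Sum>s\<in>J. b s * g s \<omega>) \<partial>M) * (\<integral>\<omega>. iexp (\<Sum>s\<in>J. b s * \<Lambda> s \<omega>) \<partial>M) =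
        (\<integral>\<omega>. iexp (\<Sum>s\<in>J. b s * (g s \<omega> + \<Lambda> s \<omega>)) \<partial>M)"
      using indep[OF J, of 0 b] by (simp add: distrib_left sum.distrib)
    finally show "(\<integral>\<omega>. iexp (t * Z \<omega> + (\<Sum>s\<in>J. b s * (g s \<omega> + \<Lambda> s \<omega>))) \<partial>M) =
        (\<integral>\<omega>. iexp (t * Z \<omega>) \<partial>M) * (\<integral>\<omega>. iexp (\<Sum>s\<in>J. b s * (g s \<omega> + \<Lambda> s \<omega>)) \<partial>M)" .
  next
    show "0 < h b" using m l by (simp add: h_def)
    show "h b \<le> h s" if "s \<in> I" for s
      using I_sub[OF that] m by (simp add: h_def divide_right_mono)
  qed (use Z_meas g_meas \<Lambda>_meas in \<open>auto intro!: borel_measurable_add\<close>)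
  then show ?thesis
    unfolding split I_def .
qed

text \<open>
  A zero without negative values nearby would be a minimum over an interval with rational end points.
\<close>

lemma gff_edge_zeros_touched_by_negative_values:
  fixes N :: "'v::finite network" and u :: "'v \<Rightarrow> real"
  assumes M: "prob_space M" and N: "electrical_network N" and \<phi>: "metric_graph_gff M N \<phi>"
  defines "f \<equiv> \<lambda>\<omega> p. \<phi> \<omega> p + interpolate u p"
  shows "AE \<omega> in M. \<forall>x y s \<epsilon>. (x, y) \<in> edges N \<longrightarrow> 0 < s \<longrightarrow> s < edge_length N x y \<longrightarrow>
    f \<omega> (edge_point N x y s) = 0 \<longrightarrow> 0 < \<epsilon> \<longrightarrow>
    (\<exists>r. \<bar>r - s\<bar> < \<epsilon> \<and> 0 < r \<and> r < edge_length N x y \<and> f \<omega> (edge_point N x y r) < 0)"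
proof -
  define bad where "bad \<omega> x y a b \<longleftrightarrow> (\<forall>s\<in>\<rat> \<inter> {a..b}. 0 \<le> f \<omega> (edge_point N x y s)) \<and>
    (\<forall>n::nat. \<exists>s\<in>\<rat> \<inter> {a..b}. f \<omega> (edge_point N x y s) < 1 / Suc n)" for \<omega> x y and a b :: real
  define Q where "Q = {(x, y, a, b). (x, y) \<in> edges N \<and> a \<in> \<rat> \<and> b \<in> \<rat> \<and> 0 < a \<and> a < b \<and> b < edge_length N x y}"
  have "countable Q"
    by (rule countable_subset[of _ "UNIV \<times> UNIV \<times> \<rat> \<times> \<rat>"])
      (auto simp: Q_def intro!: countable_SIGMA countable_rat)
  moreover have "AE \<omega> in M. \<not> bad \<omega> x y a b" if "(x, y, a, b) \<in> Q" for x y a b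
    using gff_no_zero_minimum_on_edge[OF M N \<phi>, of x y a b u] that unfolding bad_def f_def Q_def by auto
  ultimately have "AE \<omega> in M. \<forall>(x, y, a, b)\<in>Q. \<not> bad \<omega> x y a b"
    by (subst AE_ball_countable) auto
  moreover have "AE \<omega> in M. continuous_on (metric_graph N) (\<phi> \<omega>)"
    using \<phi> by (simp add: metric_graph_gff_def)
  ultimately show ?thesis
  proof eventually_elim
    case (elim \<omega>)
    show ?case
    proof (intro allI impI, rule ccontr)
      fix x y s \<epsilon>
      assume e: "(x, y) \<in> edges N" and s: "0 < s" "s < edge_length N x y" "f \<omega> (edge_point N x y s) = 0" and \<epsilon>: "0 < (\<epsilon> :: real)"
        and no: "\<not> (\<exists>r. \<bar>r - s\<bar> < \<epsilon> \<and> 0 < r \<and> r < edge_length N x y \<and> f \<omega> (edge_point N x y r) < 0)"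
      obtain a where a: "a \<in> \<rat>" "max 0 (s - \<epsilon>) < a" "a < s"
        using Rats_dense_in_real[of "max 0 (s - \<epsilon>)" s] s \<epsilon> by auto
      obtain b where b: "b \<in> \<rat>" "s < b" "b < min (edge_length N x y) (s + \<epsilon>)"
        using Rats_dense_in_real[of s "min (edge_length N x y) (s + \<epsilon>)"] s \<epsilon> by auto
      have nonneg: "0 \<le> f \<omega> (edge_point N x y r)" if "r \<in> {a..b}" for r
      proof -
        have "\<bar>r - s\<bar> < \<epsilon>" "0 < r" "r < edge_length N x y" using that a b by auto
        then show ?thesis using no by (meson not_le)
      qed
      have "continuous_on (metric_graph N) (f \<omega>)"
        unfolding f_def by (intro continuous_intros elim(2) continuous_interpolate)
      then have cont: "continuous_on {a..b} (\<lambda>r. f \<omega> (edge_point N x y r))"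
        by (rule continuous_on_compose2[OF _ continuous_edge_point])
          (use a b in \<open>auto intro!: edge_subset_metric_graph[OF e]\<close>)
      have small: "\<exists>r\<in>\<rat> \<inter> {a..b}. f \<omega> (edge_point N x y r) < 1 / Suc n" for n
      proof -
        obtain \<delta> where \<delta>: "0 < \<delta>" "\<And>r. r \<in> {a..b} \<Longrightarrow> dist r s < \<delta> \<Longrightarrow>
            dist (f \<omega> (edge_point N x y r)) (f \<omega> (edge_point N x y s)) < 1 / Suc n"
          using cont[unfolded continuous_on_iff, rule_format, of s "1 / Suc n"] a b by auto
        obtain r where r: "r \<in> \<rat>" "s < r" "r < min b (s + \<delta>)"
          using Rats_dense_in_real[of s "min b (s + \<delta>)"] b \<delta> by auto
        then have "dist (f \<omega> (edge_point N x y r)) (f \<omega> (edge_point N x y s)) < 1 / Suc n"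
          using a by (intro \<delta>(2)) (auto simp: dist_real_def)
        then show ?thesis using r a s(3) by (intro bexI[of _ r]) (auto simp: dist_real_def)
      qed
      have "bad \<omega> x y a b" using nonneg small by (auto simp: bad_def)
      moreover have "(x, y, a, b) \<in> Q" using e a b by (auto simp: Q_def)
      ultimately show False using elim(1) by auto
    qed
  qed
qed

text \<open>
  Next to a vertex with value \<open>0\<close> the field differs from the bridge by a linear function, which the
  steep descents of the bridge overcome.
\<close>

lemma gff_negative_near_zero_boundary_values:
  fixes N :: "'v::finite network" and u :: "'v \<Rightarrow> real"
  assumes M: "prob_space M" and N: "electrical_network N" and \<phi>: "metric_graph_gff M N \<phi>"
  defines "f \<equiv> \<lambda>\<omega> p. \<phi> \<omega> p + interpolate u p"
  shows "AE \<omega> in M. \<forall>x y \<epsilon>. f \<omega> (vertex x) = 0 \<longrightarrow> (x, y) \<in> edges N \<longrightarrow> 0 < \<epsilon> \<longrightarrow>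
    (\<exists>s. 0 < s \<and> s < \<epsilon> \<and> f \<omega> (edge_point N x y s) < 0)"
proof -
  define steep where "steep \<omega> x y \<longleftrightarrow> (\<forall>C. \<forall>\<delta>>0. \<exists>s. 0 < s \<and> s < \<delta> \<and> s \<le> edge_length N x y \<and>
    edge_fluctuation (\<phi> \<omega>) (edge_point N x y s) < - C * s)" for \<omega> x y
  have "AE \<omega> in M. steep \<omega> x y" if "(x, y) \<in> edges N" for x y
  proof -
    have "brownian_bridge M (edge_length N x y) (\<lambda>s \<omega>. edge_fluctuation (\<phi> \<omega>) (edge_point N x y s))"
      using \<phi> that unfolding metric_graph_gff_def by blast
    then show ?thesis
      unfolding steep_def by (rule brownian_bridge_steep_at_zero[OF M _ edge_length_pos[OF N that]])
  qed
  then have "AE \<omega> in M. \<forall>(x, y)\<in>edges N. steep \<omega> x y"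
    by (subst AE_finite_all) auto
  then show ?thesis
  proof eventually_elim
    case (elim \<omega>)
    show ?case
    proof (intro allI impI)
      fix x y and \<epsilon> :: real
      assume f0: "f \<omega> (vertex x) = 0" and e: "(x, y) \<in> edges N" and \<epsilon>: "0 < \<epsilon>"
      define l where "l = edge_length N x y"
      define C where "C = (\<phi> \<omega> (vertex y) + u y) / l"
      have "steep \<omega> x y" using elim e by auto
      then obtain s where s: "0 < s" "s < \<epsilon>" "edge_fluctuation (\<phi> \<omega>) (edge_point N x y s) < - C * s"
        unfolding steep_def using \<epsilon> by blast
      have "u x = - \<phi> \<omega> (vertex x)" using f0 by (simp add: f_def interpolate_vertex)
      then have "f \<omega> (edge_point N x y s) = edge_fluctuation (\<phi> \<omega>) (edge_point N x y s) + C * s"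
        by (simp add: f_def edge_fluctuation_def interpolate_edge_point edge_sym(3)[OF N e] C_def l_def[symmetric]
            add_divide_distrib algebra_simps)
      then show "\<exists>s. 0 < s \<and> s < \<epsilon> \<and> f \<omega> (edge_point N x y s) < 0"
        using s by (intro exI[of _ s]) simp
    qed
  qed
qed

section \<open>End points of excursions\<close>

lemma lifetime_pathD:
  assumes "w \<in> space (lifetime_paths N)"
  shows "0 \<le> fst w" "continuous_on {0..} (snd w)" "trace w \<subseteq> metric_graph N"
proof -
  have "0 \<le> fst w \<and> continuous_on {0..} (snd w) \<and> snd w ` {0..} \<subseteq> metric_graph N"
    using assms unfolding lifetime_paths_def space_restrict_space case_prod_unfold by blast
  then show "0 \<le> fst w" "continuous_on {0..} (snd w)" "trace w \<subseteq> metric_graph N"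
    by (auto simp: trace_def)
qed

text \<open>
  A path rests at its terminal point, which is therefore the limit of its positions at integer times.
\<close>

lemma measurable_terminal_point:
  "(\<lambda>w. snd w (fst w)) \<in> borel_measurable (lifetime_paths N)"
proof (rule borel_measurable_LIMSEQ_metric)
  show "(\<lambda>w. snd w (real n)) \<in> borel_measurable (lifetime_paths N)" for n
    unfolding lifetime_paths_def
    by (intro measurable_restrict_space1 measurable_compose[OF measurable_snd] measurable_component_singleton) simp
next
  fix w assume w: "w \<in> space (lifetime_paths N)"
  have const: "\<forall>t\<ge>fst w. snd w t = snd w (fst w)"
    using w unfolding lifetime_paths_def space_restrict_space case_prod_unfold by blast
  have "snd w (real n) = snd w (fst w)" if "nat \<lceil>fst w\<rceil> \<le> n" for n
  proof -
    have "fst w \<le> real n" using that by linarith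
    then show ?thesis using const by blast
  qed
  then have "eventually (\<lambda>n. snd w (real n) = snd w (fst w)) sequentially"
    by (rule eventually_sequentiallyI)
  then show "(\<lambda>n. snd w (real n)) \<longlonglongrightarrow> snd w (fst w)"
    by (rule tendsto_eventually)
qed

text \<open>
  The intensity charges only paths ending at a boundary vertex, so the number of all other paths is a
  Poisson variable with mean \<open>0\<close>.
\<close>

lemma boundary_excursions_end_in_boundary:
  fixes N :: "'v::finite network"
  assumes M: "prob_space M"
    and X: "poisson_point_process M (lifetime_paths N) (boundary_excursion_measure N u \<nu>) X"
  shows "AE \<omega> in M. \<forall>e\<in>X \<omega>. e \<in> space (lifetime_paths N) \<and> snd e (fst e) \<in> boundary_points N"
proof -
  interpret prob_space M by fact
  define B where "B = {w \<in> space (lifetime_paths N). snd w (fst w) \<notin> boundary_points N}"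
  have "closed (boundary_points N)"
    unfolding boundary_points_def by (intro finite_imp_closed) simp
  then have "- boundary_points N \<in> sets borel" by (intro borel_comp borel_closed)
  moreover have "B = (\<lambda>w. snd w (fst w)) -` (- boundary_points N) \<inter> space (lifetime_paths N)"
    by (auto simp: B_def)
  ultimately have B: "B \<in> sets (lifetime_paths N)"
    using measurable_sets[OF measurable_terminal_point] by metis
  have "emeasure (\<nu> x) {w \<in> B. snd w (fst w) = vertex y} = 0" if "y \<in> boundary N" for x y
  proof -
    have "{w \<in> B. snd w (fst w) = vertex y} = {}"
      using that by (auto simp: B_def boundary_points_def)
    then show ?thesis by (simp only: emeasure_empty)
  qed
  then have 0: "boundary_excursion_measure N u \<nu> B = 0"
    unfolding boundary_excursion_measure_def by simp
  have sub: "\<forall>\<omega>\<in>space M. X \<omega> \<subseteq> space (lifetime_paths N)"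
    using X unfolding poisson_point_process_def by (rule conjunct1)
  have "(AE \<omega> in M. finite (X \<omega> \<inter> B)) \<and>
      (\<lambda>\<omega>. card (X \<omega> \<inter> B)) \<in> measurable M (count_space UNIV) \<and>
      (\<forall>k. prob {\<omega> \<in> space M. card (X \<omega> \<inter> B) = k} =
        enn2real (boundary_excursion_measure N u \<nu> B) ^ k / fact k *
          exp (- enn2real (boundary_excursion_measure N u \<nu> B)))"
    by (rule mp[OF bspec[OF conjunct1[OF conjunct2[OF X[unfolded poisson_point_process_def]]] B]])
      (simp add: 0)
  then have fin: "AE \<omega> in M. finite (X \<omega> \<inter> B)"
    and [measurable]: "(\<lambda>\<omega>. card (X \<omega> \<inter> B)) \<in> measurable M (count_space UNIV)"
    and k: "\<And>k. prob {\<omega> \<in> space M. card (X \<omega> \<inter> B) = k} = 0 ^ k / fact k"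
    unfolding 0 by auto
  have "prob {\<omega> \<in> space M. card (X \<omega> \<inter> B) = 0} = 1"
    unfolding k by simp
  then have "AE \<omega> in M. \<omega> \<in> {\<omega> \<in> space M. card (X \<omega> \<inter> B) = 0}"
    by (subst (asm) prob_eq_1) auto
  with fin show ?thesis
  proof eventually_elim
    case (elim \<omega>)
    then have "X \<omega> \<inter> B = {}" "X \<omega> \<subseteq> space (lifetime_paths N)" using sub by auto
    then show ?case unfolding B_def by blast
  qed
qed

section \<open>Non-negative paths to the boundary\<close>

text \<open>
  The intermediate value theorem for the edge parameter of a curve.
\<close>

lemma edge_coordinate_interval:
  fixes q :: "real \<Rightarrow> real ^ 'v::finite"
  assumes N: "electrical_network N" and q: "continuous_on {a..b} q" "q ` {a..b} \<subseteq> metric_graph N"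
    and xy: "x \<noteq> y" and x: "\<And>\<tau>. \<tau> \<in> {a..b} \<Longrightarrow> 0 < q \<tau> $ x"
    and ends: "\<tau>\<^sub>1 \<in> {a..b}" "\<tau>\<^sub>2 \<in> {a..b}" and c: "q \<tau>\<^sub>1 $ y \<le> c" "c \<le> q \<tau>\<^sub>2 $ y" "0 < c"
  shows "edge_point N x y (edge_length N x y * c) \<in> q ` {a..b}"
proof -
  have "connected ((\<lambda>\<tau>. q \<tau> $ y) ` {a..b})"
    by (intro connected_continuous_image continuous_intros q) simp
  then have "{q \<tau>\<^sub>1 $ y..q \<tau>\<^sub>2 $ y} \<subseteq> (\<lambda>\<tau>. q \<tau> $ y) ` {a..b}"
    using ends by (intro connected_contains_Icc) auto
  then obtain \<tau> where \<tau>: "\<tau> \<in> {a..b}" "q \<tau> $ y = c" using c by force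
  have "q \<tau> = edge_point N x y (edge_length N x y * q \<tau> $ y)"
    by (rule metric_graph_edge_coordinates(2)[OF N _ xy x]) (use \<tau> q c in auto)
  then show ?thesis using \<tau> by (metis image_eqI)
qed

text \<open>
  At an interior time in an open edge the edge parameter of an arc is strictly monotone, so the arc
  covers a neighbourhood of its position in the edge.  A zero of \<open>f\<close> there would have no negative values
  nearby.
\<close>

lemma nonneg_arc_crosses_no_zero:
  fixes f :: "real ^ 'v::finite \<Rightarrow> real" and q :: "real \<Rightarrow> real ^ 'v"
  assumes N: "electrical_network N" and q: "continuous_on {a..b} q" "inj_on q {a..b}"
      "q ` {a..b} \<subseteq> metric_graph N" "\<And>\<tau>. \<tau> \<in> {a..b} \<Longrightarrow> 0 \<le> f (q \<tau>)"
    and t: "a < t" "t < b" "q t \<notin> boundary_points N"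
    and touch: "\<And>x y s \<epsilon>. (x, y) \<in> edges N \<Longrightarrow> 0 < s \<Longrightarrow> s < edge_length N x y \<Longrightarrow>
      f (edge_point N x y s) = 0 \<Longrightarrow> 0 < \<epsilon> \<Longrightarrow> \<exists>r. \<bar>r - s\<bar> < \<epsilon> \<and> 0 < r \<and> r < edge_length N x y \<and> f (edge_point N x y r) < 0"
    and interior: "\<And>x. x \<notin> boundary N \<Longrightarrow> f (vertex x) \<noteq> 0"
  shows "0 < f (q t)"
proof (rule ccontr)
  assume "\<not> 0 < f (q t)"
  moreover have "0 \<le> f (q t)" using t by (intro q(4)) auto
  ultimately have f0: "f (q t) = 0" by simp
  have qt: "q t \<in> metric_graph N" using q(3) t by auto
  show False
    using N qt
  proof (cases rule: metric_graph_cases)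
    case (vertex v)
    then show False using t(3) f0 interior[of v] by (auto simp: boundary_points_def)
  next
    case (edge x y s)
    define l where "l = edge_length N x y"
    have l: "0 < l" using edge_length_pos[OF N edge(1)] by (simp add: l_def)
    have xy: "x \<noteq> y" using edge_sym[OF N edge(1)] by simp
    have cy: "q t $ y = s / l" and cx: "q t $ x = 1 - s / l"
      unfolding edge(4) edge_point_coordinates[OF N edge(1)] l_def by simp_all
    have pos: "0 < q t $ x" "0 < q t $ y" unfolding cx cy using edge(2,3) l by (simp_all add: l_def)
    have cont: "continuous_on {a..b} (\<lambda>\<tau>. q \<tau> $ x)" "continuous_on {a..b} (\<lambda>\<tau>. q \<tau> $ y)"
      by (intro continuous_intros q)+
    have "isCont (\<lambda>\<tau>. q \<tau> $ x) t" "isCont (\<lambda>\<tau>. q \<tau> $ y) t"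
      using cont t by (auto intro!: continuous_on_interior[of "{a..b}"])
    then have "eventually (\<lambda>\<tau>. 0 < q \<tau> $ x) (at t)" "eventually (\<lambda>\<tau>. 0 < q \<tau> $ y) (at t)"
      using pos unfolding isCont_def by (auto intro: order_tendstoD)
    then obtain \<delta>\<^sub>1 where \<delta>\<^sub>1: "0 < \<delta>\<^sub>1" "\<And>\<tau>. \<tau> \<noteq> t \<Longrightarrow> dist \<tau> t < \<delta>\<^sub>1 \<Longrightarrow> 0 < q \<tau> $ x \<and> 0 < q \<tau> $ y"
      using eventually_conj[of "\<lambda>\<tau>. 0 < q \<tau> $ x" "at t" "\<lambda>\<tau>. 0 < q \<tau> $ y"] unfolding eventually_at by blast
    define \<delta> where "\<delta> = min (\<delta>\<^sub>1 / 2) (min (t - a) (b - t))"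
    have \<delta>: "0 < \<delta>" "a \<le> t - \<delta>" "t + \<delta> \<le> b" using \<delta>\<^sub>1 t by (auto simp: \<delta>_def min_def)
    have near: "0 < q \<tau> $ x" "0 < q \<tau> $ y" "\<tau> \<in> {a..b}" if "\<tau> \<in> {t - \<delta>..t + \<delta>}" for \<tau>
    proof -
      have "dist \<tau> t < \<delta>\<^sub>1" using that \<delta>\<^sub>1(1) by (auto simp: dist_real_def \<delta>_def min_def split: if_splits)
      then show "0 < q \<tau> $ x" "0 < q \<tau> $ y" using \<delta>\<^sub>1(2) pos by (cases "\<tau> = t"; auto)+
      show "\<tau> \<in> {a..b}" using that \<delta> by auto
    qed
    have sub: "{t - \<delta>..t + \<delta>} \<subseteq> {a..b}" using \<delta> by auto
    have cont': "continuous_on {t - \<delta>..t + \<delta>} q" using q(1) sub by (rule continuous_on_subset)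
    have inj: "inj_on (\<lambda>\<tau>. q \<tau> $ y) {t - \<delta>..t + \<delta>}"
    proof (rule inj_onI)
      fix \<tau> \<tau>' assume \<tau>: "\<tau> \<in> {t - \<delta>..t + \<delta>}" "\<tau>' \<in> {t - \<delta>..t + \<delta>}" "q \<tau> $ y = q \<tau>' $ y"
      have "q \<tau> = edge_point N x y (edge_length N x y * q \<tau> $ y)"
        using near[OF \<tau>(1)] q(3) by (intro metric_graph_edge_coordinates(2)[OF N _ xy]) auto
      also note \<tau>(3)
      also have "edge_point N x y (edge_length N x y * q \<tau>' $ y) = q \<tau>'"
        using near[OF \<tau>(2)] q(3) by (intro metric_graph_edge_coordinates(2)[OF N _ xy, symmetric]) auto
      finally show "\<tau> = \<tau>'" using q(2) near(3)[OF \<tau>(1)] near(3)[OF \<tau>(2)] by (auto dest: inj_onD)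
    qed
    \<comment> \<open>the two sides are interchangeable; only that \<open>q t $ y\<close> is strictly between matters\<close>
    have mono: "q (t - \<delta>) $ y < q t $ y \<and> q t $ y < q (t + \<delta>) $ y \<or> q (t + \<delta>) $ y < q t $ y \<and> q t $ y < q (t - \<delta>) $ y"
      using \<delta>(1) by (intro continuous_inj_imp_mono[OF _ _ _ inj] continuous_intros cont') auto
    obtain \<tau>\<^sub>1 \<tau>\<^sub>2 where \<tau>: "\<tau>\<^sub>1 \<in> {t - \<delta>..t + \<delta>}" "\<tau>\<^sub>2 \<in> {t - \<delta>..t + \<delta>}" "q \<tau>\<^sub>1 $ y < q t $ y" "q t $ y < q \<tau>\<^sub>2 $ y"
    proof (cases "q (t - \<delta>) $ y < q t $ y")
      case True
      then show thesis using mono \<delta>(1) by (intro that[of "t - \<delta>" "t + \<delta>"]) auto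
    next
      case False
      then show thesis using mono \<delta>(1) by (intro that[of "t + \<delta>" "t - \<delta>"]) auto
    qed
    define \<epsilon> where "\<epsilon> = l * min (q t $ y - q \<tau>\<^sub>1 $ y) (q \<tau>\<^sub>2 $ y - q t $ y)"
    have "0 < \<epsilon>" using l \<tau> by (simp add: \<epsilon>_def)
    then obtain r where r: "\<bar>r - s\<bar> < \<epsilon>" "0 < r" "f (edge_point N x y r) < 0"
      using touch[OF edge(1-3)] f0 edge(4) by metis
    have "\<bar>r / l - s / l\<bar> = \<bar>r - s\<bar> / l" using l by (simp add: diff_divide_distrib[symmetric])
    also have "\<dots> < min (q t $ y - q \<tau>\<^sub>1 $ y) (q \<tau>\<^sub>2 $ y - q t $ y)"
      using r(1) unfolding \<epsilon>_def by (simp only: pos_divide_less_eq[OF l] mult.commute)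
    finally have rl: "q \<tau>\<^sub>1 $ y \<le> r / l" "r / l \<le> q \<tau>\<^sub>2 $ y" unfolding cy by linarith+
    have "edge_point N x y (edge_length N x y * (r / l)) \<in> q ` {t - \<delta>..t + \<delta>}"
      by (rule edge_coordinate_interval[OF N cont' _ xy _ \<tau>(1,2) rl])
        (use near q(3) r l in auto)
    then obtain \<tau> where "\<tau> \<in> {t - \<delta>..t + \<delta>}" "edge_point N x y r = q \<tau>"
      using l by (auto simp: l_def)
    then show False using r(3) q(4) near(3) by force
  qed
qed

text \<open>
  Shortly before reaching \<open>z\<close> the arc is inside an edge from \<open>z\<close> to some \<open>y\<close>, and until it reaches \<open>z\<close> it
  has to cover the part of this edge between its position and \<open>z\<close>, where \<open>f\<close> takes negative values.
\<close>

lemma nonneg_arc_avoids_steep_vertex: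
  fixes f :: "real ^ 'v::finite \<Rightarrow> real" and q :: "real \<Rightarrow> real ^ 'v"
  assumes N: "electrical_network N" and q: "continuous_on {a..b} q" "inj_on q {a..b}"
      "q ` {a..b} \<subseteq> metric_graph N" "\<And>\<tau>. \<tau> \<in> {a..b} \<Longrightarrow> 0 \<le> f (q \<tau>)" and ab: "a < b"
    and z: "q b = vertex z"
    and steep: "\<And>y \<epsilon>. (z, y) \<in> edges N \<Longrightarrow> 0 < \<epsilon> \<Longrightarrow>
      \<exists>s. 0 < s \<and> s < \<epsilon> \<and> f (edge_point N z y s) < 0"
  shows False
proof -
  have qz: "q b $ z = 1" by (simp add: z vertex_nth)
  have cont: "continuous_on {a..b} (\<lambda>\<tau>. q \<tau> $ z)" by (intro continuous_intros q)
  then obtain \<delta> where \<delta>: "0 < \<delta>" "\<And>\<tau>. \<tau> \<in> {a..b} \<Longrightarrow> dist \<tau> b < \<delta> \<Longrightarrow> dist (q \<tau> $ z) (q b $ z) < 1"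
    using ab unfolding continuous_on_iff by (metis atLeastAtMost_iff less_eq_real_def zero_less_one)
  define t where "t = max a (b - \<delta> / 2)"
  have t: "a \<le> t" "t < b" using ab \<delta> by (auto simp: t_def)
  have near: "0 < q \<tau> $ z" if "\<tau> \<in> {t..b}" for \<tau>
  proof -
    have "dist \<tau> b < \<delta>" using that \<delta>(1) by (auto simp: dist_real_def t_def)
    then have "dist (q \<tau> $ z) (q b $ z) < 1" using \<delta>(2) that t by auto
    then show ?thesis using qz by (auto simp: dist_real_def)
  qed
  have cont': "continuous_on {t..b} q" using q(1) t by (auto elim: continuous_on_subset)
  have "q t \<noteq> q b" using q(2) t by (auto dest: inj_onD)
  moreover have qt: "q t \<in> metric_graph N" "0 < q t $ z" using t near[of t] q(3) by auto
  ultimately obtain y where y: "y \<noteq> z" "0 < q t $ y"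
    using metric_graph_near_vertex[OF N qt] unfolding z by blast
  have e: "(z, y) \<in> edges N"
    by (rule metric_graph_edge_coordinates(1)[OF N qt(1) y(1)[symmetric] qt(2) y(2)])
  define l where "l = edge_length N z y"
  have l: "0 < l" using edge_length_pos[OF N e] by (simp add: l_def)
  obtain s where s: "0 < s" "s < l * q t $ y" "f (edge_point N z y s) < 0"
    using steep[OF e, of "l * q t $ y"] l y by auto
  have "edge_point N z y (edge_length N z y * (s / l)) \<in> q ` {t..b}"
    by (rule edge_coordinate_interval[OF N cont' _ y(1)[symmetric] near, of b t])
      (use t q(3) s l y in \<open>auto simp: z vertex_nth divide_le_eq mult.commute\<close>)
  then obtain \<tau> where "\<tau> \<in> {t..b}" "edge_point N z y s = q \<tau>"
    using l by (auto simp: l_def)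
  then show False using s(3) q(4)[of \<tau>] t by auto
qed

text \<open>
  \<open>S\<close> is the arc without its starting point \<open>p\<close>, up to its first boundary point.  The point \<open>p\<close> is left
  out because it may itself be a zero of \<open>f\<close>.
\<close>

lemma first_passage_positive_connection:
  fixes f :: "real ^ 'v::finite \<Rightarrow> real"
  assumes N: "electrical_network N" and p: "p \<in> first_passage_set N 0 f" "p \<notin> boundary_points N"
    and touch: "\<And>x y s \<epsilon>. (x, y) \<in> edges N \<Longrightarrow> 0 < s \<Longrightarrow> s < edge_length N x y \<Longrightarrow>
      f (edge_point N x y s) = 0 \<Longrightarrow> 0 < \<epsilon> \<Longrightarrow> \<exists>r. \<bar>r - s\<bar> < \<epsilon> \<and> 0 < r \<and> r < edge_length N x y \<and> f (edge_point N x y r) < 0"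
    and interior: "\<And>x. x \<notin> boundary N \<Longrightarrow> f (vertex x) \<noteq> 0"
    and steep: "\<And>x y \<epsilon>. x \<in> boundary N \<Longrightarrow> f (vertex x) = 0 \<Longrightarrow> (x, y) \<in> edges N \<Longrightarrow> 0 < \<epsilon> \<Longrightarrow>
      \<exists>s. 0 < s \<and> s < \<epsilon> \<and> f (edge_point N x y s) < 0"
  shows "\<exists>S z. connected S \<and> S \<subseteq> {q \<in> metric_graph N. 0 < f q} \<and> p \<in> closure S \<and>
    z \<in> boundary N \<and> 0 < f (vertex z) \<and> vertex z \<in> S"
proof -
  obtain \<gamma> where \<gamma>: "path \<gamma>" "path_image \<gamma> \<subseteq> metric_graph N" "pathstart \<gamma> = p"
    "pathfinish \<gamma> \<in> boundary_points N" "\<And>q. q \<in> path_image \<gamma> \<Longrightarrow> 0 \<le> f q"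
    using p(1) by (auto simp: first_passage_set_def)
  have "p \<noteq> pathfinish \<gamma>" using p(2) \<gamma>(4) by auto
  then obtain q where q: "arc q" "path_image q \<subseteq> path_image \<gamma>" "pathstart q = p" "pathfinish q = pathfinish \<gamma>"
    using path_contains_arc[OF \<gamma>(1,3) refl] by metis
  have qc: "continuous_on {0..1} q" and qi: "inj_on q {0..1}"
    using q(1) by (auto simp: arc_def path_def)
  have qG: "q ` {0..1} \<subseteq> metric_graph N"
    using q(2) \<gamma>(2) by (simp add: path_image_def)
  have qf: "0 \<le> f (q t)" if "t \<in> {0..1}" for t
    using that q(2) by (intro \<gamma>(5)) (auto simp: path_image_def)
  define T where "T = {t \<in> {0..1}. q t \<in> boundary_points N}"
  have "closed (boundary_points N)" unfolding boundary_points_def by (intro finite_imp_closed) simp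
  then have "closed T" unfolding T_def
    using continuous_closed_preimage[OF qc] by (simp add: vimage_def Int_def)
  moreover have "bounded T" by (rule bounded_subset[of "{0..1}"]) (auto simp: T_def)
  ultimately have "compact T" by (simp add: compact_eq_bounded_closed)
  moreover have "1 \<in> T" using q(4) \<gamma>(4) by (simp add: T_def pathfinish_def)
  ultimately obtain t\<^sub>0 where t\<^sub>0: "t\<^sub>0 \<in> T" "\<And>t. t \<in> T \<Longrightarrow> t\<^sub>0 \<le> t"
    using compact_attains_inf[of T] by blast
  have q0: "q 0 = p" using q(3) by (simp add: pathstart_def)
  have "t\<^sub>0 \<noteq> 0" using t\<^sub>0(1) q0 p(2) by (auto simp: T_def)
  then have t\<^sub>0_pos: "0 < t\<^sub>0" "t\<^sub>0 \<le> 1" using t\<^sub>0(1) by (auto simp: T_def)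
  obtain z where z: "z \<in> boundary N" "q t\<^sub>0 = vertex z"
    using t\<^sub>0(1) by (auto simp: T_def boundary_points_def)
  have sub: "{0..t\<^sub>0} \<subseteq> {0..1}" using t\<^sub>0_pos by auto
  have qc': "continuous_on {0..t\<^sub>0} q" using qc sub by (rule continuous_on_subset)
  have qi': "inj_on q {0..t\<^sub>0}" using qi sub by (rule inj_on_subset)
  have qG': "q ` {0..t\<^sub>0} \<subseteq> metric_graph N" and qf': "\<And>t. t \<in> {0..t\<^sub>0} \<Longrightarrow> 0 \<le> f (q t)"
    using qG qf sub by auto
  have fz: "0 < f (vertex z)"
  proof (rule ccontr)
    assume "\<not> 0 < f (vertex z)"
    then have "f (vertex z) = 0" using qf'[of t\<^sub>0] t\<^sub>0_pos z by auto
    then show False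
      using nonneg_arc_avoids_steep_vertex[where f = f, OF N qc' qi' qG' qf' t\<^sub>0_pos(1) z(2)]
        steep[OF z(1)] by blast
  qed
  have pos: "0 < f (q t)" if t: "0 < t" "t < t\<^sub>0" for t
  proof (rule nonneg_arc_crosses_no_zero[where f = f, OF N qc' qi' qG' qf' t _ touch interior])
    show "q t \<notin> boundary_points N"
      using t t\<^sub>0(2)[of t] t\<^sub>0_pos by (auto simp: T_def)
  qed auto
  define S where "S = q ` {0<..t\<^sub>0}"
  have "connected S" unfolding S_def
    by (intro connected_continuous_image continuous_on_subset[OF qc']) auto
  moreover have "S \<subseteq> {q \<in> metric_graph N. 0 < f q}"
  proof -
    have "0 < f (q t)" if "t \<in> {0<..t\<^sub>0}" for t
      using that pos[of t] fz z by (cases "t = t\<^sub>0") auto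
    then show ?thesis using qG' by (auto simp: S_def image_subset_iff)
  qed
  moreover have "p \<in> closure S"
  proof -
    have "q ` closure {0<..t\<^sub>0} \<subseteq> closure (q ` {0<..t\<^sub>0})"
      using t\<^sub>0_pos qc' by (intro image_closure_subset) (auto intro: closure_subset[THEN subsetD])
    then show ?thesis using t\<^sub>0_pos q0 by (auto simp: S_def)
  qed
  moreover have "vertex z \<in> S" unfolding S_def z(2)[symmetric] using t\<^sub>0_pos by (intro imageI) auto
  ultimately show ?thesis using z fz by blast
qed

section \<open>First passage sets and excursion clusters\<close>

text \<open>
  A segment on which the local time is positive has positive occupation time.
\<close>

lemma local_time_positive_imp_visited:
  fixes N :: "'v::finite network"
  assumes N: "electrical_network N" and loc: "total_local_time N X l"
    and e: "(x, y) \<in> edges N" and pos: "0 < l (vertex x)"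
  shows "\<exists>\<delta>>0. \<delta> \<le> edge_length N x y \<and> (\<forall>s\<in>{0..\<delta>}. 0 < l (edge_point N x y s)) \<and>
    (\<exists>w\<in>X. trace w \<inter> edge_point N x y ` {0..\<delta>} \<noteq> {})"
proof -
  let ?e = "edge_point N x y" and ?l = "edge_length N x y"
  have len: "0 < ?l" by (rule edge_length_pos[OF N e])
  have lc: "continuous_on (metric_graph N) l" using loc by (simp add: total_local_time_def)
  have "continuous_on {0..?l} (\<lambda>s. l (?e s))"
    by (rule continuous_on_compose2[OF lc continuous_edge_point]) (auto intro: edge_subset_metric_graph[OF e])
  moreover have e0: "?e 0 = vertex x" by (simp add: edge_point_def)
  ultimately obtain \<delta>' where \<delta>': "0 < \<delta>'" "\<And>s. s \<in> {0..?l} \<Longrightarrow> dist s 0 < \<delta>' \<Longrightarrow> dist (l (?e s)) (l (vertex x)) < l (vertex x)"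
    using pos len unfolding continuous_on_iff by (metis atLeastAtMost_iff less_imp_le order_refl)
  define \<delta> where "\<delta> = min ?l (\<delta>' / 2)"
  have \<delta>: "0 < \<delta>" "\<delta> \<le> ?l" "\<delta> < \<delta>'" using \<delta>' len by (auto simp: \<delta>_def)
  have l_pos: "0 < l (?e s)" if "s \<in> {0..\<delta>}" for s
    using \<delta>'(2)[of s] that \<delta> by (auto simp: dist_real_def)
  define B where "B = ?e ` {0..\<delta>}"
  have BG: "B \<subseteq> metric_graph N" using \<delta> by (auto simp: B_def intro!: edge_subset_metric_graph[OF e])
  have "compact B" unfolding B_def by (intro compact_continuous_image continuous_edge_point) simp
  then have "B \<in> sets borel" by (intro borel_closed compact_imp_closed)
  then have B: "B \<in> sets (length_measure N)"
    using BG by (auto simp: sets_restrict_space intro!: image_eqI[of _ _ B])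
  have B_mass: "emeasure (length_measure N) B \<noteq> 0"
  proof
    assume "emeasure (length_measure N) B = 0"
    then have "(\<Sum>(x, y)\<in>edges N. emeasure lborel {s \<in> {0..edge_length N x y}. edge_point N x y s \<in> B}) = 0"
      using emeasure_length_measure[OF B] by (simp add: ennreal_divide_eq_0_iff)
    then have "emeasure lborel {s \<in> {0..?l}. ?e s \<in> B} = 0"
      using e by (subst (asm) sum_nonneg_eq_0_iff) auto
    moreover have "emeasure lborel {0..\<delta>} \<le> emeasure lborel {s \<in> {0..?l}. ?e s \<in> B}"
    proof (rule emeasure_mono)
      show "{0..\<delta>} \<subseteq> {s \<in> {0..?l}. ?e s \<in> B}" using \<delta> by (auto simp: B_def)
      have "{s \<in> {0..?l}. ?e s \<in> B} = {0..?l} \<inter> ?e -` B" by auto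
      moreover have "closed ({0..?l} \<inter> ?e -` B)"
        using \<open>compact B\<close> by (intro continuous_closed_preimage continuous_edge_point compact_imp_closed) auto
      ultimately show "{s \<in> {0..?l}. ?e s \<in> B} \<in> sets lborel" by simp
    qed
    ultimately show False using \<delta>(1) by simp
  qed
  have "\<exists>w\<in>X. trace w \<inter> B \<noteq> {}"
  proof (rule ccontr)
    assume none: "\<not> (\<exists>w\<in>X. trace w \<inter> B \<noteq> {})"
    have "(\<integral>\<^sup>+t\<in>{0..fst w}. indicator B (snd w t) \<partial>lborel) = 0" if "w \<in> X" for w
    proof -
      have "snd w t \<notin> B" if "t \<in> {0..fst w}" for t
        using none \<open>w \<in> X\<close> that unfolding trace_def by blast
      then have "(\<integral>\<^sup>+t\<in>{0..fst w}. indicator B (snd w t) \<partial>lborel) = (\<integral>\<^sup>+t. 0 \<partial>(lborel :: real measure))"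
        by (intro nn_integral_cong) (auto simp: indicator_def)
      then show ?thesis by simp
    qed
    then have "(\<integral>\<^sup>+w. (\<integral>\<^sup>+t\<in>{0..fst w}. indicator B (snd w t) \<partial>lborel) \<partial>count_space X) = (\<integral>\<^sup>+w. 0 \<partial>count_space X)"
      by (intro nn_integral_cong) simp
    moreover have "(\<integral>\<^sup>+w. (\<integral>\<^sup>+t\<in>{0..fst w}. indicator B (snd w t) \<partial>lborel) \<partial>count_space X) =
        (\<integral>\<^sup>+p\<in>B. ennreal (l p) \<partial>length_measure N)"
      using loc B unfolding total_local_time_def by blast
    ultimately have "(\<integral>\<^sup>+p\<in>B. ennreal (l p) \<partial>length_measure N) = 0" by simp
    moreover have [measurable]: "l \<in> borel_measurable (length_measure N)"
      using borel_measurable_continuous_on_restrict[OF lc] by (simp cong: measurable_cong_sets)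
    have [measurable]: "B \<in> sets (length_measure N)" by (rule B)
    have "(\<lambda>p. ennreal (l p) * indicator B p) \<in> borel_measurable (length_measure N)" by measurable
    ultimately have "AE p in length_measure N. ennreal (l p) * indicator B p = 0"
      by (subst (asm) nn_integral_0_iff_AE) auto
    then have "AE p in length_measure N. p \<notin> B"
      by eventually_elim (use l_pos in \<open>auto simp: B_def indicator_def ennreal_eq_0_iff not_le[symmetric] split: if_splits\<close>)
    then have "emeasure (length_measure N) B = 0"
      using B by (subst (asm) AE_iff_measurable[OF B]) (use sets.sets_into_space[OF B] in auto)
    with B_mass show False by simp
  qed
  then show ?thesis using \<delta> l_pos unfolding B_def by blast
qed

lemma first_passage_point_in_excursion_cluster:
  fixes f :: "real ^ 'v::finite \<Rightarrow> real"
  assumes N: "electrical_network N" and p: "p \<in> first_passage_set N 0 f" "p \<notin> boundary_points N"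
    and touch: "\<And>x y s \<epsilon>. (x, y) \<in> edges N \<Longrightarrow> 0 < s \<Longrightarrow> s < edge_length N x y \<Longrightarrow>
      f (edge_point N x y s) = 0 \<Longrightarrow> 0 < \<epsilon> \<Longrightarrow> \<exists>r. \<bar>r - s\<bar> < \<epsilon> \<and> 0 < r \<and> r < edge_length N x y \<and> f (edge_point N x y r) < 0"
    and interior: "\<And>x. x \<notin> boundary N \<Longrightarrow> f (vertex x) \<noteq> 0"
    and steep: "\<And>x y \<epsilon>. x \<in> boundary N \<Longrightarrow> f (vertex x) = 0 \<Longrightarrow> (x, y) \<in> edges N \<Longrightarrow> 0 < \<epsilon> \<Longrightarrow>
      \<exists>s. 0 < s \<and> s < \<epsilon> \<and> f (edge_point N x y s) < 0"
    and loc: "total_local_time N X l" and le: "\<And>q. q \<in> metric_graph N \<Longrightarrow> l q \<le> L q"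
    and f_L: "\<And>q. q \<in> metric_graph N \<Longrightarrow> 0 < f q \<Longrightarrow> 0 < L q"
    and f_l: "\<And>x. x \<in> boundary N \<Longrightarrow> 0 < f (vertex x) \<Longrightarrow> 0 < l (vertex x)"
  shows "\<exists>K\<in>components (positivity_set N L). contains_excursion X K \<and> p \<in> closure K"
proof -
  obtain S z where S: "connected S" "S \<subseteq> {q \<in> metric_graph N. 0 < f q}" "p \<in> closure S"
      "z \<in> boundary N" "0 < f (vertex z)" "vertex z \<in> S"
    using first_passage_positive_connection[OF N p touch interior steep] by blast
  let ?U = "positivity_set N L"
  define K where "K = connected_component_set ?U (vertex z)"
  have SU: "S \<subseteq> ?U" using S(2) f_L by (auto simp: positivity_set_def)
  then have zU: "vertex z \<in> ?U" using S(6) by auto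
  then have K: "K \<in> components ?U" unfolding K_def by (rule componentsI)
  have SK: "S \<subseteq> K" unfolding K_def by (rule connected_component_maximal[OF S(6,1) SU])
  obtain y where y: "(z, y) \<in> edges N" using vertex_has_neighbour[OF N] .
  obtain \<delta> where \<delta>: "0 < \<delta>" "\<delta> \<le> edge_length N z y" "\<And>s. s \<in> {0..\<delta>} \<Longrightarrow> 0 < l (edge_point N z y s)"
    and visit: "\<exists>w\<in>X. trace w \<inter> edge_point N z y ` {0..\<delta>} \<noteq> {}"
    using local_time_positive_imp_visited[OF N loc y f_l[OF S(4,5)]] by blast
  have "edge_point N z y ` {0..\<delta>} \<subseteq> K"
    unfolding K_def
  proof (rule connected_component_maximal)
    show "vertex z \<in> edge_point N z y ` {0..\<delta>}"
      using \<delta>(1) by (intro image_eqI[of _ _ 0]) (auto simp: edge_point_def)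
    show "connected (edge_point N z y ` {0..\<delta>})"
      by (intro connected_continuous_image continuous_edge_point) simp
    show "edge_point N z y ` {0..\<delta>} \<subseteq> ?U"
    proof
      fix q assume "q \<in> edge_point N z y ` {0..\<delta>}"
      then obtain s where s: "s \<in> {0..\<delta>}" "q = edge_point N z y s" by auto
      then have "q \<in> metric_graph N" using \<delta> by (auto intro!: edge_subset_metric_graph[OF y])
      then show "q \<in> ?U" using \<delta>(3)[OF s(1)] le[of q] s by (auto simp: positivity_set_def)
    qed
  qed
  then have "contains_excursion X K" using visit unfolding contains_excursion_def by blast
  moreover have "p \<in> closure K" using S(3) closure_mono[OF SK] by auto
  ultimately show ?thesis using K by blast
qed

lemma positivity_component_path_connected:
  assumes N: "electrical_network N" and L: "continuous_on (metric_graph N) L"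
    and K: "K \<in> components (positivity_set N L)"
  shows "path_connected K"
proof -
  have "openin (top_of_set (metric_graph N)) (metric_graph N \<inter> L -` {0<..})"
    by (rule continuous_openin_preimage_gen[OF L]) simp
  then have "openin (top_of_set (metric_graph N)) (positivity_set N L)"
    by (simp add: positivity_set_def vimage_def Int_def)
  then have "locally path_connected (positivity_set N L)"
    using locally_path_connected_metric_graph[OF N] by (rule locally_open_subset[rotated])
  moreover obtain x where "x \<in> positivity_set N L" "K = connected_component_set (positivity_set N L) x"
    using K by (auto simp: components_def)
  ultimately show ?thesis
    using path_component_eq_connected_component_set path_connected_path_component by metis
qed

text \<open>
  Inside an edge, a limit point outside \<open>K\<close> is approached along this edge from one of its two sides,
  and \<open>connected_subset_accumulating_along_edge\<close> supplies a segment to it.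
\<close>

lemma component_closure_path_accessible:
  fixes N :: "'v::finite network"
  assumes N: "electrical_network N" and L: "continuous_on (metric_graph N) L"
    and K: "K \<in> components (positivity_set N L)" and k: "k \<in> K"
    and p: "p \<in> closure K" and vertices: "\<And>v. p = vertex v \<Longrightarrow> p \<in> K"
  shows "path_component (closure K) p k"
proof -
  have KG: "K \<subseteq> metric_graph N" using in_components_subset[OF K] by (auto simp: positivity_set_def)
  have Kc: "connected K" by (rule in_components_connected[OF K])
  have inside: "path_component (closure K) q k" if "q \<in> K" for q
    using positivity_component_path_connected[OF N L K] that k closure_subset
    by (meson path_component_of_subset path_connected_component)
  show ?thesis
  proof (cases "p \<in> K")
    case False
    have pG: "p \<in> metric_graph N"
      using p KG closed_metric_graph[OF N] closure_minimal by blast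
    have "\<exists>k'\<in>K. closed_segment p k' \<subseteq> closure K"
      using N pG
    proof (cases rule: metric_graph_cases)
      case (vertex v)
      then show ?thesis using vertices False by auto
    next
      case (edge x y s)
      note xy = edge_sym(3)[OF N edge(1)]
      have c: "p $ y = s / edge_length N x y" "p $ x = 1 - s / edge_length N x y"
        unfolding edge(4) by (rule edge_point_coordinates[OF N edge(1)])+
      have pos: "0 < p $ x" "0 < p $ y" unfolding c using edge(2,3) by simp_all
      have near: "\<exists>q\<in>K. 0 < q $ x \<and> 0 < q $ y \<and> q $ y \<noteq> p $ y \<and> \<bar>q $ y - p $ y\<bar> < \<epsilon>" if "0 < \<epsilon>" for \<epsilon>
      proof -
        have "open {q. 0 < q $ x \<and> 0 < q $ y \<and> \<bar>q $ y - p $ y\<bar> < \<epsilon>}"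
          by (intro open_Collect_conj open_Collect_less continuous_intros)
        moreover have "p \<in> {q. 0 < q $ x \<and> 0 < q $ y \<and> \<bar>q $ y - p $ y\<bar> < \<epsilon>}" using pos that by simp
        ultimately obtain q where q: "q \<in> K" "0 < q $ x" "0 < q $ y" "\<bar>q $ y - p $ y\<bar> < \<epsilon>"
          using p unfolding closure_iff_nhds_not_empty by blast
        have "q $ y \<noteq> p $ y"
        proof
          assume eq: "q $ y = p $ y"
          have "q = edge_point N x y (edge_length N x y * q $ y)"
            using q KG by (intro metric_graph_edge_coordinates(2)[OF N _ xy]) auto
          also note eq
          also have "edge_point N x y (edge_length N x y * p $ y) = p"
            by (rule metric_graph_edge_coordinates(2)[OF N pG xy pos, symmetric])
          finally show False using False q by simp
        qed
        then show ?thesis using q by blast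
      qed
      consider "\<And>\<epsilon>. 0 < \<epsilon> \<Longrightarrow> \<exists>q\<in>K. 0 < q $ x \<and> p $ y < q $ y \<and> q $ y < p $ y + \<epsilon>"
        | "\<And>\<epsilon>. 0 < \<epsilon> \<Longrightarrow> \<exists>q\<in>K. 0 < q $ y \<and> p $ x < q $ x \<and> q $ x < p $ x + \<epsilon>"
      proof (cases "\<forall>\<epsilon>>0. \<exists>q\<in>K. 0 < q $ x \<and> p $ y < q $ y \<and> q $ y < p $ y + \<epsilon>")
        case True
        then show thesis using that(1) by blast
      next
        case False
        then obtain \<epsilon>\<^sub>0 where \<epsilon>\<^sub>0: "0 < \<epsilon>\<^sub>0" "\<And>q. q \<in> K \<Longrightarrow> 0 < q $ x \<Longrightarrow> p $ y < q $ y \<Longrightarrow> p $ y + \<epsilon>\<^sub>0 \<le> q $ y"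
          by (meson not_le)
        have "\<exists>q\<in>K. 0 < q $ y \<and> p $ x < q $ x \<and> q $ x < p $ x + \<epsilon>" if \<epsilon>: "0 < \<epsilon>" for \<epsilon>
        proof -
          obtain q where q: "q \<in> K" "0 < q $ x" "0 < q $ y" "q $ y \<noteq> p $ y" "\<bar>q $ y - p $ y\<bar> < min \<epsilon> \<epsilon>\<^sub>0"
            using near[of "min \<epsilon> \<epsilon>\<^sub>0"] \<epsilon> \<epsilon>\<^sub>0(1) by auto
          have "q $ x = 1 - q $ y" "p $ x = 1 - p $ y"
            using metric_graph_edge_coordinates(3)[OF N _ xy, of q] metric_graph_edge_coordinates(3)[OF N pG xy pos] q KG by auto
          moreover have "\<not> p $ y < q $ y" using \<epsilon>\<^sub>0(2)[OF q(1,2)] q(5) by auto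
          ultimately show ?thesis using q by (intro bexI[of _ q]) auto
        qed
        then show thesis by (rule that(2))
      qed
      then show ?thesis
      proof cases
        case 1
        then show ?thesis
          by (rule connected_subset_accumulating_along_edge[OF N Kc KG pG False xy pos])
      next
        case 2
        then show ?thesis
          by (rule connected_subset_accumulating_along_edge[OF N Kc KG pG False xy[symmetric] pos(2,1)])
      qed
    qed
    then obtain k' where k': "k' \<in> K" "closed_segment p k' \<subseteq> closure K" by blast
    have "path_component (closure K) p k'"
      unfolding path_component_def using k'(2) by (intro exI[of _ "linepath p k'"]) auto
    then show ?thesis using inside[OF k'(1)] path_component_trans by blast
  qed (rule inside)
qed

lemma excursion_cluster_in_first_passage_set:
  fixes N :: "'v::finite network"
  assumes N: "electrical_network N" and L: "continuous_on (metric_graph N) L"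
    and f: "continuous_on (metric_graph N) f"
    and K: "K \<in> components (positivity_set N L)" and p: "p \<in> closure K"
    and e: "continuous_on {0..} (snd e)" "trace e \<subseteq> metric_graph N" "snd e (fst e) \<in> boundary_points N" "trace e \<inter> K \<noteq> {}"
    and f_K: "\<And>q. q \<in> K \<Longrightarrow> 0 \<le> f q" and f_e: "\<And>q. q \<in> trace e \<Longrightarrow> 0 \<le> f q"
    and boundary: "\<And>x. x \<in> boundary N \<Longrightarrow> 0 \<le> f (vertex x)"
    and interior: "\<And>x. x \<notin> boundary N \<Longrightarrow> 0 < L (vertex x)"
  shows "p \<in> first_passage_set N 0 f"
proof -
  have KG: "K \<subseteq> metric_graph N" using in_components_subset[OF K] by (auto simp: positivity_set_def)
  have cKG: "closure K \<subseteq> metric_graph N" using KG closed_metric_graph[OF N] by (rule closure_minimal)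
  have "closed (metric_graph N \<inter> f -` {0..})"
    by (intro continuous_closed_preimage f closed_metric_graph[OF N]) simp
  then have "closure K \<subseteq> metric_graph N \<inter> f -` {0..}"
    using KG f_K by (intro closure_minimal) auto
  then have f_cK: "0 \<le> f q" if "q \<in> closure K" for q using that by auto
  show ?thesis
  proof (cases "p \<in> boundary_points N")
    case True
    then have "0 \<le> f p" using boundary by (auto simp: boundary_points_def)
    then show ?thesis
      using True cKG p unfolding first_passage_set_def
      by (auto intro!: exI[of _ "\<lambda>_. p"] simp: path_def path_image_def pathstart_def pathfinish_def)
  next
    case False
    obtain t where t: "0 \<le> t" "t \<le> fst e" "snd e t \<in> K" using e(4) by (auto simp: trace_def)
    have vert: "p \<in> K" if v: "p = vertex v" for v
    proof -
      have "v \<notin> boundary N" using False v by (auto simp: boundary_points_def)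
      then have pU: "p \<in> positivity_set N L"
        using interior v by (auto simp: positivity_set_def vertex_in_metric_graph)
      obtain k where k: "k \<in> K" using t by auto
      have "connected (insert p K)"
        by (rule connected_intermediate_closure[OF in_components_connected[OF K]]) (use p closure_subset in auto)
      then have "insert p K \<subseteq> K"
        using components_maximal[OF K, of "insert p K"] pU in_components_subset[OF K] k by auto
      then show "p \<in> K" by auto
    qed
    have "path_component (closure K) p (snd e t)"
      by (rule component_closure_path_accessible[OF N L K t(3) p vert])
    moreover have "path_component (trace e) (snd e t) (snd e (fst e))"
    proof -
      have "path_connected (snd e ` {t..fst e})"
        using t by (intro path_connected_continuous_image continuous_on_subset[OF e(1)] convex_imp_path_connected) auto
      then have "path_component (snd e ` {t..fst e}) (snd e t) (snd e (fst e))"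
        using t by (auto simp: path_connected_component)
      then show ?thesis
        by (rule path_component_of_subset[rotated]) (use t in \<open>auto simp: trace_def\<close>)
    qed
    ultimately have "path_component (closure K \<union> trace e) p (snd e (fst e))"
      by (meson Un_upper1 Un_upper2 path_component_of_subset path_component_trans)
    then obtain \<gamma> where \<gamma>: "path \<gamma>" "path_image \<gamma> \<subseteq> closure K \<union> trace e" "pathstart \<gamma> = p" "pathfinish \<gamma> = snd e (fst e)"
      by (auto simp: path_component_def)
    then have "path_image \<gamma> \<subseteq> metric_graph N" "\<forall>q\<in>path_image \<gamma>. - 0 \<le> f q"
      using cKG e(2) f_cK f_e by auto
    then show ?thesis using \<gamma> e(3) p cKG unfolding first_passage_set_def by auto
  qed
qed

text \<open>
  An excursion meeting the trace of a cluster intersects one of its paths and hence belongs to the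
  cluster.
\<close>

lemma excursion_clusters_eq_components:
  fixes L\<^sub>0 X :: "'v::finite lifetime_path set"
  assumes eq: "cluster_trace ` clusters (L\<^sub>0 \<union> X) = \<K>" and life: "\<And>w. w \<in> X \<Longrightarrow> 0 \<le> fst w"
  shows "cluster_trace ` {C \<in> clusters (L\<^sub>0 \<union> X). C \<inter> X \<noteq> {}} = {K \<in> \<K>. contains_excursion X K}"
proof (intro equalityI subsetI)
  fix K assume "K \<in> cluster_trace ` {C \<in> clusters (L\<^sub>0 \<union> X). C \<inter> X \<noteq> {}}"
  then obtain C w where C: "C \<in> clusters (L\<^sub>0 \<union> X)" "w \<in> C" "w \<in> X" "K = cluster_trace C" by auto
  have "trace w \<subseteq> K" "trace w \<noteq> {}" using C life[OF C(3)] by (auto simp: cluster_trace_def trace_def)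
  then show "K \<in> {K \<in> \<K>. contains_excursion X K}"
    using C eq unfolding contains_excursion_def by blast
next
  fix K assume "K \<in> {K \<in> \<K>. contains_excursion X K}"
  then obtain C e where C: "C \<in> clusters (L\<^sub>0 \<union> X)" "K = cluster_trace C" and e: "e \<in> X" "trace e \<inter> K \<noteq> {}"
    using eq unfolding contains_excursion_def by blast
  define R where "R = {(w1, w2). w1 \<in> L\<^sub>0 \<union> X \<and> w2 \<in> L\<^sub>0 \<union> X \<and> trace w1 \<inter> trace w2 \<noteq> {}}"
  have C': "C \<in> (L\<^sub>0 \<union> X) // {(w, w') \<in> (L\<^sub>0 \<union> X) \<times> (L\<^sub>0 \<union> X). (w, w') \<in> R\<^sup>*}"
    using C(1) by (simp add: clusters_def R_def)
  obtain w\<^sub>0 where w\<^sub>0: "w\<^sub>0 \<in> L\<^sub>0 \<union> X" "C = {(w, w') \<in> (L\<^sub>0 \<union> X) \<times> (L\<^sub>0 \<union> X). (w, w') \<in> R\<^sup>*} `` {w\<^sub>0}"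
    using C' by (rule quotientE)
  obtain w where w: "w \<in> C" "trace e \<inter> trace w \<noteq> {}" using e(2) C(2) by (auto simp: cluster_trace_def)
  then have "w \<in> L\<^sub>0 \<union> X" "(w\<^sub>0, w) \<in> R\<^sup>*" using w\<^sub>0(2) by auto
  moreover have "(w, e) \<in> R" using \<open>w \<in> L\<^sub>0 \<union> X\<close> e(1) w(2) by (auto simp: R_def)
  ultimately have "e \<in> C" using w\<^sub>0 e(1) by (auto intro: rtrancl_into_rtrancl)
  then show "K \<in> cluster_trace ` {C \<in> clusters (L\<^sub>0 \<union> X). C \<inter> X \<noteq> {}}"
    using C e(1) by blast
qed

text \<open>
  The theorem for one realisation, under the properties that hold almost surely.
\<close>

lemma first_passage_set_eq_excursion_clusters:
  fixes N :: "'v::finite network" and f \<sigma> l\<^sub>1 l\<^sub>2 :: "real ^ 'v \<Rightarrow> real"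
  defines "L \<equiv> \<lambda>q. l\<^sub>1 q + l\<^sub>2 q"
  assumes N: "electrical_network N" and f: "continuous_on (metric_graph N) f"
    and loc: "total_local_time N X\<^sub>0 l\<^sub>1" "total_local_time N X l\<^sub>2"
    and X: "\<And>e. e \<in> X \<Longrightarrow> e \<in> space (lifetime_paths N) \<and> snd e (fst e) \<in> boundary_points N"
    and coupling: "\<And>q. q \<in> metric_graph N \<Longrightarrow> f q = \<sigma> q * sqrt 2 * sqrt (L q)"
    and sign: "\<And>K q. K \<in> components (positivity_set N L) \<Longrightarrow> contains_excursion X K \<Longrightarrow> q \<in> K \<Longrightarrow> \<sigma> q = 1"
    and boundary: "\<And>x. x \<in> boundary N \<Longrightarrow> 0 \<le> f (vertex x) \<and> l\<^sub>2 (vertex x) = (f (vertex x))\<^sup>2 / 2"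
    and interior: "\<And>x. x \<notin> boundary N \<Longrightarrow> f (vertex x) \<noteq> 0"
    and touch: "\<And>x y s \<epsilon>. (x, y) \<in> edges N \<Longrightarrow> 0 < s \<Longrightarrow> s < edge_length N x y \<Longrightarrow>
      f (edge_point N x y s) = 0 \<Longrightarrow> 0 < \<epsilon> \<Longrightarrow> \<exists>r. \<bar>r - s\<bar> < \<epsilon> \<and> 0 < r \<and> r < edge_length N x y \<and> f (edge_point N x y r) < 0"
    and steep: "\<And>x y \<epsilon>. x \<in> boundary N \<Longrightarrow> f (vertex x) = 0 \<Longrightarrow> (x, y) \<in> edges N \<Longrightarrow> 0 < \<epsilon> \<Longrightarrow>
      \<exists>s. 0 < s \<and> s < \<epsilon> \<and> f (edge_point N x y s) < 0"
  shows "first_passage_set N 0 f =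
    (\<Union>K \<in> {K \<in> components (positivity_set N L). contains_excursion X K}. closure K) \<union> boundary_points N"
proof -
  have l: "0 \<le> l\<^sub>1 q" "0 \<le> l\<^sub>2 q" if "q \<in> metric_graph N" for q
    using loc that by (auto simp: total_local_time_def)
  have L: "continuous_on (metric_graph N) L"
    using loc unfolding L_def total_local_time_def by (intro continuous_intros) auto
  have L_pos: "0 < L q" if "q \<in> metric_graph N" "f q \<noteq> 0" for q
    using coupling[OF that(1)] l[OF that(1)] that(2) by (cases "L q = 0") (auto simp: L_def)
  have f_pos: "0 \<le> f q" if "q \<in> metric_graph N" "\<sigma> q = 1" for q
    using coupling[OF that(1)] l[OF that(1)] that(2) by (simp add: L_def)
  show ?thesis
  proof (intro equalityI subsetI)
    fix p assume p: "p \<in> first_passage_set N 0 f"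
    show "p \<in> (\<Union>K \<in> {K \<in> components (positivity_set N L). contains_excursion X K}. closure K) \<union> boundary_points N"
    proof (cases "p \<in> boundary_points N")
      case False
      have "\<exists>K\<in>components (positivity_set N L). contains_excursion X K \<and> p \<in> closure K"
      proof (rule first_passage_point_in_excursion_cluster[OF N p False touch interior steep loc(2)])
        show "l\<^sub>2 q \<le> L q" if "q \<in> metric_graph N" for q
          using l[OF that] by (simp add: L_def)
        show "0 < L q" if "q \<in> metric_graph N" "0 < f q" for q
          using L_pos that by auto
        show "0 < l\<^sub>2 (vertex x)" if "x \<in> boundary N" "0 < f (vertex x)" for x
          using boundary[OF that(1)] zero_less_power[OF that(2), of 2] by linarith
      qed
      then show ?thesis by blast
    qed auto
  next
    fix p assume "p \<in> (\<Union>K \<in> {K \<in> components (positivity_set N L). contains_excursion X K}. closure K) \<union> boundary_points N"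
    then consider K where "K \<in> components (positivity_set N L)" "contains_excursion X K" "p \<in> closure K"
      | x where "x \<in> boundary N" "p = vertex x"
      by (auto simp: boundary_points_def)
    then show "p \<in> first_passage_set N 0 f"
    proof cases
      case 1
      then obtain e where e: "e \<in> X" "trace e \<inter> K \<noteq> {}" by (auto simp: contains_excursion_def)
      note path = lifetime_pathD[of e N]
      have eN: "e \<in> space (lifetime_paths N)" "snd e (fst e) \<in> boundary_points N" using X[OF e(1)] by auto
      show ?thesis
      proof (rule excursion_cluster_in_first_passage_set[OF N L f 1(1,3) path(2,3)[OF eN(1)] eN(2) e(2)])
        show "0 \<le> f q" if "q \<in> K" for q
          using sign[OF 1(1,2) that] in_components_subset[OF 1(1)] that
          by (intro f_pos) (auto simp: positivity_set_def)
        show "0 \<le> f q" if q: "q \<in> trace e" for q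
        proof -
          have qG: "q \<in> metric_graph N" using path(3)[OF eN(1)] q by auto
          show ?thesis
          proof (cases "L q = 0")
            case False
            let ?K = "connected_component_set (positivity_set N L) q"
            have qL: "q \<in> positivity_set N L" using False l[OF qG] qG by (auto simp: positivity_set_def L_def)
            then have "?K \<in> components (positivity_set N L)" by (rule componentsI)
            moreover have "q \<in> ?K" using qL by simp
            moreover from this have "contains_excursion X ?K" using e(1) q unfolding contains_excursion_def by blast
            ultimately have "\<sigma> q = 1" by (intro sign)
            then show ?thesis using qG by (intro f_pos)
          qed (use coupling[OF qG] in simp)
        qed
        show "0 \<le> f (vertex x)" if "x \<in> boundary N" for x
          using boundary[OF that] by simp
        show "0 < L (vertex x)" if "x \<notin> boundary N" for x
          by (rule L_pos[OF vertex_in_metric_graph interior[OF that]])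
      qed
    next
      case 2
      then show ?thesis
        using boundary[OF 2(1)] vertex_in_metric_graph[of x N] unfolding first_passage_set_def boundary_points_def
        by (auto intro!: exI[of _ "\<lambda>_. p"] simp: path_def path_image_def pathstart_def pathfinish_def)
    qed
  qed
qed

theorem proposition2p5:
  fixes N :: "'v::finite network"
    and u :: "'v \<Rightarrow> real"
    and P :: "real ^ 'v \<Rightarrow> (real \<Rightarrow> real ^ 'v) measure"
    and p :: "real \<Rightarrow> real ^ 'v \<Rightarrow> real ^ 'v \<Rightarrow> real"
    and Br :: "real \<Rightarrow> real ^ 'v \<Rightarrow> real ^ 'v \<Rightarrow> 'v lifetime_path measure"
    and \<nu> :: "'v \<Rightarrow> 'v lifetime_path measure"
    and M :: "'w measure"
    and \<L> \<Xi> :: "'w \<Rightarrow> 'v lifetime_path set"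
    and l\<^sub>\<L> l\<^sub>\<Xi> \<sigma> \<phi> :: "'w \<Rightarrow> real ^ 'v \<Rightarrow> real"
  defines "\<mu>\<^sub>\<L> \<equiv> \<lambda>B. loop_measure N p Br B / 2"
    and "\<mu>\<^sub>\<Xi> \<equiv> boundary_excursion_measure N u \<nu>"
    and "L \<equiv> \<lambda>\<omega> x. l\<^sub>\<L> \<omega> x + l\<^sub>\<Xi> \<omega> x"
  defines "\<E>\<^sub>\<L> \<equiv> point_process_events M (lifetime_paths N) \<mu>\<^sub>\<L> \<L>"
    and "\<E>\<^sub>\<Xi> \<equiv> point_process_events M (lifetime_paths N) \<mu>\<^sub>\<Xi> \<Xi>"
  assumes network: "electrical_network N"
    and harmonic: "boundary_condition N u" and nonneg: "\<forall>x\<in>boundary N. 0 \<le> u x"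
    and X: "diffusion N P" and p: "transition_density N P p" and Br: "bridges N P p Br"
    and exc: "\<forall>x\<in>boundary N. excursion_measure N P x (\<nu> x)"
    and M: "prob_space M"
    and loop_soup: "poisson_point_process M (lifetime_paths N) \<mu>\<^sub>\<L> \<L>"
    and excursions: "poisson_point_process M (lifetime_paths N) \<mu>\<^sub>\<Xi> \<Xi>"
    and indep: "prob_space.indep_set M (sigma_sets (space M) \<E>\<^sub>\<L>) (sigma_sets (space M) \<E>\<^sub>\<Xi>)"
    and loc_loops: "AE \<omega> in M. total_local_time N (\<L> \<omega>) (l\<^sub>\<L> \<omega>)"
    and loc_exc: "AE \<omega> in M. total_local_time N (\<Xi> \<omega>) (l\<^sub>\<Xi> \<omega>) \<and>
           (\<forall>x\<in>boundary N. l\<^sub>\<Xi> \<omega> (vertex x) = (u x)\<^sup>2 / 2)"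
    and sign: "cluster_sign M N (sigma_sets (space M) (\<E>\<^sub>\<L> \<union> \<E>\<^sub>\<Xi>)) \<Xi> L \<sigma>"
    and gff: "metric_graph_gff M N \<phi>"
    and coupling: "AE \<omega> in M. \<forall>x\<in>metric_graph N.
           \<phi> \<omega> x + interpolate u x = \<sigma> \<omega> x * sqrt 2 * sqrt (L \<omega> x)"
  shows "AE \<omega> in M.
     first_passage_set N 0 (\<lambda>x. \<phi> \<omega> x + interpolate u x) =
       (\<Union>K \<in> {K \<in> components (positivity_set N (L \<omega>)). contains_excursion (\<Xi> \<omega>) K}. closure K)
         \<union> boundary_points N \<and>
     (cluster_trace ` clusters (\<L> \<omega> \<union> \<Xi> \<omega>) = components (positivity_set N (L \<omega>)) \<longrightarrow>
      first_passage_set N 0 (\<lambda>x. \<phi> \<omega> x + interpolate u x) =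
       (\<Union>C \<in> {C \<in> clusters (\<L> \<omega> \<union> \<Xi> \<omega>). C \<inter> \<Xi> \<omega> \<noteq> {}}. closure (cluster_trace C))
         \<union> boundary_points N)"
proof -
  define f where "f \<omega> p = \<phi> \<omega> p + interpolate u p" for \<omega> p
  have L_eq: "L \<omega> = (\<lambda>q. l\<^sub>\<L> \<omega> q + l\<^sub>\<Xi> \<omega> q)" for \<omega> by (simp add: L_def)
  have cont: "AE \<omega> in M. continuous_on (metric_graph N) (\<phi> \<omega>)"
    using gff by (simp add: metric_graph_gff_def)
  have sgn: "AE \<omega> in M. \<forall>K\<in>components (positivity_set N (L \<omega>)). contains_excursion (\<Xi> \<omega>) K \<longrightarrow> (\<forall>q\<in>K. \<sigma> \<omega> q = 1)"
    using conjunct1[OF conjunct2[OF sign[unfolded cluster_sign_def]]] by (rule eventually_mono) blast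
  have ends: "AE \<omega> in M. \<forall>e\<in>\<Xi> \<omega>. e \<in> space (lifetime_paths N) \<and> snd e (fst e) \<in> boundary_points N"
    using excursions unfolding \<mu>\<^sub>\<Xi>_def by (rule boundary_excursions_end_in_boundary[OF M])
  note touch = gff_edge_zeros_touched_by_negative_values[OF M network gff, of u, folded f_def]
  note steep = gff_negative_near_zero_boundary_values[OF M network gff, of u, folded f_def]
  note interior = gff_avoids_level_at_interior_vertices[OF M network gff, of "\<lambda>x. - u x"]
  have "AE \<omega> in M. first_passage_set N 0 (f \<omega>) =
       (\<Union>K \<in> {K \<in> components (positivity_set N (L \<omega>)). contains_excursion (\<Xi> \<omega>) K}. closure K)
         \<union> boundary_points N \<and>
     (cluster_trace ` clusters (\<L> \<omega> \<union> \<Xi> \<omega>) = components (positivity_set N (L \<omega>)) \<longrightarrow>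
      first_passage_set N 0 (f \<omega>) =
       (\<Union>C \<in> {C \<in> clusters (\<L> \<omega> \<union> \<Xi> \<omega>). C \<inter> \<Xi> \<omega> \<noteq> {}}. closure (cluster_trace C))
         \<union> boundary_points N)"
    using cont sgn ends touch steep interior gff_zero_on_boundary[OF gff] loc_loops loc_exc coupling
  proof eventually_elim
    case (elim \<omega>)
    have f_vertex: "f \<omega> (vertex x) = \<phi> \<omega> (vertex x) + u x" for x
      by (simp add: f_def interpolate_vertex)
    have fps: "first_passage_set N 0 (f \<omega>) =
       (\<Union>K \<in> {K \<in> components (positivity_set N (L \<omega>)). contains_excursion (\<Xi> \<omega>) K}. closure K)
         \<union> boundary_points N"
      unfolding L_eq
    proof (rule first_passage_set_eq_excursion_clusters[OF network _ elim(8), where \<sigma> = "\<sigma> \<omega>"])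
      show "continuous_on (metric_graph N) (f \<omega>)"
        unfolding f_def[abs_def] by (intro continuous_intros elim(1) continuous_interpolate)
      show "total_local_time N (\<Xi> \<omega>) (l\<^sub>\<Xi> \<omega>)" using elim(9) by blast
      show "e \<in> space (lifetime_paths N) \<and> snd e (fst e) \<in> boundary_points N" if "e \<in> \<Xi> \<omega>" for e
        using elim(3) that by blast
      show "f \<omega> q = \<sigma> \<omega> q * sqrt 2 * sqrt (l\<^sub>\<L> \<omega> q + l\<^sub>\<Xi> \<omega> q)" if "q \<in> metric_graph N" for q
        using elim(10) that by (simp add: f_def L_def)
      show "\<sigma> \<omega> q = 1" if "K \<in> components (positivity_set N (\<lambda>q. l\<^sub>\<L> \<omega> q + l\<^sub>\<Xi> \<omega> q))"
        "contains_excursion (\<Xi> \<omega>) K" "q \<in> K" for K q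
        using elim(2) that unfolding L_eq by blast
      show "0 \<le> f \<omega> (vertex x) \<and> l\<^sub>\<Xi> \<omega> (vertex x) = (f \<omega> (vertex x))\<^sup>2 / 2" if "x \<in> boundary N" for x
        using elim(7,9) nonneg that by (simp add: f_vertex)
      show "f \<omega> (vertex x) \<noteq> 0" if "x \<notin> boundary N" for x
        using elim(6) that by (auto simp: f_vertex)
      show "\<exists>r. \<bar>r - s\<bar> < \<epsilon> \<and> 0 < r \<and> r < edge_length N x y \<and> f \<omega> (edge_point N x y r) < 0"
        if "(x, y) \<in> edges N" "0 < s" "s < edge_length N x y" "f \<omega> (edge_point N x y s) = 0" "0 < \<epsilon>" for x y s \<epsilon>
        using elim(4) that by blast
      show "\<exists>s. 0 < s \<and> s < \<epsilon> \<and> f \<omega> (edge_point N x y s) < 0"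
        if "x \<in> boundary N" "f \<omega> (vertex x) = 0" "(x, y) \<in> edges N" "0 < \<epsilon>" for x y \<epsilon>
        using elim(5) that by blast
    qed
    moreover have "first_passage_set N 0 (f \<omega>) =
       (\<Union>C \<in> {C \<in> clusters (\<L> \<omega> \<union> \<Xi> \<omega>). C \<inter> \<Xi> \<omega> \<noteq> {}}. closure (cluster_trace C))
         \<union> boundary_points N"
      if "cluster_trace ` clusters (\<L> \<omega> \<union> \<Xi> \<omega>) = components (positivity_set N (L \<omega>))"
    proof -
      have "0 \<le> fst w" if "w \<in> \<Xi> \<omega>" for w using elim(3) that lifetime_pathD(1) by blast
      then have "{K \<in> components (positivity_set N (L \<omega>)). contains_excursion (\<Xi> \<omega>) K} =
          cluster_trace ` {C \<in> clusters (\<L> \<omega> \<union> \<Xi> \<omega>). C \<inter> \<Xi> \<omega> \<noteq> {}}"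
        by (rule excursion_clusters_eq_components[OF that, symmetric])
      then show ?thesis by (simp only: fps image_image)
    qed
    ultimately show ?case by blast
  qed
  then show ?thesis unfolding f_def .
qed

end
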